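(* Suppose $M$ is compact, $\nu>0$, $p\ge -4$, $q\ge\varrho_\nu(p)$, and either: (a) $\nu>1$ and $\sigma$ is a $\nu(1-p)$-Riemannian section of $\mathcal E$; or (b) $\nu=1$ and $\sigma$ is a strictly $(1-p)$-Riemannian section of $\mathcal E$. Then $\sigma$ is a $(p,q)$-harmonic section of $\mathcal E$ if and only if $\sigma$ is parallel ($\nabla\sigma=0$).
   Context: Setting: $(M,g)$ is a smooth, oriented, connected Riemannian manifold without boundary, and $\pi\colon\mathcal E\to M$ is a smooth oriented real vector bundle with a fibre metric $\langle\,,\rangle$ and a connection $\nabla$ for which the fibre metric is holonomy-invariant, i.e. $\nabla\langle\,,\rangle=0$. All sections are smooth. For a section $\sigma$, put $F=\tfrac12|\sigma|^2\colon M\to\mathbb R$, let $\nabla F$ be its gradient, and $|\nabla\sigma|^2=\sum_i|\nabla_{E_i}\sigma|^2$ for a local orthonormal tangent frame $\{E_i\}$. For $p,q\in\mathbb R$ define a symmetric 2-tensor on the total space $\mathcal E$ by $h_{p,q}(A,B)=g(d\pi(A),d\pi(B))+(1+|e|^2)^{-p}\big(\langle KA,KB\rangle+q\langle KA,e\rangle\langle KB,e\rangle\big)$ for $A,B\in T_e\mathcal E$, where $K\colon T\mathcal E\to\mathcal E$ is the connection map of $\nabla$. The vertical $(p,q)$-energy of $\sigma$ on compact $M$ (half the integral of the $h_{p,q}$-square norm of the vertical part of $d\sigma$) is $$E^v_{p,q}(\sigma)=\frac12\int_M\frac{1}{(1+|\sigma|^2)^p}\big(|\nabla\sigma|^2+q|\nabla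 F|^2\big)\,\mathrm{vol}(g).$$ $\sigma$ is a $(p,q)$-harmonic section of $\mathcal E$ if $\frac{d}{dt}\big|_{t=0}E^v_{p,q}(\sigma_t)=0$ for every smooth variation $\sigma_t$ of $\sigma_0=\sigma$ through sections of $\mathcal E$. For $r\in\mathbb R$, a section $\sigma$ is $r$-Riemannian if $r|\sigma(x)|^2\ge -1$ for all $x\in M$; an $r$-Riemannian section is strictly $r$-Riemannian if $r|\sigma(x)|^2>-1$ for some $x\in M$. For $\nu>0$ the function $\varrho_\nu\colon[-4,\infty)\to\mathbb R$ is defined by $\varrho_\nu(p)=-1-p$ if $-4\le p\le -1$; $\varrho_\nu(p)=0$ if $-1\le p\le 2$; $\varrho_\nu(p)=\nu(2-p)/2$ if $p\ge 2$. *)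

theory Defs
  imports "HOL-Analysis.Analysis" "HOL-Combinatorics.Permutations"
begin

section \<open>Smooth maps between Euclidean spaces\<close>

text \<open>\<open>Ck_on k S f\<close>: all iterated directional derivatives of \<open>f\<close> up to order \<open>k\<close> exist and are
  continuous on \<open>S\<close>.  Only meaningful for open \<open>S\<close> in a finite-dimensional space.\<close>

primrec Ck_on :: "nat \<Rightarrow> 'a::euclidean_space set \<Rightarrow> ('a \<Rightarrow> 'b::real_normed_vector) \<Rightarrow> bool" where
  "Ck_on 0 S f \<longleftrightarrow> continuous_on S f"
| "Ck_on (Suc k) S f \<longleftrightarrow>
     (\<forall>x\<in>S. f differentiable (at x)) \<and> (\<forall>v. Ck_on k S (\<lambda>x. frechet_derivative f (at x) v))"

definition smooth_on :: "'a::euclidean_space set \<Rightarrow> ('a \<Rightarrow> 'b::real_normed_vector) \<Rightarrow> bool" where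
  "smooth_on S f \<longleftrightarrow> (\<forall>k. Ck_on k S f)"


section \<open>Oriented smooth manifolds\<close>

text \<open>The underlying set of a manifold is a whole type \<open>'m\<close>; its dimension is \<open>CARD('n)\<close>.
  A chart is a pair of a domain and a coordinate map (irrelevant off the domain).\<close>

type_synonym ('m, 'n) chart = "'m set \<times> ('m \<Rightarrow> real^'n)"

abbreviation chart_inv :: "('m, 'n) chart \<Rightarrow> real^'n \<Rightarrow> 'm" where
  "chart_inv c \<equiv> inv_into (fst c) (snd c)"

locale oriented_manifold =
  fixes A :: "('m::{t2_space, second_countable_topology}, 'n::finite) chart set"
  assumes chart: "\<And>c. c \<in> A \<Longrightarrow> open (fst c) \<and> open (snd c ` fst c) \<and>
      homeomorphism (fst c) (snd c ` fst c) (snd c) (chart_inv c)"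
    and charts_cover: "(\<Union>c\<in>A. fst c) = UNIV"
    and smooth_transition: "\<And>c d. c \<in> A \<Longrightarrow> d \<in> A \<Longrightarrow>
      smooth_on (snd c ` (fst c \<inter> fst d)) (snd d \<circ> chart_inv c)"
    and oriented_transition: "\<And>c d y. c \<in> A \<Longrightarrow> d \<in> A \<Longrightarrow> y \<in> snd c ` (fst c \<inter> fst d) \<Longrightarrow>
      det (matrix (frechet_derivative (snd d \<circ> chart_inv c) (at y))) > 0"

definition smooth_fun :: "('m, 'n::finite) chart set \<Rightarrow> 'm set \<Rightarrow> ('m \<Rightarrow> real) \<Rightarrow> bool" where
  "smooth_fun A U f \<longleftrightarrow> (\<forall>c\<in>A. smooth_on (snd c ` (fst c \<inter> U)) (f \<circ> chart_inv c))"

text \<open>The tangent space at \<open>x\<close> is identified with \<open>real^'n\<close> by means of one preferred chart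
  \<open>chart_at A x\<close> around \<open>x\<close>.  The preferred chart need not vary continuously with \<open>x\<close>, so smoothness
  is always expressed through \<open>tangent_vec A c x w\<close>, the tangent vector at \<open>x\<close> whose components
  in the chart \<open>c\<close> are \<open>w\<close>.\<close>

definition chart_at :: "('m, 'n) chart set \<Rightarrow> 'm \<Rightarrow> ('m, 'n) chart" where
  "chart_at A x = (SOME c. c \<in> A \<and> x \<in> fst c)"

definition tangent_vec ::
  "('m, 'n::finite) chart set \<Rightarrow> ('m, 'n) chart \<Rightarrow> 'm \<Rightarrow> real^'n \<Rightarrow> real^'n" where
  "tangent_vec A c x w =
     frechet_derivative (snd (chart_at A x) \<circ> chart_inv c) (at (snd c x)) w"

definition differential ::
  "('m, 'n::finite) chart set \<Rightarrow> ('m \<Rightarrow> real) \<Rightarrow> 'm \<Rightarrow> real^'n \<Rightarrow> real" where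
  "differential A f x v =
     frechet_derivative (f \<circ> chart_inv (chart_at A x)) (at (snd (chart_at A x) x)) v"


section \<open>Riemannian metrics\<close>

definition inner_product_on :: "'v::real_vector set \<Rightarrow> ('v \<Rightarrow> 'v \<Rightarrow> real) \<Rightarrow> bool" where
  "inner_product_on V b \<longleftrightarrow>
     (\<forall>u\<in>V. \<forall>v\<in>V. b u v = b v u) \<and>
     (\<forall>u\<in>V. \<forall>v\<in>V. \<forall>w\<in>V. \<forall>s. b (s *\<^sub>R u + v) w = s * b u w + b v w) \<and>
     (\<forall>u\<in>V. u \<noteq> 0 \<longrightarrow> b u u > 0)"

locale riemannian_manifold = oriented_manifold A
  for A :: "('m::{t2_space, second_countable_topology}, 'n::finite) chart set" +
  fixes g :: "'m \<Rightarrow> real^'n \<Rightarrow> real^'n \<Rightarrow> real"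
  assumes connected_manifold: "connected (UNIV :: 'm set)"
    and metric_inner: "\<And>x. inner_product_on UNIV (g x)"
    and metric_smooth: "\<And>c w w'. c \<in> A \<Longrightarrow>
      smooth_fun A (fst c) (\<lambda>x. g x (tangent_vec A c x w) (tangent_vec A c x w'))"

definition gradient ::
  "('m, 'n::finite) chart set \<Rightarrow> ('m \<Rightarrow> real^'n \<Rightarrow> real^'n \<Rightarrow> real) \<Rightarrow> ('m \<Rightarrow> real) \<Rightarrow> 'm \<Rightarrow> real^'n" where
  "gradient A g f x = (THE v. \<forall>w. g x v w = differential A f x w)"

definition orthonormal_basis :: "(real^'n \<Rightarrow> real^'n \<Rightarrow> real) \<Rightarrow> ('n \<Rightarrow> real^'n) \<Rightarrow> bool" where
  "orthonormal_basis b e \<longleftrightarrow> (\<forall>i j. b (e i) (e j) = (if i = j then 1 else 0))"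

definition gram_matrix :: "('m, 'n::finite) chart set \<Rightarrow> ('m \<Rightarrow> real^'n \<Rightarrow> real^'n \<Rightarrow> real) \<Rightarrow>
    ('m, 'n) chart \<Rightarrow> 'm \<Rightarrow> real^'n^'n" where
  "gram_matrix A g c x =
     (\<chi> i j. g x (tangent_vec A c x (axis i 1)) (tangent_vec A c x (axis j 1)))"

text \<open>The Riemannian measure vol(g) has density \<open>sqrt (det (g\<^sub>i\<^sub>j))\<close> with respect to Lebesgue
  measure in every chart.  It is assembled from a countable cover by chart domains, made disjoint;
  by the change of variables formula the result does not depend on the chosen cover.  Integrating
  a function against the volume form in the given orientation amounts to integrating it against
  this measure.\<close>

definition chart_cover :: "('m, 'n) chart set \<Rightarrow> nat \<Rightarrow> ('m, 'n) chart" where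
  "chart_cover A = (SOME c. range c \<subseteq> A \<and> (\<Union>k. fst (c k)) = UNIV)"

definition riemannian_measure :: "('m::topological_space, 'n::finite) chart set \<Rightarrow>
    ('m \<Rightarrow> real^'n \<Rightarrow> real^'n \<Rightarrow> real) \<Rightarrow> 'm measure" where
  "riemannian_measure A g = measure_of UNIV (sets borel)
     (\<lambda>S. \<Sum>k. let c = chart_cover A k; S\<^sub>k = S \<inter> disjointed (\<lambda>j. fst (chart_cover A j)) k in
        \<integral>\<^sup>+ y \<in> snd c ` S\<^sub>k. ennreal (sqrt (det (gram_matrix A g c (chart_inv c y)))) \<partial>lborel)"


section \<open>Oriented vector bundles\<close>

text \<open>A bundle of rank \<open>r\<close> is given by its fibres \<open>E x\<close> and an atlas \<open>Fr\<close> of local frames, related by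
  smooth transition matrices of positive determinant.  The fibres are subspaces of one real
  vector space \<open>'v\<close>; this is merely a bookkeeping device (any family of vector spaces embeds
  in its direct sum), and no topology on \<open>'v\<close> is involved.\<close>

type_synonym ('m, 'v) frame = "'m set \<times> (nat \<Rightarrow> 'm \<Rightarrow> 'v)"

definition nat_det :: "nat \<Rightarrow> (nat \<Rightarrow> nat \<Rightarrow> real) \<Rightarrow> real" where
  "nat_det r a = (\<Sum>\<pi> | \<pi> permutes {..<r}. of_int (sign \<pi>) * (\<Prod>i<r. a i (\<pi> i)))"

locale oriented_vector_bundle = oriented_manifold A
  for A :: "('m::{t2_space, second_countable_topology}, 'n::finite) chart set" +
  fixes E :: "'m \<Rightarrow> 'v::real_vector set" and r :: nat and Fr :: "('m, 'v) frame set"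
  assumes frame_open: "\<And>U s. (U, s) \<in> Fr \<Longrightarrow> open U"
    and frames_cover: "(\<Union>F\<in>Fr. fst F) = UNIV"
    and frame_basis: "\<And>U s x. (U, s) \<in> Fr \<Longrightarrow> x \<in> U \<Longrightarrow>
      inj_on (\<lambda>i. s i x) {..<r} \<and> independent ((\<lambda>i. s i x) ` {..<r}) \<and>
      span ((\<lambda>i. s i x) ` {..<r}) = E x"
    and frame_transition: "\<And>U s V t. (U, s) \<in> Fr \<Longrightarrow> (V, t) \<in> Fr \<Longrightarrow>
      \<exists>a. (\<forall>i<r. \<forall>j<r. smooth_fun A (U \<inter> V) (a i j)) \<and>
          (\<forall>x\<in>U \<inter> V. (\<forall>j<r. t j x = (\<Sum>i<r. a i j x *\<^sub>R s i x)) \<and> nat_det r (\<lambda>i j. a i j x) > 0)"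

definition smooth_section :: "('m, 'n::finite) chart set \<Rightarrow> ('m \<Rightarrow> 'v::real_vector set) \<Rightarrow> nat \<Rightarrow>
    ('m, 'v) frame set \<Rightarrow> 'm set \<Rightarrow> ('m \<Rightarrow> 'v) \<Rightarrow> bool" where
  "smooth_section A E r Fr U \<sigma> \<longleftrightarrow> (\<forall>x\<in>U. \<sigma> x \<in> E x) \<and>
     (\<forall>(V, s)\<in>Fr. \<exists>a. (\<forall>i<r. smooth_fun A (U \<inter> V) (a i)) \<and>
        (\<forall>x\<in>U \<inter> V. \<sigma> x = (\<Sum>i<r. a i x *\<^sub>R s i x)))"

text \<open>A connection \<open>N\<close> acts on smooth sections over open sets: \<open>N \<sigma> x v\<close> is the covariant derivative
  of \<open>\<sigma>\<close> at \<open>x\<close> in the direction of the tangent vector \<open>v\<close>.  Locality is a consequence of the Leibniz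
  rule, with \<open>f\<close> the indicator function of \<open>U\<close>.\<close>

locale riemannian_vector_bundle =
  riemannian_manifold A g + oriented_vector_bundle A E r Fr
  for A :: "('m::{t2_space, second_countable_topology}, 'n::finite) chart set"
    and g :: "'m \<Rightarrow> real^'n \<Rightarrow> real^'n \<Rightarrow> real"
    and E :: "'m \<Rightarrow> 'v::real_vector set" and r :: nat and Fr :: "('m, 'v) frame set" +
  fixes h :: "'m \<Rightarrow> 'v \<Rightarrow> 'v \<Rightarrow> real"
    and N :: "('m \<Rightarrow> 'v) \<Rightarrow> 'm \<Rightarrow> real^'n \<Rightarrow> 'v"
  assumes fibre_metric_inner: "\<And>x. inner_product_on (E x) (h x)"
    and fibre_metric_smooth: "\<And>U s i j. (U, s) \<in> Fr \<Longrightarrow> i < r \<Longrightarrow> j < r \<Longrightarrow>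
      smooth_fun A U (\<lambda>x. h x (s i x) (s j x))"
    and connection_linear: "\<And>U \<sigma> x. open U \<Longrightarrow> smooth_section A E r Fr U \<sigma> \<Longrightarrow> x \<in> U \<Longrightarrow>
      linear (N \<sigma> x) \<and> range (N \<sigma> x) \<subseteq> E x"
    and connection_smooth: "\<And>U \<sigma> c w. open U \<Longrightarrow> smooth_section A E r Fr U \<sigma> \<Longrightarrow> c \<in> A \<Longrightarrow>
      smooth_section A E r Fr (U \<inter> fst c) (\<lambda>x. N \<sigma> x (tangent_vec A c x w))"
    and connection_add: "\<And>U \<sigma> \<tau> x v. open U \<Longrightarrow> smooth_section A E r Fr U \<sigma> \<Longrightarrow>
      smooth_section A E r Fr U \<tau> \<Longrightarrow> x \<in> U \<Longrightarrow>
      N (\<lambda>y. \<sigma> y + \<tau> y) x v = N \<sigma> x v + N \<tau> x v"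
    and connection_Leibniz: "\<And>U f \<sigma> x v. open U \<Longrightarrow> smooth_fun A U f \<Longrightarrow>
      smooth_section A E r Fr U \<sigma> \<Longrightarrow> x \<in> U \<Longrightarrow>
      N (\<lambda>y. f y *\<^sub>R \<sigma> y) x v = differential A f x v *\<^sub>R \<sigma> x + f x *\<^sub>R N \<sigma> x v"
    and connection_metric: "\<And>U \<sigma> \<tau> x v. open U \<Longrightarrow> smooth_section A E r Fr U \<sigma> \<Longrightarrow>
      smooth_section A E r Fr U \<tau> \<Longrightarrow> x \<in> U \<Longrightarrow>
      differential A (\<lambda>y. h y (\<sigma> y) (\<tau> y)) x v = h x (N \<sigma> x v) (\<tau> x) + h x (\<sigma> x) (N \<tau> x v)"

definition parallel :: "(('m \<Rightarrow> 'v::real_vector) \<Rightarrow> 'm \<Rightarrow> real^'n \<Rightarrow> 'v) \<Rightarrow> ('m \<Rightarrow> 'v) \<Rightarrow> bool" where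
  "parallel N \<sigma> \<longleftrightarrow> (\<forall>x v. N \<sigma> x v = 0)"


section \<open>The vertical energy and harmonic sections\<close>

definition covariant_norm_sq :: "('m \<Rightarrow> real^'n::finite \<Rightarrow> real^'n \<Rightarrow> real) \<Rightarrow>
    ('m \<Rightarrow> 'v \<Rightarrow> 'v \<Rightarrow> real) \<Rightarrow> (('m \<Rightarrow> 'v) \<Rightarrow> 'm \<Rightarrow> real^'n \<Rightarrow> 'v) \<Rightarrow> ('m \<Rightarrow> 'v) \<Rightarrow> 'm \<Rightarrow> real" where
  "covariant_norm_sq g h N \<sigma> x =
     (let e = (SOME e. orthonormal_basis (g x) e)
      in \<Sum>i\<in>UNIV. h x (N \<sigma> x (e i)) (N \<sigma> x (e i)))"

definition vertical_energy :: "('m::topological_space, 'n::finite) chart set \<Rightarrow>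
    ('m \<Rightarrow> real^'n \<Rightarrow> real^'n \<Rightarrow> real) \<Rightarrow> ('m \<Rightarrow> 'v \<Rightarrow> 'v \<Rightarrow> real) \<Rightarrow>
    (('m \<Rightarrow> 'v) \<Rightarrow> 'm \<Rightarrow> real^'n \<Rightarrow> 'v) \<Rightarrow> real \<Rightarrow> real \<Rightarrow> ('m \<Rightarrow> 'v) \<Rightarrow> real" where
  "vertical_energy A g h N p q \<sigma> =
     (let F = (\<lambda>x. 1/2 * h x (\<sigma> x) (\<sigma> x)); gradF = gradient A g F in
      1/2 * (LINT x|riemannian_measure A g.
        1 / (1 + h x (\<sigma> x) (\<sigma> x)) powr p *
          (covariant_norm_sq g h N \<sigma> x + q * g x (gradF x) (gradF x))))"

text \<open>A smooth variation is a family of sections \<open>\<Sigma> t\<close>, \<open>\<bar>t\<bar> < \<epsilon>\<close>, whose coefficients with respect to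
  local frames are jointly smooth in \<open>t\<close> and the coordinates of \<open>x\<close>.\<close>

definition smooth_variation :: "('m, 'n::finite) chart set \<Rightarrow> ('m \<Rightarrow> 'v::real_vector set) \<Rightarrow> nat \<Rightarrow>
    ('m, 'v) frame set \<Rightarrow> ('m \<Rightarrow> 'v) \<Rightarrow> real \<Rightarrow> (real \<Rightarrow> 'm \<Rightarrow> 'v) \<Rightarrow> bool" where
  "smooth_variation A E r Fr \<sigma> \<epsilon> \<Sigma> \<longleftrightarrow> \<epsilon> > 0 \<and> \<Sigma> 0 = \<sigma> \<and>
     (\<forall>t\<in>{-\<epsilon><..<\<epsilon>}. \<forall>x. \<Sigma> t x \<in> E x) \<and>
     (\<forall>c\<in>A. \<forall>(V, s)\<in>Fr. \<exists>a :: nat \<Rightarrow> real \<times> (real^'n) \<Rightarrow> real.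
        (\<forall>i<r. smooth_on ({-\<epsilon><..<\<epsilon>} \<times> snd c ` (fst c \<inter> V)) (a i)) \<and>
        (\<forall>t\<in>{-\<epsilon><..<\<epsilon>}. \<forall>x\<in>fst c \<inter> V. \<Sigma> t x = (\<Sum>i<r. a i (t, snd c x) *\<^sub>R s i x)))"

definition harmonic_section :: "('m::topological_space, 'n::finite) chart set \<Rightarrow>
    ('m \<Rightarrow> real^'n \<Rightarrow> real^'n \<Rightarrow> real) \<Rightarrow> ('m \<Rightarrow> 'v::real_vector set) \<Rightarrow> nat \<Rightarrow> ('m, 'v) frame set \<Rightarrow>
    ('m \<Rightarrow> 'v \<Rightarrow> 'v \<Rightarrow> real) \<Rightarrow> (('m \<Rightarrow> 'v) \<Rightarrow> 'm \<Rightarrow> real^'n \<Rightarrow> 'v) \<Rightarrow> real \<Rightarrow> real \<Rightarrow>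
    ('m \<Rightarrow> 'v) \<Rightarrow> bool" where
  "harmonic_section A g E r Fr h N p q \<sigma> \<longleftrightarrow> smooth_section A E r Fr UNIV \<sigma> \<and>
     (\<forall>\<epsilon> \<Sigma>. smooth_variation A E r Fr \<sigma> \<epsilon> \<Sigma> \<longrightarrow>
        ((\<lambda>t. vertical_energy A g h N p q (\<Sigma> t)) has_real_derivative 0) (at 0))"

definition riemannian_section :: "('m \<Rightarrow> 'v \<Rightarrow> 'v \<Rightarrow> real) \<Rightarrow> real \<Rightarrow> ('m \<Rightarrow> 'v) \<Rightarrow> bool" where
  "riemannian_section h \<rho> \<sigma> \<longleftrightarrow> (\<forall>x. \<rho> * h x (\<sigma> x) (\<sigma> x) \<ge> -1)"

definition strictly_riemannian_section ::
  "('m \<Rightarrow> 'v \<Rightarrow> 'v \<Rightarrow> real) \<Rightarrow> real \<Rightarrow> ('m \<Rightarrow> 'v) \<Rightarrow> bool" where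
  "strictly_riemannian_section h \<rho> \<sigma> \<longleftrightarrow>
     riemannian_section h \<rho> \<sigma> \<and> (\<exists>x. \<rho> * h x (\<sigma> x) (\<sigma> x) > -1)"

text \<open>Used for \<open>p \<ge> -4\<close> only.\<close>

definition varrho :: "real \<Rightarrow> real \<Rightarrow> real" where
  "varrho \<nu> p = (if p \<le> -1 then -1 - p else if p \<le> 2 then 0 else \<nu> * (2 - p) / 2)"

end

theory Submission
  imports Defs "HOL-Library.Landau_Symbols"
begin

text \<open>Write \<open>u = |\<sigma>|\<^sup>2\<close>, \<open>S = |\<nabla>\<sigma>|\<^sup>2\<close>, \<open>D = |\<nabla>F|\<^sup>2\<close>.  If \<open>\<sigma>\<close> is harmonic, the first variation along
  \<open>(1 + t f) \<sigma>\<close> with \<open>f = exp (c u)\<close> reads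
  \<open>0 = \<integral> f (1 + u)\<^sup>-\<^sup>p\<^sup>-\<^sup>1 ((1 + (1 - p) u) S + (2 c (1 + u) (1 + q u) + q (2 + (2 - p) u)) D)\<close>.
  The hypotheses give \<open>1 + (1 - p) u \<ge> 0\<close> and \<open>1 + q u \<ge> 1/2\<close>, so for large \<open>c\<close> the integrand is
  nonnegative, hence zero, and \<open>S\<close> vanishes wherever \<open>1 + (1 - p) u > 0\<close>; in the borderline case
  \<open>\<nu> = 1\<close> this set is everything because \<open>u\<close> is locally constant on it and \<open>M\<close> is connected.
  Conversely, for a variation \<open>\<sigma>\<^sub>t\<close> of a parallel section \<open>\<nabla>\<sigma>\<^sub>t\<close> is \<open>O(t)\<close> uniformly on the compact \<open>M\<close>, so
  the energy is \<open>O(t\<^sup>2)\<close>.\<close>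

section \<open>Smooth functions\<close>

text \<open>Because the variations stay along \<sigma>, stationarity is used directly in integrated
  form: neither an Euler-Lagrange equation nor a divergence theorem on M enters. With a constant
  multiplier the coefficient of \<open>D\<close> would be just \<open>q * (2 + (2 - p) * u)\<close>,
  whose sign is not controlled. An exponential multiplier satisfies df = c f du, and this derivative
  adds \<open>2 * c * (1 + u) * (1 + q * u)\<close>, which dominates once \<open>c\<close> is large.
  Being a function of \<open>u\<close> alone, \<open>f\<close> also keeps the energy density of the
  scaled section inside the quantities \<open>u\<close>, \<open>S\<close> and \<open>D\<close>. Much
  of the length is due to the encodings. \<open>covariant_norm_sq\<close> uses an orthonormal basis
  picked separately at each point, so its continuity has to be read off from Gram matrices in
  charts. The Riemannian measure is assembled from an arbitrary countable cover, and its finiteness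
  on compact M rests on the change of variables between charts.\<close>

lemma Ck_on_subset: "Ck_on k S f \<Longrightarrow> T \<subseteq> S \<Longrightarrow> Ck_on k T f"
proof (induction k arbitrary: f)
  case 0
  then show ?case by (auto intro: continuous_on_subset)
next
  case (Suc k)
  then show ?case by auto
qed

text \<open>A derivative \<open>at x\<close> sees a full neighbourhood of \<open>x\<close>, which
  openness of \<open>S\<close> places inside the set of agreement. Both functions then have the same
  \<open>has_derivative\<close> predicate, so even the choices behind
  \<open>frechet_derivative\<close> agree.\<close>

lemma Ck_on_cong:
  assumes "open S" "\<And>x. x \<in> S \<Longrightarrow> f x = g x"
  shows "Ck_on k S f \<longleftrightarrow> Ck_on k S g"
  using assms(2)
proof (induction k arbitrary: f g)
  case 0
  then show ?case by (auto intro: continuous_on_cong)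
next
  case (Suc k)
  have *: "(f has_derivative D) (at x) \<longleftrightarrow> (g has_derivative D) (at x)" if "x \<in> S" for x D
    using has_derivative_transform_within_open[OF _ assms(1) that] Suc.prems by metis
  then have 1: "f differentiable (at x) \<longleftrightarrow> g differentiable (at x)" if "x \<in> S" for x
    using that by (simp add: differentiable_def)
  have 2: "frechet_derivative f (at x) v = frechet_derivative g (at x) v" if "x \<in> S" for x v
    using * that by (simp add: frechet_derivative_def)
  show ?case
    using 1 Suc.IH[of "\<lambda>x. frechet_derivative f (at x) v" "\<lambda>x. frechet_derivative g (at x) v" for v] 2
    by simp
qed

lemma Ck_on_Suc_imp: "Ck_on (Suc k) S f \<Longrightarrow> Ck_on k S f"
proof (induction k arbitrary: f)
  case 0
  then show ?case
    by (auto intro: differentiable_imp_continuous_on simp: differentiable_on_def differentiable_at_withinI)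
next
  case (Suc k)
  then show ?case by (metis Ck_on.simps(2))
qed

text \<open>Only order 0 mentions the set in its filter, and there \<open>at x within S\<close>
  equals \<open>at x within (S \<inter> T)\<close> for an open neighbourhood \<open>T\<close>; at
  higher orders differentiability \<open>at x\<close> is a statement about the point alone.\<close>

lemma Ck_on_locally:
  assumes "\<And>x. x \<in> S \<Longrightarrow> \<exists>T. open T \<and> x \<in> T \<and> Ck_on k (S \<inter> T) f"
  shows "Ck_on k S f"
  using assms
proof (induction k arbitrary: f)
  case 0
  show ?case
    unfolding Ck_on.simps continuous_on_eq_continuous_within
  proof
    fix x assume "x \<in> S"
    with 0 obtain T where "open T" "x \<in> T" "continuous_on (S \<inter> T) f" by auto
    moreover have "at x within S = at x within (S \<inter> T)"
      by (rule at_within_nhd[of x T]) (use \<open>open T\<close> \<open>x \<in> T\<close> in auto)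
    ultimately show "continuous (at x within S) f"
      using \<open>x \<in> S\<close> by (auto simp: continuous_on_eq_continuous_within)
  qed
next
  case (Suc k)
  show ?case
    unfolding Ck_on.simps
  proof (intro conjI allI ballI)
    fix x assume "x \<in> S"
    with Suc.prems show "f differentiable (at x)" by fastforce
  next
    fix v show "Ck_on k S (\<lambda>x. frechet_derivative f (at x) v)"
      by (rule Suc.IH) (use Suc.prems in fastforce)
  qed
qed

lemma frechet_derivative_worksI:
  "f differentiable (at x) \<Longrightarrow> (f has_derivative frechet_derivative f (at x)) (at x)"
  by (simp add: frechet_derivative_works[symmetric])

text \<open>Uniqueness of derivatives replaces \<open>frechet_derivative\<close> by a closed formula
  \<open>D\<close>; the product, exponential and chain rules below are inductions whose step
  supplies such a formula.\<close>

lemma Ck_on_SucI: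
  assumes "open S" "\<And>x. x \<in> S \<Longrightarrow> (f has_derivative D x) (at x)"
    "\<And>v. Ck_on k S (\<lambda>x. D x v)"
  shows "Ck_on (Suc k) S f"
proof -
  have "frechet_derivative f (at x) = D x" if "x \<in> S" for x
    using assms(2)[OF that] by (metis frechet_derivative_at)
  then have "Ck_on k S (\<lambda>x. frechet_derivative f (at x) v)" for v
    using Ck_on_cong[OF assms(1), of "\<lambda>x. frechet_derivative f (at x) v" "\<lambda>x. D x v" k] assms(3) by simp
  then show ?thesis using assms(2) by (auto simp: differentiable_def)
qed

lemma Ck_on_const [simp]: "Ck_on k S (\<lambda>x. c)"
  by (induction k arbitrary: c) auto

lemma Ck_on_add:
  assumes "open S" shows "Ck_on k S f \<Longrightarrow> Ck_on k S g \<Longrightarrow> Ck_on k S (\<lambda>x. f x + g x)"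
proof (induction k arbitrary: f g)
  case 0
  then show ?case by (auto intro: continuous_intros)
next
  case (Suc k)
  show ?case
    by (rule Ck_on_SucI[OF assms, where D = "\<lambda>x v. frechet_derivative f (at x) v + frechet_derivative g (at x) v"])
      (use Suc in \<open>auto intro!: derivative_eq_intros simp: frechet_derivative_worksI\<close>)
qed

lemma Ck_on_mult:
  fixes f g :: "'a::euclidean_space \<Rightarrow> real"
  assumes "open S" shows "Ck_on k S f \<Longrightarrow> Ck_on k S g \<Longrightarrow> Ck_on k S (\<lambda>x. f x * g x)"
proof (induction k arbitrary: f g)
  case 0
  then show ?case by (auto intro: continuous_intros)
next
  case (Suc k)
  have "Ck_on k S f" "Ck_on k S g" using Suc.prems by (auto intro: Ck_on_Suc_imp simp del: Ck_on.simps)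
  with Suc show ?case
    by (intro Ck_on_SucI[OF assms, where D = "\<lambda>x v. f x * frechet_derivative g (at x) v + frechet_derivative f (at x) v * g x"])
      (auto intro!: has_derivative_mult Ck_on_add assms Suc.IH simp: frechet_derivative_worksI)
qed

lemma Ck_on_exp:
  fixes f :: "'a::euclidean_space \<Rightarrow> real"
  assumes "open S" shows "Ck_on k S f \<Longrightarrow> Ck_on k S (\<lambda>x. exp (f x))"
proof (induction k)
  case 0
  then show ?case by (auto intro: continuous_intros)
next
  case (Suc k)
  \<comment> \<open>The derivative of \<open>exp (f x)\<close> contains \<open>exp (f x)\<close>
    again; the induction hypothesis at order \<open>k\<close> supplies that factor.\<close>
  then have "Ck_on k S (\<lambda>x. exp (f x))" by (auto intro: Ck_on_Suc_imp simp del: Ck_on.simps)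
  with Suc show ?case
    by (intro Ck_on_SucI[OF assms, where D = "\<lambda>x v. exp (f x) * frechet_derivative f (at x) v"])
      (auto intro!: derivative_eq_intros Ck_on_mult assms simp: frechet_derivative_worksI)
qed

lemma Ck_on_sum:
  assumes "open S" "\<And>i. i \<in> I \<Longrightarrow> Ck_on k S (f i)"
  shows "Ck_on k S (\<lambda>x. \<Sum>i\<in>I. f i x)"
  using assms(2) by (induction I rule: infinite_finite_induct) (auto intro: Ck_on_add assms)

text \<open>Covers the projections of a product as well as the inclusions \<open>y \<mapsto> (t, y)\<close> of its slices.\<close>

lemma Ck_on_compose_affine:
  fixes L :: "'b::euclidean_space \<Rightarrow> 'a::euclidean_space" and f :: "'a \<Rightarrow> 'c::real_normed_vector"
  assumes "open T" "bounded_linear L" "\<And>y. y \<in> T \<Longrightarrow> b + L y \<in> S"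
  shows "Ck_on k S f \<Longrightarrow> Ck_on k T (\<lambda>y. f (b + L y))"
proof (induction k arbitrary: f)
  case 0
  have "continuous_on T (\<lambda>y. b + L y)"
    by (rule continuous_on_add[OF continuous_on_const linear_continuous_on[OF assms(2)]])
  with 0 show ?case
    using assms(3) by (auto intro!: continuous_on_compose2[of S f])
next
  case (Suc k)
  interpret bounded_linear L by fact
  show ?case
  proof (rule Ck_on_SucI[OF assms(1), where D = "\<lambda>y v. frechet_derivative f (at (b + L y)) (L v)"])
    fix y assume "y \<in> T"
    then have "f differentiable (at (b + L y))" using Suc assms(3) by auto
    then have *: "(f has_derivative frechet_derivative f (at (b + L y))) (at (b + L y))"
      by (simp add: frechet_derivative_worksI)
    have "((\<lambda>y. b + L y) has_derivative L) (at y)"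
      by (auto intro!: derivative_eq_intros bounded_linear_imp_has_derivative assms)
    from has_derivative_compose[OF this *]
    show "((\<lambda>y. f (b + L y)) has_derivative (\<lambda>v. frechet_derivative f (at (b + L y)) (L v))) (at y)" .
  next
    fix v show "Ck_on k T (\<lambda>y. frechet_derivative f (at (b + L y)) (L v))"
      using Suc by auto
  qed
qed

section \<open>Smooth maps: closure properties, slices of products, vanishing on a slice\<close>

lemma smooth_on_subset: "smooth_on S f \<Longrightarrow> T \<subseteq> S \<Longrightarrow> smooth_on T f"
  by (auto simp: smooth_on_def intro: Ck_on_subset)

lemma smooth_on_cong:
  "open S \<Longrightarrow> (\<And>x. x \<in> S \<Longrightarrow> f x = g x) \<Longrightarrow> smooth_on S f \<longleftrightarrow> smooth_on S g"
  using Ck_on_cong by (metis smooth_on_def)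

lemma smooth_on_const [simp]: "smooth_on S (\<lambda>x. c)"
  by (simp add: smooth_on_def)

lemma smooth_on_add: "open S \<Longrightarrow> smooth_on S f \<Longrightarrow> smooth_on S g \<Longrightarrow> smooth_on S (\<lambda>x. f x + g x)"
  by (auto simp: smooth_on_def intro: Ck_on_add)

lemma smooth_on_mult:
  fixes f g :: "'a::euclidean_space \<Rightarrow> real"
  shows "open S \<Longrightarrow> smooth_on S f \<Longrightarrow> smooth_on S g \<Longrightarrow> smooth_on S (\<lambda>x. f x * g x)"
  by (auto simp: smooth_on_def intro: Ck_on_mult)

lemma smooth_on_exp:
  fixes f :: "'a::euclidean_space \<Rightarrow> real"
  shows "open S \<Longrightarrow> smooth_on S f \<Longrightarrow> smooth_on S (\<lambda>x. exp (f x))"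
  by (auto simp: smooth_on_def intro: Ck_on_exp)

lemma smooth_on_sum:
  "open S \<Longrightarrow> (\<And>i. i \<in> I \<Longrightarrow> smooth_on S (f i)) \<Longrightarrow> smooth_on S (\<lambda>x. \<Sum>i\<in>I. f i x)"
  by (auto simp: smooth_on_def intro: Ck_on_sum)

lemma smooth_on_locally:
  "(\<And>x. x \<in> S \<Longrightarrow> \<exists>T. open T \<and> x \<in> T \<and> smooth_on (S \<inter> T) f) \<Longrightarrow> smooth_on S f"
  unfolding smooth_on_def
proof
  fix k assume *: "\<And>x. x \<in> S \<Longrightarrow> \<exists>T. open T \<and> x \<in> T \<and> (\<forall>k. Ck_on k (S \<inter> T) f)"
  show "Ck_on k S f"
    by (rule Ck_on_locally) (use * in metis)
qed

lemma smooth_on_differentiable: "smooth_on S f \<Longrightarrow> x \<in> S \<Longrightarrow> f differentiable (at x)"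
  unfolding smooth_on_def by (metis Ck_on.simps(2))

lemma smooth_on_has_derivative:
  "smooth_on S f \<Longrightarrow> x \<in> S \<Longrightarrow> (f has_derivative frechet_derivative f (at x)) (at x)"
  by (simp add: frechet_derivative_worksI smooth_on_differentiable)

lemma smooth_on_continuous: "smooth_on S f \<Longrightarrow> continuous_on S f"
  unfolding smooth_on_def by (metis Ck_on.simps(1))

lemma smooth_on_derivative: "smooth_on S f \<Longrightarrow> smooth_on S (\<lambda>x. frechet_derivative f (at x) v)"
  unfolding smooth_on_def by (metis Ck_on.simps(2))

lemma smooth_on_compose_snd:
  assumes "open T" "open S" "smooth_on S f"
  shows "smooth_on (T \<times> S) (\<lambda>z. f (snd z))"
  unfolding smooth_on_def
proof
  fix k show "Ck_on k (T \<times> S) (\<lambda>z. f (snd z))"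
    using Ck_on_compose_affine[of "T \<times> S" snd 0 S k f] assms
    by (auto simp: smooth_on_def bounded_linear_snd open_Times)
qed

lemma smooth_on_fst:
  assumes "open T"
  shows "smooth_on T (\<lambda>z::real \<times> 'b::euclidean_space. fst z)"
  unfolding smooth_on_def
proof
  have id: "Ck_on k UNIV (\<lambda>x::real. x)" for k
    by (cases k) (auto intro!: Ck_on_SucI[where D = "\<lambda>x v. v"] continuous_intros)
  fix k show "Ck_on k T (\<lambda>z::real \<times> 'b. fst z)"
    using Ck_on_compose_affine[of T fst 0 UNIV k "\<lambda>x. x", OF assms] id
    by (auto simp: bounded_linear_fst)
qed

lemma smooth_on_slice:
  fixes a :: "real \<times> 'b::euclidean_space \<Rightarrow> real"
  assumes "smooth_on (T \<times> S) a" "t \<in> T" "open S"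
  shows "smooth_on S (\<lambda>y. a (t, y))"
    "y \<in> S \<Longrightarrow> frechet_derivative (\<lambda>y. a (t, y)) (at y) w = frechet_derivative a (at (t, y)) (0, w)"
proof -
  have bl: "bounded_linear (\<lambda>y. (0::real, y::'b))"
    by (intro bounded_linear_Pair bounded_linear_zero bounded_linear_ident)
  show "smooth_on S (\<lambda>y. a (t, y))"
    unfolding smooth_on_def
  proof
    fix k show "Ck_on k S (\<lambda>y. a (t, y))"
      using Ck_on_compose_affine[of S "\<lambda>y. (0, y)" "(t, 0)" "T \<times> S" k a, OF assms(3) bl] assms
      by (auto simp: smooth_on_def)
  qed
  assume "y \<in> S"
  then have *: "(a has_derivative frechet_derivative a (at (t, y))) (at (t, y))"
    using assms by (intro smooth_on_has_derivative) auto
  have "((\<lambda>y. (t, y)) has_derivative (\<lambda>w. (0, w))) (at y)"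
    by (auto intro!: derivative_eq_intros)
  from has_derivative_compose[OF this *]
  show "frechet_derivative (\<lambda>y. a (t, y)) (at y) w = frechet_derivative a (at (t, y)) (0, w)"
    by (metis frechet_derivative_at)
qed

text \<open>Mean value theorem in the first variable: since \<open>b\<close> vanishes on the slice t
  = 0, its size is at most \<open>\<bar>t\<bar>\<close> times a bound for its derivative in
  \<open>t\<close> on a compact neighbourhood, uniformly in \<open>y\<close>. It is applied to the
  coefficients of covariant derivatives along a variation of a parallel section.\<close>

lemma smooth_on_vanishing_bigo:
  fixes b :: "real \<times> 'b::euclidean_space \<Rightarrow> real"
  assumes "smooth_on ({-e<..<e} \<times> S) b" "e > 0" "open S" "y0 \<in> S" "\<And>y. y \<in> S \<Longrightarrow> b (0, y) = 0"
  shows "b \<in> O[nhds (0, y0)](fst)"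
proof -
  let ?D = "\<lambda>z. frechet_derivative b (at z) (1, 0)"
  obtain d0 where d0: "d0 > 0" "cball y0 d0 \<subseteq> S" using assms open_contains_cball by blast
  \<comment> \<open>Halving \<open>e\<close> keeps the closed interval \<open>{-d..d}\<close> inside
    the open one, so that the derivative is bounded on a compact box.\<close>
  define d where "d = min d0 (e/2)"
  have d: "d > 0" "d < e" "cball y0 d \<subseteq> S" using d0 assms(2) by (auto simp: d_def)
  have cont: "continuous_on ({-d..d} \<times> cball y0 d) ?D"
    by (rule continuous_on_subset[OF smooth_on_continuous[OF smooth_on_derivative[OF assms(1)]]])
      (use d in auto)
  then have "bounded (?D ` ({-d..d} \<times> cball y0 d))"
    by (intro compact_imp_bounded compact_continuous_image) (auto intro: compact_Times)
  then obtain C where C: "C > 0" "\<And>z. z \<in> {-d..d} \<times> cball y0 d \<Longrightarrow> \<bar>?D z\<bar> \<le> C"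
    unfolding bounded_pos by auto
  have "\<bar>b (t, y)\<bar> \<le> C * \<bar>t\<bar>" if "\<bar>t\<bar> < d" "y \<in> ball y0 d" for t y
  proof -
    have der: "((\<lambda>t. b (t, y)) has_real_derivative ?D (s, y)) (at s within {-d..d})" if "s \<in> {-d..d}" for s
    proof -
      have "(s, y) \<in> {-e<..<e} \<times> S" using d that \<open>y \<in> ball y0 d\<close> by auto
      then have *: "(b has_derivative frechet_derivative b (at (s, y))) (at (s, y))"
        using smooth_on_has_derivative[OF assms(1)] by blast
      have 1: "((\<lambda>s. (s, y)) has_derivative (\<lambda>w. (w, 0))) (at s)"
        by (auto intro!: derivative_eq_intros)
      have 2: "((\<lambda>s. b (s, y)) has_derivative (\<lambda>w. frechet_derivative b (at (s, y)) (w, 0))) (at s)"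
        using has_derivative_compose[OF 1 *] .
      interpret linear "frechet_derivative b (at (s, y))"
        using * has_derivative_linear by blast
      have "(\<lambda>w. frechet_derivative b (at (s, y)) (w, 0)) = (*) (?D (s, y))"
      proof
        fix w show "frechet_derivative b (at (s, y)) (w, 0) = ?D (s, y) * w"
          using scaleR[of w "(1, 0)"] by (simp only: scaleR_Pair scaleR_zero_right real_scaleR_def mult_1_right mult_1_left mult.commute)
      qed
      with 2 show ?thesis
        by (auto simp: has_field_derivative_def intro: has_derivative_at_withinI)
    qed
    have "norm (b (t, y) - b (0, y)) \<le> C * norm (t - 0)"
    proof (rule field_differentiable_bound[of "{-d..d}" "\<lambda>t. b (t, y)" "\<lambda>s. ?D (s, y)"])
      fix s assume "s \<in> {-d..d}" then show "norm (?D (s, y)) \<le> C" using C(2)[of "(s, y)"] that by auto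
    qed (use der that in auto)
    moreover have "y \<in> S" using d that by auto
    ultimately show ?thesis using assms(5) by simp
  qed
  then have "\<forall>z\<in>{-d<..<d} \<times> ball y0 d. norm (b z) \<le> C * norm (fst z)" by auto
  moreover have "open ({-d<..<d} \<times> ball y0 d)" "(0, y0) \<in> {-d<..<d} \<times> ball y0 d"
    using d by (auto intro: open_Times)
  ultimately show ?thesis
    by (intro bigoI[of _ C]) (auto simp: eventually_nhds)
qed

lemma continuous_on_bigo_1:
  fixes f :: "'a::topological_space \<Rightarrow> real"
  assumes "continuous_on S f" "open S" "z \<in> S"
  shows "f \<in> O[nhds z](\<lambda>_. 1)"
proof (rule bigoI[of _ "\<bar>f z\<bar> + 1"])
  have "open (S \<inter> f -` ball (f z) 1)"
    using continuous_open_preimage[OF assms(1,2) open_ball] .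
  moreover have "z \<in> S \<inter> f -` ball (f z) 1" using assms by simp
  moreover have "\<forall>w\<in>S \<inter> f -` ball (f z) 1. norm (f w) \<le> (\<bar>f z\<bar> + 1) * norm (1::real)"
    by (auto simp: dist_real_def)
  ultimately show "\<forall>\<^sub>F w in nhds z. norm (f w) \<le> (\<bar>f z\<bar> + 1) * norm (1::real)"
    unfolding eventually_nhds by blast
qed

section \<open>Inner products on coordinate space\<close>

lemma orthonormal_basisD:
  "orthonormal_basis b e \<Longrightarrow> b (e i) (e j) = (if i = j then 1 else 0)"
  by (simp add: orthonormal_basis_def)

text \<open>The metric at a point is a further inner product on \<open>real^'n\<close> besides the
  standard one, so orthonormal bases, Riesz representation and Gram matrices are set up for an
  arbitrary form \<open>b\<close>.\<close>

locale inner_prod =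
  fixes b :: "real^'n::finite \<Rightarrow> real^'n \<Rightarrow> real"
  assumes ip: "inner_product_on UNIV b"
begin

lemma sym: "b u v = b v u"
  using ip by (simp add: inner_product_on_def)

lemma pos: "u \<noteq> 0 \<Longrightarrow> b u u > 0"
  using ip by (simp add: inner_product_on_def)

lemma linear_left: "linear (\<lambda>v. b v w)"
proof -
  have *: "b (s *\<^sub>R u + v) w = s * b u w + b v w" for s u v
    using ip unfolding inner_product_on_def by blast
  have z: "b 0 w = 0" using *[of 1 0 0] by simp
  show ?thesis
    by (rule linearI) (use *[of 1] *[of _ _ 0] z in simp_all)
qed

lemma linear_right: "linear (b w)"
  using linear_left[of w] sym by (metis (no_types, lifting) ext)

lemma left_simps: "b (u + v) w = b u w + b v w" "b (u - v) w = b u w - b v w" "b (s *\<^sub>R u) w = s * b u w"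
    "b (sum f I) w = (\<Sum>i\<in>I. b (f i) w)"
  using linear_add[OF linear_left] linear_diff[OF linear_left] linear_cmul[OF linear_left]
    linear_sum[OF linear_left] by auto

lemma right_simps: "b w (s *\<^sub>R u) = s * b w u" "b w (sum f I) = (\<Sum>i\<in>I. b w (f i))"
  using linear_cmul[OF linear_right] linear_sum[OF linear_right] by auto

lemma bilinear: "bilinear b"
  by (simp add: bilinear_def linear_left linear_right)

text \<open>A dimension count instead of explicit orthogonalisation: pairing with the vectors
  already found is a linear map whose image misses \<open>axis k 1\<close>, so it is not surjective,
  hence not injective, and a normalised kernel vector is the next basis element.\<close>

lemma ex_orthonormal: "\<exists>e. orthonormal_basis b e"
proof -
  have "\<exists>e. \<forall>i\<in>I. \<forall>j\<in>I. b (e i) (e j) = (if i = j then 1 else 0)" for I :: "'n set"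
  proof (induction I rule: finite_induct[OF finite])
    case 1 then show ?case by simp
  next
    case (2 k I)
    then obtain e where e: "\<And>i j. i \<in> I \<Longrightarrow> j \<in> I \<Longrightarrow> b (e i) (e j) = (if i = j then 1 else 0)" by metis
    let ?L = "\<lambda>v. (\<chi> i. if i \<in> I then b v (e i) else 0) :: real^'n"
    have L: "linear ?L"
      by (rule linearI) (auto simp: vec_eq_iff left_simps)
    have "\<not> surj ?L"
    proof
      assume "surj ?L"
      then obtain v where v: "axis k 1 = ?L v" unfolding surj_def by blast
      then have "(axis k 1 :: real^'n) $ k = ?L v $ k" by (rule arg_cong)
      with \<open>k \<notin> I\<close> show False by simp
    qed
    then have "\<not> inj ?L" using linear_injective_imp_surjective[OF L] by blast
    then obtain v where v: "?L v = 0" "v \<noteq> 0" using linear_injective_0[OF L] by auto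
    define w where "w = (1 / sqrt (b v v)) *\<^sub>R v"
    have bv: "b v (e i) = 0" if "i \<in> I" for i
      using arg_cong[OF v(1), of "\<lambda>x. x $ i"] that by simp
    have wI: "b w (e i) = 0" "b (e i) w = 0" if "i \<in> I" for i
      using bv[OF that] sym[of "e i" w] by (simp_all add: w_def left_simps)
    have "b w w = (1 / sqrt (b v v)) * ((1 / sqrt (b v v)) * b v v)"
      unfolding w_def left_simps right_simps by simp
    also have "\<dots> = 1" using pos[OF v(2)] by (simp add: field_simps)
    finally have ww: "b w w = 1" .
    have "\<forall>i\<in>insert k I. \<forall>j\<in>insert k I. b ((e(k := w)) i) ((e(k := w)) j) = (if i = j then 1 else 0)"
      using e wI ww \<open>k \<notin> I\<close> by auto
    then show ?case by blast
  qed
  from this[of UNIV] show ?thesis by (auto simp: orthonormal_basis_def)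
qed

lemma orthonormal_expansion:
  assumes "orthonormal_basis b e"
  shows "v = (\<Sum>i\<in>UNIV. b v (e i) *\<^sub>R e i)"
proof -
  let ?L = "\<lambda>c::real^'n. \<Sum>i\<in>UNIV. (c $ i) *\<^sub>R e i"
  have L: "linear ?L"
    by (rule linearI) (simp_all add: scaleR_add_left sum.distrib scaleR_sum_right)
  have coeff: "b (?L c) (e j) = c $ j" for c j
  proof -
    have "b (?L c) (e j) = (\<Sum>i\<in>UNIV. c $ i * b (e i) (e j))"
      by (simp add: left_simps)
    also have "\<dots> = c $ j" by (simp add: orthonormal_basisD[OF assms] if_distrib[where f="\<lambda>x. _ * x"] cong: if_cong)
    finally show ?thesis .
  qed
  have "inj ?L" by (rule injI) (metis coeff vec_eq_iff)
  then have "surj ?L" using linear_injective_imp_surjective[OF L] by blast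
  then obtain c where "v = ?L c" unfolding surj_def by blast
  with coeff show ?thesis by simp
qed

text \<open>The representing vector is
  \<open>\<Sum>i\<in>UNIV. \<omega> (e i) *\<^sub>R e i\<close>; positivity of \<open>b\<close>
  makes it unique, which justifies the \<open>THE\<close> in \<open>gradient\<close>. The second
  equation gives the squared norm of a gradient in any orthonormal basis.\<close>

lemma riesz:
  assumes e: "orthonormal_basis b e" and "linear \<omega>"
  defines "v \<equiv> (THE v. \<forall>w. b v w = \<omega> w)"
  shows "b v w = \<omega> w" "b v v = (\<Sum>i\<in>UNIV. (\<omega> (e i))\<^sup>2)"
proof -
  let ?v = "\<Sum>i\<in>UNIV. \<omega> (e i) *\<^sub>R e i"
  have 1: "b ?v w = \<omega> w" for w
  proof -
    have "b ?v w = (\<Sum>i\<in>UNIV. \<omega> (e i) * b w (e i))"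
      by (simp add: left_simps sym[of w])
    also have "\<dots> = \<omega> (\<Sum>i\<in>UNIV. b w (e i) *\<^sub>R e i)"
      by (simp add: linear_sum[OF assms(2)] linear_cmul[OF assms(2)] mult.commute)
    finally show ?thesis using orthonormal_expansion[OF e, of w] by simp
  qed
  have "v = ?v" unfolding v_def
  proof (rule the_equality)
    fix v' assume *: "\<forall>w. b v' w = \<omega> w"
    have "b (v' - ?v) (v' - ?v) = 0"
      using 1 * by (simp add: left_simps(2))
    then show "v' = ?v" using pos[of "v' - ?v"] by fastforce
  qed (use 1 in simp)
  with 1 show w: "b v w = \<omega> w" for w by simp
  have "b v v = \<omega> ?v" using w \<open>v = ?v\<close> by simp
  also have "\<dots> = (\<Sum>i\<in>UNIV. (\<omega> (e i))\<^sup>2)"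
    by (simp add: linear_sum[OF assms(2)] linear_cmul[OF assms(2)] power2_eq_square)
  finally show "b v v = (\<Sum>i\<in>UNIV. (\<omega> (e i))\<^sup>2)" .
qed

section \<open>Gram matrices of a general inner product\<close>

definition gram :: "('n \<Rightarrow> real^'n) \<Rightarrow> real^'n^'n" where
  "gram w = (\<chi> i j. b (w i) (w j))"

lemma gram_factor:
  assumes "orthonormal_basis b e"
  defines "P \<equiv> (\<lambda>w. (\<chi> i j. b (w i) (e j)))"
  shows "gram w = P w ** transpose (P w)"
proof -
  have "b (w i) (w j) = (\<Sum>k\<in>UNIV. b (w i) (e k) * b (w j) (e k))" for i j
  proof -
    have "b (w i) (w j) = b (\<Sum>k\<in>UNIV. b (w i) (e k) *\<^sub>R e k) (w j)"
      using orthonormal_expansion[OF assms(1), of "w i"] by simp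
    also have "\<dots> = (\<Sum>k\<in>UNIV. b (w i) (e k) * b (w j) (e k))"
      by (simp add: left_simps sym[of "w j"])
    finally show ?thesis .
  qed
  then show ?thesis
    by (simp add: gram_def P_def matrix_matrix_mult_def transpose_def)
qed

text \<open>With \<open>P\<close> the matrix of coordinates of the \<open>w i\<close> in the basis
  \<open>e\<close>, \<open>gram w = P ** transpose P\<close>, so
  \<open>transpose P ** Q ** P\<close> is the identity. The trace of \<open>B\<close> over an
  orthonormal basis thus has an expression in which that basis does not appear, only the
  \<open>w j\<close> and the inverse of their Gram matrix.\<close>

lemma trace_gram_inverse:
  assumes e: "orthonormal_basis b e" and Q: "gram w ** Q = mat 1" and B: "bilinear B"
  shows "(\<Sum>i\<in>UNIV. B (e i) (e i)) = (\<Sum>j\<in>UNIV. \<Sum>k\<in>UNIV. Q $ j $ k * B (w j) (w k))"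
proof -
  define P :: "real^'n^'n" where "P = (\<chi> i j. b (w i) (e j))"
  have "P ** (transpose P ** Q) = mat 1"
    using Q gram_factor[OF e, of w] by (simp add: P_def matrix_mul_assoc)
  \<comment> \<open>For square matrices a right inverse is also a left inverse.\<close>
  then have PQ: "(transpose P ** Q) ** P = mat 1"
    using matrix_left_right_inverse by blast
  have PQ': "(\<Sum>j\<in>UNIV. \<Sum>k\<in>UNIV. Q $ j $ k * P $ j $ i * P $ k $ l) = (if i = l then 1 else 0)" for i l
  proof -
    have "(if i = l then 1 else 0) = ((transpose P ** Q) ** P) $ i $ l"
      unfolding PQ by (simp add: mat_def)
    also have "\<dots> = (\<Sum>k\<in>UNIV. \<Sum>j\<in>UNIV. Q $ j $ k * P $ j $ i * P $ k $ l)"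
      by (simp add: matrix_matrix_mult_def transpose_def sum_distrib_right sum_distrib_left ac_simps)
    also have "\<dots> = (\<Sum>j\<in>UNIV. \<Sum>k\<in>UNIV. Q $ j $ k * P $ j $ i * P $ k $ l)"
      by (rule sum.swap)
    finally show ?thesis by simp
  qed
  have exp: "B (w j) (w k) = (\<Sum>i\<in>UNIV. \<Sum>l\<in>UNIV. P $ j $ i * P $ k $ l * B (e i) (e l))" for j k
  proof -
    have "B (w j) (w k) = B (\<Sum>i\<in>UNIV. b (w j) (e i) *\<^sub>R e i) (\<Sum>l\<in>UNIV. b (w k) (e l) *\<^sub>R e l)"
      using orthonormal_expansion[OF e] by simp
    also have "\<dots> = (\<Sum>(i,l)\<in>UNIV \<times> UNIV. P $ j $ i * P $ k $ l * B (e i) (e l))"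
      by (subst bilinear_sum[OF B])
        (auto intro!: sum.cong simp: P_def bilinear_lmul[OF B] bilinear_rmul[OF B])
    finally show ?thesis by (simp add: sum.cartesian_product)
  qed
  have "(\<Sum>j\<in>UNIV. \<Sum>k\<in>UNIV. Q $ j $ k * B (w j) (w k)) =
        (\<Sum>j\<in>UNIV. \<Sum>k\<in>UNIV. \<Sum>i\<in>UNIV. \<Sum>l\<in>UNIV. Q $ j $ k * P $ j $ i * P $ k $ l * B (e i) (e l))"
    by (simp add: exp sum_distrib_left mult.assoc)
  also have "\<dots> = (\<Sum>j\<in>UNIV. \<Sum>i\<in>UNIV. \<Sum>k\<in>UNIV. \<Sum>l\<in>UNIV. Q $ j $ k * P $ j $ i * P $ k $ l * B (e i) (e l))"
    by (intro sum.cong refl sum.swap)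
  also have "\<dots> = (\<Sum>i\<in>UNIV. \<Sum>j\<in>UNIV. \<Sum>k\<in>UNIV. \<Sum>l\<in>UNIV. Q $ j $ k * P $ j $ i * P $ k $ l * B (e i) (e l))"
    by (rule sum.swap)
  also have "\<dots> = (\<Sum>i\<in>UNIV. \<Sum>j\<in>UNIV. \<Sum>l\<in>UNIV. \<Sum>k\<in>UNIV. Q $ j $ k * P $ j $ i * P $ k $ l * B (e i) (e l))"
    by (intro sum.cong refl sum.swap)
  also have "\<dots> = (\<Sum>i\<in>UNIV. \<Sum>l\<in>UNIV. \<Sum>j\<in>UNIV. \<Sum>k\<in>UNIV. Q $ j $ k * P $ j $ i * P $ k $ l * B (e i) (e l))"
    by (intro sum.cong refl sum.swap)
  also have "\<dots> = (\<Sum>i\<in>UNIV. \<Sum>l\<in>UNIV. (if i = l then 1 else 0) * B (e i) (e l))"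
    unfolding PQ'[symmetric] by (simp add: sum_distrib_right)
  also have "\<dots> = (\<Sum>i\<in>UNIV. B (e i) (e i))"
    by (simp add: if_distrib[where f="\<lambda>x. x * _"] cong: if_cong)
  finally show ?thesis by simp
qed

text \<open>The determinant is the square of \<open>det P\<close> for the coordinate matrix
  \<open>P\<close> of the images of the axes. A nonzero \<open>c\<close> in the left kernel of
  \<open>P\<close> would make \<open>L c\<close> orthogonal to a whole orthonormal basis, against
  injectivity.\<close>

lemma det_gram_pos:
  fixes L :: "real^'n \<Rightarrow> real^'n"
  assumes "inj L" "linear L"
  shows "det (gram (\<lambda>i. L (axis i 1))) > 0"
proof -
  obtain e where e: "orthonormal_basis b e" using ex_orthonormal by blast
  define P :: "real^'n^'n" where "P = (\<chi> i j. b (L (axis i 1)) (e j))"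
  have "det (gram (\<lambda>i. L (axis i 1))) = (det P)\<^sup>2"
    using gram_factor[OF e] by (simp add: P_def det_mul power2_eq_square)
  moreover have "det P \<noteq> 0"
  proof
    assume "det P = 0"
    then obtain c where c: "c v* P = 0" "c \<noteq> 0"
      using invertible_det_nz[of "transpose P"] matrix_left_invertible_ker[of "transpose P"]
      by (auto simp: det_transpose invertible_left_inverse)
    have "b (L c) (e j) = 0" for j
    proof -
      have "b (L c) (e j) = b (L (\<Sum>i\<in>UNIV. c $ i *\<^sub>R axis i 1)) (e j)"
        using basis_expansion[of c] by (simp add: scalar_mult_eq_scaleR)
      also have "\<dots> = (c v* P) $ j"
        by (simp add: linear_sum[OF assms(2)] linear_cmul[OF assms(2)] left_simps P_def vector_matrix_mult_def mult.commute)
      finally show ?thesis using c by simp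
    qed
    then have "L c = 0" using orthonormal_expansion[OF e, of "L c"] by simp
    with assms c(2) show False by (metis linear_injective_0)
  qed
  ultimately show ?thesis by simp
qed

end

text \<open>Defined by Cramer's rule, so that continuity in the entries is evident.\<close>

definition cramer_inverse :: "real^'n^'n \<Rightarrow> real^'n^'n" where
  "cramer_inverse M = (\<chi> j k. det (\<chi> i l. if l = j then axis k 1 $ i else M $ i $ l) / det M)"

lemma cramer_inverse:
  assumes "det M \<noteq> 0" shows "M ** cramer_inverse M = mat 1"
proof -
  have "(M ** cramer_inverse M) $ i $ k = mat 1 $ i $ k" for i k
  proof -
    have "M *v (\<chi> j. cramer_inverse M $ j $ k) = axis k 1"
      using cramer[OF assms, of "\<chi> j. cramer_inverse M $ j $ k" "axis k 1"]
      by (simp add: cramer_inverse_def)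
    then have "(M *v (\<chi> j. cramer_inverse M $ j $ k)) $ i = axis k 1 $ i" by simp
    then show ?thesis
      by (simp add: matrix_matrix_mult_def matrix_vector_mult_def mat_def axis_def)
  qed
  then show ?thesis by (simp add: vec_eq_iff)
qed

lemma continuous_on_det:
  assumes "\<And>i j. continuous_on S (\<lambda>x. M x $ i $ j)"
  shows "continuous_on S (\<lambda>x. det (M x) :: real)"
  unfolding det_def
  by (intro continuous_on_sum continuous_on_mult continuous_on_const continuous_on_prod assms)

lemma continuous_on_cramer_inverse:
  assumes "\<And>i j. continuous_on S (\<lambda>x. M x $ i $ j)" "\<And>x. x \<in> S \<Longrightarrow> det (M x) \<noteq> 0"
  shows "continuous_on S (\<lambda>x. cramer_inverse (M x) $ j $ k)"
proof -
  have "continuous_on S (\<lambda>x. if l = j then axis k 1 $ i else M x $ i $ l)" for i l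
    using assms(1) by (cases "l = j") auto
  then show ?thesis
    unfolding cramer_inverse_def vec_lambda_beta
    using assms by (intro continuous_on_divide continuous_on_det; simp)
qed

section \<open>Change of variables for arbitrary finite index types\<close>

text \<open>The change of variables theorems of the library require a well-ordered index type.  A copy
  of the index type, ordered through an enumeration, removes this restriction.\<close>

typedef 'n enum_copy = "UNIV :: 'n set"
  by auto

instantiation enum_copy :: (countable) linorder
begin

definition less_eq_enum_copy :: "'a enum_copy \<Rightarrow> 'a enum_copy \<Rightarrow> bool" where
  "less_eq_enum_copy a b \<longleftrightarrow> to_nat (Rep_enum_copy a) \<le> to_nat (Rep_enum_copy b)"

definition less_enum_copy :: "'a enum_copy \<Rightarrow> 'a enum_copy \<Rightarrow> bool" where
  "less_enum_copy a b \<longleftrightarrow> to_nat (Rep_enum_copy a) < to_nat (Rep_enum_copy b)"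

instance
  by standard (auto simp: less_eq_enum_copy_def less_enum_copy_def Rep_enum_copy_inject)

end

instance enum_copy :: (countable) wellorder
proof
  fix P :: "'a enum_copy \<Rightarrow> bool" and a
  assume *: "\<And>x. (\<And>y. y < x \<Longrightarrow> P y) \<Longrightarrow> P x"
  show "P a"
    by (induction "to_nat (Rep_enum_copy a)" arbitrary: a rule: less_induct)
      (use * in \<open>auto simp: less_enum_copy_def\<close>)
qed

lemma bij_Abs_enum_copy: "bij Abs_enum_copy"
  by (rule bij_betw_byWitness[where f' = Rep_enum_copy])
    (auto simp: Rep_enum_copy_inverse Abs_enum_copy_inverse)

lemma bij_Rep_enum_copy: "bij Rep_enum_copy"
  by (rule bij_betw_byWitness[where f' = Abs_enum_copy])
    (auto simp: Rep_enum_copy_inverse Abs_enum_copy_inverse)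

instance enum_copy :: (finite) finite
proof
  show "finite (UNIV :: 'a enum_copy set)"
    by (metis bij_Abs_enum_copy bij_def finite finite_imageI)
qed

section \<open>Transport of Lebesgue measure and determinants to the ordered index type\<close>

definition to_copy :: "real^'n::finite \<Rightarrow> real^('n enum_copy)" where
  "to_copy v = (\<chi> i. v $ Rep_enum_copy i)"

definition of_copy :: "real^('n enum_copy) \<Rightarrow> real^'n::finite" where
  "of_copy v = (\<chi> i. v $ Abs_enum_copy i)"

lemma to_of_copy [simp]: "to_copy (of_copy v) = v"
  by (simp add: to_copy_def of_copy_def Rep_enum_copy_inverse vec_eq_iff)

lemma of_to_copy [simp]: "of_copy (to_copy v) = v"
  by (simp add: to_copy_def of_copy_def Abs_enum_copy_inverse vec_eq_iff)

lemma bounded_linear_to_copy: "bounded_linear to_copy"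
  by (intro linear_conv_bounded_linear[THEN iffD1] linearI) (auto simp: to_copy_def vec_eq_iff)

lemma bounded_linear_of_copy: "bounded_linear of_copy"
  by (intro linear_conv_bounded_linear[THEN iffD1] linearI) (auto simp: of_copy_def vec_eq_iff)

lemma measurable_to_copy [measurable]: "to_copy \<in> borel \<rightarrow>\<^sub>M borel"
  by (simp add: bounded_linear_to_copy linear_continuous_on borel_measurable_continuous_onI)

lemma measurable_of_copy [measurable]: "of_copy \<in> borel \<rightarrow>\<^sub>M borel"
  by (simp add: bounded_linear_of_copy linear_continuous_on borel_measurable_continuous_onI)

lemma prod_Basis_cart: "(\<Prod>b\<in>Basis. v \<bullet> b) = (\<Prod>i\<in>UNIV. v $ i)" for v :: "real^'k::finite"
proof -
  have "(Basis :: (real^'k) set) = range (\<lambda>i. axis i 1)"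
    by (auto simp: Basis_vec_def)
  moreover have "inj (\<lambda>i. axis i (1::real) :: real^'k)"
    by (simp add: inj_on_def axis_eq_axis)
  ultimately show ?thesis
    using prod.reindex[of "\<lambda>i. axis i 1" UNIV "(\<bullet>) v"] by (simp add: inner_axis comp_def)
qed

text \<open>Relabelling coordinates carries boxes to boxes with the same side lengths, and
  \<open>lborel\<close> is determined by its values on boxes.\<close>

lemma lborel_distr_to_copy: "distr lborel borel to_copy = (lborel :: (real^('n::finite enum_copy)) measure)"
proof (rule lborel_eqI[symmetric])
  fix l u :: "real^('n enum_copy)"
  assume lu: "\<And>b. b \<in> Basis \<Longrightarrow> l \<bullet> b \<le> u \<bullet> b"
  have le: "l $ i \<le> u $ i" for i
    using lu[of "axis i 1"] by (simp add: inner_axis axis_in_Basis_iff)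
  have "to_copy -` box l u = box (of_copy l) (of_copy u)"
    unfolding box_def Basis_vec_def to_copy_def of_copy_def
    by (auto simp: inner_axis) (metis Abs_enum_copy_inverse Rep_enum_copy_inverse UNIV_I)+
  then have "emeasure (distr lborel borel to_copy) (box l u) = emeasure lborel (box (of_copy l) (of_copy u))"
    by (simp add: emeasure_distr)
  also have "\<dots> = (\<Prod>b\<in>Basis. (of_copy u - of_copy l) \<bullet> b)"
    by (rule emeasure_lborel_box) (use le in \<open>auto simp: Basis_vec_def inner_axis of_copy_def\<close>)
  also have "\<dots> = (\<Prod>i\<in>UNIV. (u - l) $ Abs_enum_copy i)"
    by (simp add: prod_Basis_cart of_copy_def)
  also have "\<dots> = (\<Prod>i\<in>UNIV. (u - l) $ i)"
    using prod.reindex_bij_betw[OF bij_Abs_enum_copy, of "\<lambda>i. (u - l) $ i"] by simp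
  finally show "emeasure (distr lborel borel to_copy) (box l u) = (\<Prod>b\<in>Basis. (u - l) \<bullet> b)"
    by (simp add: prod_Basis_cart)
qed simp

lemma nn_integral_of_copy:
  assumes [measurable]: "G \<in> borel_measurable borel"
  shows "(\<integral>\<^sup>+x. G (of_copy x) \<partial>lborel) = (\<integral>\<^sup>+x. G x \<partial>lborel)"
proof -
  have "(\<integral>\<^sup>+x. G (of_copy x) \<partial>lborel) = (\<integral>\<^sup>+x. G (of_copy x) \<partial>distr lborel borel to_copy)"
    by (simp add: lborel_distr_to_copy)
  also have "\<dots> = (\<integral>\<^sup>+x. G x \<partial>lborel)"
    by (subst nn_integral_distr) auto
  finally show ?thesis .
qed

text \<open>Conjugation by the bijection of index types matches the two sets of permutations and
  preserves signs, so the Leibniz sums agree term by term.\<close>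

lemma det_enum_copy:
  fixes M :: "real^'n::finite^'n"
  shows "det (\<chi> i j. M $ Rep_enum_copy i $ Rep_enum_copy j) = det M"
proof -
  let ?A = "Abs_enum_copy :: 'n \<Rightarrow> 'n enum_copy" and ?R = "Rep_enum_copy :: 'n enum_copy \<Rightarrow> 'n"
  have bij: "bij_betw (map_permutation UNIV ?A) {p. p permutes UNIV} {p. p permutes UNIV}"
  proof (rule bij_betw_byWitness[where f' = "map_permutation UNIV ?R"])
    show "\<forall>p\<in>{p. p permutes UNIV}. map_permutation UNIV ?R (map_permutation UNIV ?A p) = p"
      using bij_Abs_enum_copy by (auto intro!: map_permutation_compose_inv simp: Abs_enum_copy_inverse)
    show "\<forall>p\<in>{p. p permutes UNIV}. map_permutation UNIV ?A (map_permutation UNIV ?R p) = p"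
      using bij_Rep_enum_copy by (auto intro!: map_permutation_compose_inv simp: Rep_enum_copy_inverse)
  qed (use bij_Abs_enum_copy bij_Rep_enum_copy in \<open>auto intro!: map_permutation_permutes\<close>)
  have mp: "map_permutation UNIV ?A p (?A i) = ?A (p i)" for p i
    using bij_Abs_enum_copy by (intro map_permutation_apply) (auto simp: bij_def)
  have "det (\<chi> i j. M $ ?R i $ ?R j) =
      (\<Sum>p | p permutes UNIV. of_int (sign (map_permutation UNIV ?A p)) *
         (\<Prod>i\<in>UNIV. M $ ?R i $ ?R (map_permutation UNIV ?A p i)))"
    unfolding det_def by (subst sum.reindex_bij_betw[OF bij, symmetric]) simp
  also have "\<dots> = (\<Sum>p | p permutes UNIV. of_int (sign p) * (\<Prod>i\<in>UNIV. M $ i $ p i))"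
  proof (rule sum.cong[OF refl])
    fix p :: "'n \<Rightarrow> 'n" assume "p \<in> {p. p permutes UNIV}"
    then have "sign (map_permutation UNIV ?A p) = sign p"
      using bij_Abs_enum_copy by (intro sign_map_permutation) (auto simp: bij_def)
    moreover have "(\<Prod>i\<in>UNIV. M $ ?R i $ ?R (map_permutation UNIV ?A p i)) = (\<Prod>i\<in>UNIV. M $ i $ p i)"
      using prod.reindex_bij_betw[OF bij_Abs_enum_copy, of "\<lambda>i. M $ ?R i $ ?R (map_permutation UNIV ?A p i)"]
      by (simp add: mp Abs_enum_copy_inverse)
    ultimately show "of_int (sign (map_permutation UNIV ?A p)) *
         (\<Prod>i\<in>UNIV. M $ ?R i $ ?R (map_permutation UNIV ?A p i)) = of_int (sign p) * (\<Prod>i\<in>UNIV. M $ i $ p i)"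
      by simp
  qed
  finally show ?thesis by (simp add: det_def)
qed

lemma matrix_copy: "matrix (\<lambda>x. to_copy (D (of_copy x))) =
    (\<chi> i j. matrix D $ Rep_enum_copy i $ Rep_enum_copy j)"
  for D :: "real^'n::finite \<Rightarrow> real^'n"
proof -
  have "of_copy (axis j 1) = axis (Rep_enum_copy j) 1" for j :: "'n enum_copy"
    by (auto simp: of_copy_def axis_def vec_eq_iff Rep_enum_copy_inverse Abs_enum_copy_inverse)
  then show ?thesis by (simp add: matrix_def to_copy_def)
qed

text \<open>\<open>cov_invertible_nonneg_eq\<close> speaks about gauge integrals with a given real
  value. Finiteness over \<open>S\<close> provides that value \<open>b\<close>, and nonnegativity of
  \<open>f\<close> permits the passage to the gauge integral on \<open>S\<close> and back to the
  nonnegative integral on \<open>T\<close>.\<close>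

lemma nn_integral_change_of_variables_wellorder:
  fixes f :: "real^'n::{finite,wellorder} \<Rightarrow> real" and \<psi> \<phi> :: "real^'n::_ \<Rightarrow> real^'n::_"
  assumes \<psi>: "\<And>x. x \<in> S \<Longrightarrow> (\<psi> has_derivative \<psi>' x) (at x)"
    and \<phi>: "\<And>y. y \<in> T \<Longrightarrow> (\<phi> has_derivative \<phi>' y) (at y)"
    and f: "\<And>y. y \<in> T \<Longrightarrow> 0 \<le> f y"
    and ST: "\<And>x. x \<in> S \<Longrightarrow> \<psi> x \<in> T \<and> \<phi> (\<psi> x) = x"
    and TS: "\<And>y. y \<in> T \<Longrightarrow> \<phi> y \<in> S \<and> \<psi> (\<phi> y) = y"
    and inv: "\<And>y. y \<in> T \<Longrightarrow> \<phi>' y \<circ> \<psi>' (\<phi> y) = id"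
    and meas: "(\<lambda>x. indicator S x * (\<bar>det (matrix (\<psi>' x))\<bar> * f (\<psi> x))) \<in> borel_measurable borel"
    and fin: "(\<integral>\<^sup>+x\<in>S. ennreal (\<bar>det (matrix (\<psi>' x))\<bar> * f (\<psi> x)) \<partial>lborel) < \<infinity>"
  shows "(\<integral>\<^sup>+y\<in>T. ennreal (f y) \<partial>lborel) = (\<integral>\<^sup>+x\<in>S. ennreal (\<bar>det (matrix (\<psi>' x))\<bar> * f (\<psi> x)) \<partial>lborel)"
proof -
  let ?F = "\<lambda>x. \<bar>det (matrix (\<psi>' x))\<bar> * f (\<psi> x)"
  obtain b where b: "b \<ge> 0" "(\<integral>\<^sup>+x\<in>S. ennreal (?F x) \<partial>lborel) = ennreal b"
    using fin by (cases "\<integral>\<^sup>+x\<in>S. ennreal (?F x) \<partial>lborel") auto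
  have "(\<integral>\<^sup>+x. ennreal (indicator S x * ?F x) \<partial>lborel) = (\<integral>\<^sup>+x\<in>S. ennreal (?F x) \<partial>lborel)"
    by (intro nn_integral_cong) (auto simp: indicator_def)
  with b have "((\<lambda>x. indicator S x * ?F x) has_integral b) UNIV"
    by (intro nn_integral_has_integral[OF meas]) (use f ST in \<open>auto simp: indicator_def\<close>)
  moreover have "(\<lambda>x. indicator S x * ?F x) = (\<lambda>x. if x \<in> S then ?F x else 0)"
    by auto
  ultimately have "(?F has_integral b) S"
    using has_integral_restrict_UNIV[of S ?F b] by simp
  then have "(f has_integral b) T"
    using cov_invertible_nonneg_eq[of S \<psi> \<psi>' T \<phi> \<phi>' f b] \<psi> \<phi> f ST TS inv
    by (auto intro: has_derivative_at_withinI)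
  from nn_integral_has_integral_lebesgue'[OF f this] b(2) show ?thesis by simp
qed

text \<open>All maps are conjugated with the relabelling of coordinates: by
  \<open>det_enum_copy\<close> the Jacobian determinants stay the same, and by
  \<open>nn_integral_of_copy\<close> so do the integrals.\<close>

lemma nn_integral_change_of_variables:
  fixes f :: "real^'n::finite \<Rightarrow> real" and \<psi> \<phi> :: "real^'n \<Rightarrow> real^'n"
  assumes \<psi>: "\<And>x. x \<in> S \<Longrightarrow> (\<psi> has_derivative \<psi>' x) (at x)"
    and \<phi>: "\<And>y. y \<in> T \<Longrightarrow> (\<phi> has_derivative \<phi>' y) (at y)"
    and f: "\<And>y. y \<in> T \<Longrightarrow> 0 \<le> f y"
    and ST: "\<And>x. x \<in> S \<Longrightarrow> \<psi> x \<in> T \<and> \<phi> (\<psi> x) = x"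
    and TS: "\<And>y. y \<in> T \<Longrightarrow> \<phi> y \<in> S \<and> \<psi> (\<phi> y) = y"
    and inv: "\<And>y. y \<in> T \<Longrightarrow> \<phi>' y \<circ> \<psi>' (\<phi> y) = id"
    and meas [measurable]: "(\<lambda>x. indicator S x * (\<bar>det (matrix (\<psi>' x))\<bar> * f (\<psi> x))) \<in> borel_measurable borel"
    and meas_f [measurable]: "(\<lambda>y. indicator T y * f y) \<in> borel_measurable borel"
    and fin: "(\<integral>\<^sup>+x\<in>S. ennreal (\<bar>det (matrix (\<psi>' x))\<bar> * f (\<psi> x)) \<partial>lborel) < \<infinity>"
  shows "(\<integral>\<^sup>+y\<in>T. ennreal (f y) \<partial>lborel) = (\<integral>\<^sup>+x\<in>S. ennreal (\<bar>det (matrix (\<psi>' x))\<bar> * f (\<psi> x)) \<partial>lborel)"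
proof -
  let ?F = "\<lambda>x. \<bar>det (matrix (\<psi>' x))\<bar> * f (\<psi> x)"
  define S' :: "(real^('n enum_copy)) set" where "S' = of_copy -` S"
  define T' :: "(real^('n enum_copy)) set" where "T' = of_copy -` T"
  define P where "P = (\<lambda>x. to_copy (\<psi> (of_copy x)))"
  define P' where "P' = (\<lambda>x v. to_copy (\<psi>' (of_copy x) (of_copy v)))"
  have det: "det (matrix (P' x)) = det (matrix (\<psi>' (of_copy x)))" for x
    unfolding P'_def matrix_copy det_enum_copy ..
  have der: "((\<lambda>x. to_copy (g (of_copy x))) has_derivative (\<lambda>v. to_copy (g' (of_copy v)))) (at x)"
    if "(g has_derivative g') (at (of_copy x))" for g g' and x :: "real^('n enum_copy)"
    using bounded_linear.has_derivative[OF bounded_linear_to_copy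
        has_derivative_compose[OF bounded_linear_imp_has_derivative[OF bounded_linear_of_copy] that]] .
  have set_eq: "(\<integral>\<^sup>+x\<in>of_copy -` U. ennreal (G (of_copy x)) \<partial>lborel) = (\<integral>\<^sup>+x\<in>U. ennreal (G x) \<partial>lborel)"
    if [measurable]: "(\<lambda>x. indicator U x * G x) \<in> borel_measurable borel" for U and G :: "real^'n \<Rightarrow> real"
  proof -
    have *: "ennreal (G x) * indicator U x = ennreal (indicator U x * G x)" for x
      by (auto simp: indicator_def)
    have "(\<integral>\<^sup>+x\<in>of_copy -` U. ennreal (G (of_copy x)) \<partial>lborel) =
          (\<integral>\<^sup>+x. ennreal (indicator U (of_copy x) * G (of_copy x)) \<partial>lborel)"
      by (intro nn_integral_cong) (auto simp: indicator_def)
    also have "\<dots> = (\<integral>\<^sup>+x. ennreal (indicator U x * G x) \<partial>lborel)"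
      by (rule nn_integral_of_copy) measurable
    finally show ?thesis by (simp add: *)
  qed
  have FS: "(\<integral>\<^sup>+x\<in>S'. ennreal (\<bar>det (matrix (P' x))\<bar> * f (of_copy (P x))) \<partial>lborel) = (\<integral>\<^sup>+x\<in>S. ennreal (?F x) \<partial>lborel)"
    unfolding S'_def det using set_eq[OF meas] by (simp add: P_def)
  have "(\<lambda>x. indicator S (of_copy x) * ?F (of_copy x)) \<in> borel_measurable borel"
    by (rule measurable_compose[OF measurable_of_copy meas])
  moreover have "(\<lambda>x. indicator S' x * (\<bar>det (matrix (P' x))\<bar> * f (of_copy (P x)))) =
      (\<lambda>x. indicator S (of_copy x) * ?F (of_copy x))"
    unfolding det by (auto simp: S'_def P_def indicator_def)
  ultimately have mF: "(\<lambda>x. indicator S' x * (\<bar>det (matrix (P' x))\<bar> * f (of_copy (P x)))) \<in> borel_measurable borel"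
    by simp
  have "(\<integral>\<^sup>+y\<in>T'. ennreal (f (of_copy y)) \<partial>lborel) =
      (\<integral>\<^sup>+x\<in>S'. ennreal (\<bar>det (matrix (P' x))\<bar> * f (of_copy (P x))) \<partial>lborel)"
  proof (rule nn_integral_change_of_variables_wellorder[where \<phi> = "\<lambda>y. to_copy (\<phi> (of_copy y))"
        and \<phi>' = "\<lambda>y v. to_copy (\<phi>' (of_copy y) (of_copy v))"])
    fix x assume "x \<in> S'" then show "(P has_derivative P' x) (at x)"
      unfolding P_def P'_def by (intro der \<psi>) (simp add: S'_def)
  next
    fix y assume "y \<in> T'"
    then show "((\<lambda>y. to_copy (\<phi> (of_copy y))) has_derivative (\<lambda>v. to_copy (\<phi>' (of_copy y) (of_copy v)))) (at y)"
      by (intro der \<phi>) (simp add: T'_def)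
  next
    fix y assume "y \<in> T'"
    then have "(\<phi>' (of_copy y) \<circ> \<psi>' (\<phi> (of_copy y))) v = v" for v using inv[of "of_copy y"] by (simp add: T'_def)
    then show "(\<lambda>v. to_copy (\<phi>' (of_copy y) (of_copy v))) \<circ> P' (to_copy (\<phi> (of_copy y))) = id"
      by (auto simp: P'_def)
  qed (use f ST TS mF fin FS in \<open>auto simp: S'_def T'_def P_def\<close>)
  then show ?thesis
    using FS set_eq[OF meas_f] by (simp add: T'_def)
qed

section \<open>Manifolds\<close>

lemma smooth_funI: "(\<And>c. c \<in> A \<Longrightarrow> smooth_on (snd c ` (fst c \<inter> U)) (\<lambda>y. f (chart_inv c y))) \<Longrightarrow> smooth_fun A U f"
  by (simp add: smooth_fun_def comp_def)

lemma smooth_funD: "smooth_fun A U f \<Longrightarrow> c \<in> A \<Longrightarrow> smooth_on (snd c ` (fst c \<inter> U)) (\<lambda>y. f (chart_inv c y))"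
  by (simp add: smooth_fun_def comp_def)

context oriented_manifold
begin

lemma chart_open: "c \<in> A \<Longrightarrow> open (fst c)"
  using chart by blast

lemma chart_inv_apply [simp]: "c \<in> A \<Longrightarrow> x \<in> fst c \<Longrightarrow> chart_inv c (snd c x) = x"
  using chart homeomorphism_apply1 by blast

lemma chart_open_image: "c \<in> A \<Longrightarrow> open U \<Longrightarrow> open (snd c ` (fst c \<inter> U))"
proof -
  assume c: "c \<in> A" and "open U"
  then have "openin (top_of_set (fst c)) (fst c \<inter> U)" by blast
  from homeomorphism_imp_open_map[OF _ this] show ?thesis
    using chart[OF c] openin_open_trans by blast
qed

lemma continuous_on_chart: "c \<in> A \<Longrightarrow> continuous_on (fst c) (snd c)"
  using chart homeomorphism_cont1 by blast

lemma continuous_on_chart_inv: "c \<in> A \<Longrightarrow> continuous_on (snd c ` fst c) (chart_inv c)"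
  using chart homeomorphism_cont2 by blast

lemma open_chart_inv_image:
  assumes c: "c \<in> A" and "open W" "W \<subseteq> snd c ` fst c"
  shows "open (chart_inv c ` W)"
proof -
  have "chart_inv c ` W = fst c \<inter> snd c -` W"
    using assms by (auto simp: image_iff) (metis chart_inv_apply)
  then show ?thesis
    using continuous_open_preimage[OF continuous_on_chart[OF c] chart_open[OF c] assms(2)] by simp
qed

lemma chart_at: "chart_at A x \<in> A" "x \<in> fst (chart_at A x)"
proof -
  obtain c where "c \<in> A \<and> x \<in> fst c" using charts_cover by blast
  then have "chart_at A x \<in> A \<and> x \<in> fst (chart_at A x)"
    unfolding chart_at_def by (rule someI)
  then show "chart_at A x \<in> A" "x \<in> fst (chart_at A x)" by auto
qed

section \<open>Jacobians of chart transitions and tangent vectors\<close>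

definition jac :: "('m, 'n) chart \<Rightarrow> ('m, 'n) chart \<Rightarrow> 'm \<Rightarrow> real^'n \<Rightarrow> real^'n" where
  "jac c d x = frechet_derivative (snd d \<circ> chart_inv c) (at (snd c x))"

lemma jac_has_derivative:
  assumes "c \<in> A" "d \<in> A" "x \<in> fst c" "x \<in> fst d"
  shows "((snd d \<circ> chart_inv c) has_derivative jac c d x) (at (snd c x))"
  unfolding jac_def using assms by (intro smooth_on_has_derivative[OF smooth_transition]) auto

lemma jac_linear: "c \<in> A \<Longrightarrow> d \<in> A \<Longrightarrow> x \<in> fst c \<Longrightarrow> x \<in> fst d \<Longrightarrow> linear (jac c d x)"
  using jac_has_derivative has_derivative_linear by blast

text \<open>The chain rule through the transition map, for values in any normed space: with
  \<open>f = snd e\<close> it yields the cocycle law of Jacobians, with real \<open>f\<close> the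
  form of a differential in an arbitrary chart.\<close>

lemma chart_change_has_derivative:
  assumes "c \<in> A" "d \<in> A" "x \<in> fst c" "x \<in> fst d"
    and "((\<lambda>y. f (chart_inv d y)) has_derivative D) (at (snd d x))"
  shows "((\<lambda>y. f (chart_inv c y)) has_derivative (\<lambda>v. D (jac c d x v))) (at (snd c x))"
proof (rule has_derivative_transform_within_open[OF _ chart_open_image[of c "fst d"]])
  show "((\<lambda>y. f (chart_inv d ((snd d \<circ> chart_inv c) y))) has_derivative (\<lambda>v. D (jac c d x v))) (at (snd c x))"
    using has_derivative_compose[OF jac_has_derivative, of c d x "\<lambda>y. f (chart_inv d y)" D] assms by simp
qed (use assms chart_open in auto)

lemma jac_cocycle:
  assumes "c \<in> A" "d \<in> A" "e \<in> A" "x \<in> fst c" "x \<in> fst d" "x \<in> fst e"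
  shows "jac c e x v = jac d e x (jac c d x v)"
proof -
  have "((\<lambda>y. snd e (chart_inv c y)) has_derivative (\<lambda>v. jac d e x (jac c d x v))) (at (snd c x))"
    by (rule chart_change_has_derivative)
      (use assms chart_open jac_has_derivative[of d e x] in \<open>auto simp: comp_def\<close>)
  from frechet_derivative_at[OF this, symmetric] show ?thesis
    by (simp add: jac_def comp_def)
qed

lemma jac_same:
  assumes "c \<in> A" "x \<in> fst c" shows "jac c c x v = v"
proof -
  have "((snd c \<circ> chart_inv c) has_derivative (\<lambda>v. v)) (at (snd c x))"
    by (rule has_derivative_transform_within_open[OF has_derivative_ident chart_open_image[of c UNIV]])
      (use assms in auto)
  from frechet_derivative_at[OF this, symmetric] show ?thesis
    by (simp add: jac_def)
qed

lemma tangent_vec_jac: "tangent_vec A c x = jac c (chart_at A x) x"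
  by (auto simp: tangent_vec_def jac_def)

lemma tangent_vec_change:
  assumes "c \<in> A" "d \<in> A" "x \<in> fst c" "x \<in> fst d"
  shows "tangent_vec A c x v = tangent_vec A d x (jac c d x v)"
  unfolding tangent_vec_jac using assms chart_at by (intro jac_cocycle) auto

lemma tangent_vec_linear: "c \<in> A \<Longrightarrow> x \<in> fst c \<Longrightarrow> linear (tangent_vec A c x)"
  unfolding tangent_vec_jac using chart_at by (intro jac_linear) auto

lemma tangent_vec_inj:
  assumes "c \<in> A" "x \<in> fst c" shows "inj (tangent_vec A c x)"
proof (rule inj_on_inverseI)
  fix v
  \<comment> \<open>The Jacobian in the opposite direction is a left inverse.\<close>
  show "jac (chart_at A x) c x (tangent_vec A c x v) = v"
    unfolding tangent_vec_jac
    by (simp only: jac_cocycle[OF assms(1) chart_at(1) assms(1) assms(2) chart_at(2) assms(2), symmetric] jac_same[OF assms])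
qed

section \<open>Smooth functions on a manifold and their differentials\<close>

lemma smooth_fun_subset: "smooth_fun A U f \<Longrightarrow> V \<subseteq> U \<Longrightarrow> smooth_fun A V f"
  unfolding smooth_fun_def by (blast intro: smooth_on_subset)

lemma smooth_fun_cong:
  assumes "open U" "\<And>x. x \<in> U \<Longrightarrow> f x = g x"
  shows "smooth_fun A U f \<longleftrightarrow> smooth_fun A U g"
proof -
  have "smooth_on (snd c ` (fst c \<inter> U)) (f \<circ> chart_inv c) \<longleftrightarrow> smooth_on (snd c ` (fst c \<inter> U)) (g \<circ> chart_inv c)"
    if "c \<in> A" for c
    using that assms by (intro smooth_on_cong chart_open_image) auto
  then show ?thesis by (simp add: smooth_fun_def)
qed

lemma smooth_fun_const [simp]: "smooth_fun A U (\<lambda>x. k)"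
  by (simp add: smooth_fun_def comp_def)

lemma smooth_fun_add:
  "open U \<Longrightarrow> smooth_fun A U f \<Longrightarrow> smooth_fun A U g \<Longrightarrow> smooth_fun A U (\<lambda>x. f x + g x)"
  by (rule smooth_funI, rule smooth_on_add) (auto intro: smooth_funD chart_open_image)

lemma smooth_fun_mult:
  "open U \<Longrightarrow> smooth_fun A U f \<Longrightarrow> smooth_fun A U g \<Longrightarrow> smooth_fun A U (\<lambda>x. f x * g x)"
  by (rule smooth_funI, rule smooth_on_mult) (auto intro: smooth_funD chart_open_image)

lemma smooth_fun_exp: "open U \<Longrightarrow> smooth_fun A U f \<Longrightarrow> smooth_fun A U (\<lambda>x. exp (f x))"
  by (rule smooth_funI, rule smooth_on_exp) (auto intro: smooth_funD chart_open_image)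

lemma smooth_fun_sum:
  "open U \<Longrightarrow> (\<And>i. i \<in> I \<Longrightarrow> smooth_fun A U (f i)) \<Longrightarrow> smooth_fun A U (\<lambda>x. \<Sum>i\<in>I. f i x)"
  by (rule smooth_funI, rule smooth_on_sum) (auto intro: smooth_funD chart_open_image)

lemma smooth_fun_locally:
  assumes "\<And>x. x \<in> U \<Longrightarrow> \<exists>V. open V \<and> x \<in> V \<and> smooth_fun A (U \<inter> V) f"
  shows "smooth_fun A U f"
proof (intro smooth_funI smooth_on_locally)
  fix c y assume c: "c \<in> A" and "y \<in> snd c ` (fst c \<inter> U)"
  then obtain x where x: "y = snd c x" "x \<in> fst c" "x \<in> U" by auto
  then obtain V where V: "open V" "x \<in> V" "smooth_fun A (U \<inter> V) f" using assms by blast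
  let ?T = "snd c ` (fst c \<inter> V)"
  have "snd c ` (fst c \<inter> U) \<inter> ?T \<subseteq> snd c ` (fst c \<inter> (U \<inter> V))"
    using c by clarsimp (metis IntI chart_inv_apply imageI)
  then have "smooth_on (snd c ` (fst c \<inter> U) \<inter> ?T) (\<lambda>y. f (chart_inv c y))"
    using smooth_on_subset[OF smooth_funD[OF V(3) c]] by blast
  then show "\<exists>T. open T \<and> y \<in> T \<and> smooth_on (snd c ` (fst c \<inter> U) \<inter> T) (\<lambda>y. f (chart_inv c y))"
    using chart_open_image[OF c V(1)] x V(2) by blast
qed

lemma smooth_fun_UN: "(\<And>i. i \<in> I \<Longrightarrow> open (V i)) \<Longrightarrow> U \<subseteq> (\<Union>i\<in>I. V i) \<Longrightarrow>
    (\<And>i. i \<in> I \<Longrightarrow> smooth_fun A (U \<inter> V i) f) \<Longrightarrow> smooth_fun A U f"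
  by (rule smooth_fun_locally) blast

text \<open>\<open>differential\<close> is defined in the preferred chart at \<open>x\<close>, which
  may jump as \<open>x\<close> moves; arguments on a neighbourhood need its form in one fixed chart
  \<open>c\<close>.\<close>

lemma smooth_fun_chart_has_derivative:
  assumes "c \<in> A" "x \<in> fst c" "open U" "x \<in> U" "smooth_fun A U f"
  shows "((\<lambda>y. f (chart_inv c y)) has_derivative (\<lambda>w. differential A f x (tangent_vec A c x w))) (at (snd c x))"
proof -
  let ?d = "chart_at A x"
  have "((\<lambda>y. f (chart_inv ?d y)) has_derivative
      frechet_derivative (\<lambda>y. f (chart_inv ?d y)) (at (snd ?d x))) (at (snd ?d x))"
    using chart_at[of x] assms
    by (intro smooth_on_has_derivative[where S = "snd ?d ` (fst ?d \<inter> U)"] smooth_funD) auto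
  moreover have "differential A f x = frechet_derivative (\<lambda>y. f (chart_inv ?d y)) (at (snd ?d x))"
    by (rule ext) (simp add: differential_def comp_def)
  ultimately have "((\<lambda>y. f (chart_inv ?d y)) has_derivative differential A f x) (at (snd ?d x))"
    by simp
  from chart_change_has_derivative[OF assms(1) chart_at(1) assms(2) chart_at(2) this]
  show ?thesis by (simp add: tangent_vec_jac)
qed


lemma smooth_fun_continuous:
  assumes "open U" "smooth_fun A U f" shows "continuous_on U f"
proof -
  have "continuous_on (\<Union>c\<in>A. fst c \<inter> U) f"
  proof (rule continuous_on_open_UN)
    fix c assume c: "c \<in> A"
    then show "open (fst c \<inter> U)" using chart_open assms(1) by blast
    have "continuous_on (fst c \<inter> U) (\<lambda>x. f (chart_inv c (snd c x)))"
      by (rule continuous_on_compose2[OF smooth_on_continuous[OF smooth_funD[OF assms(2) c]]])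
        (use continuous_on_subset[OF continuous_on_chart[OF c]] in auto)
    then show "continuous_on (fst c \<inter> U) f"
      by (rule continuous_on_eq) (use c in auto)
  qed
  moreover have "(\<Union>c\<in>A. fst c \<inter> U) = U" using charts_cover by blast
  ultimately show ?thesis by simp
qed

lemma differential_linear:
  assumes "open U" "x \<in> U" "smooth_fun A U f" shows "linear (differential A f x)"
proof -
  \<comment> \<open>In the preferred chart itself tangent vectors are their own components.\<close>
  have "tangent_vec A (chart_at A x) x v = v" for v
    by (simp add: tangent_vec_jac jac_same chart_at)
  then show ?thesis
    using has_derivative_linear[OF smooth_fun_chart_has_derivative[OF chart_at assms]] by simp
qed

lemma differential_eqI:
  assumes "open U" "x \<in> U" "smooth_fun A U f"
    and "((\<lambda>y. f (chart_inv (chart_at A x) y)) has_derivative D) (at (snd (chart_at A x) x))"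
  shows "differential A f x v = D v"
  using frechet_derivative_at[OF assms(4)] by (simp add: differential_def comp_def)

lemma differential_const [simp]: "differential A (\<lambda>x. k) x v = 0"
  by (simp add: differential_def comp_def frechet_derivative_const)

text \<open>Both functions have the same derivatives at \<open>x\<close> in the preferred chart, so
  the choice made by \<open>frechet_derivative\<close> is the same, even if no derivative
  exists.\<close>

lemma differential_cong:
  assumes "open U" "x \<in> U" "\<And>y. y \<in> U \<Longrightarrow> f y = g y"
  shows "differential A f x v = differential A g x v"
proof -
  let ?d = "chart_at A x"
  have "(g' \<circ> chart_inv ?d has_derivative D) (at (snd ?d x))"
    if "(f' \<circ> chart_inv ?d has_derivative D) (at (snd ?d x))" "\<And>y. y \<in> U \<Longrightarrow> f' y = g' y" for f' g' D
    by (rule has_derivative_transform_within_open[OF that(1) chart_open_image[OF chart_at(1) assms(1)]])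
      (use assms(2) chart_at[of x] that(2) in auto)
  from this[of f _ g] this[of g _ f]
  have "(f \<circ> chart_inv ?d has_derivative D) (at (snd ?d x)) \<longleftrightarrow> (g \<circ> chart_inv ?d has_derivative D) (at (snd ?d x))" for D
    using assms(3) by auto
  then show ?thesis by (simp add: differential_def frechet_derivative_def)
qed

lemma differential_exp:
  assumes "open U" "x \<in> U" "smooth_fun A U f"
  shows "differential A (\<lambda>x. exp (f x)) x v = exp (f x) * differential A f x v"
proof -
  have D: "((\<lambda>y. f (chart_inv (chart_at A x) y)) has_derivative differential A f x) (at (snd (chart_at A x) x))"
    using smooth_fun_chart_has_derivative[OF chart_at assms]
    by (simp add: tangent_vec_jac jac_same chart_at)
  show ?thesis
    using differential_eqI[OF assms(1,2) smooth_fun_exp[OF assms(1,3)] has_derivative_exp[OF D]]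
    by (simp add: chart_at)
qed

lemma differential_affine:
  assumes "open U" "x \<in> U" "smooth_fun A U f"
  shows "differential A (\<lambda>x. a + k * f x) x v = k * differential A f x v"
proof -
  have D: "((\<lambda>y. f (chart_inv (chart_at A x) y)) has_derivative differential A f x) (at (snd (chart_at A x) x))"
    using smooth_fun_chart_has_derivative[OF chart_at assms]
    by (simp add: tangent_vec_jac jac_same chart_at)
  have "((\<lambda>y. a + k * f (chart_inv (chart_at A x) y)) has_derivative (\<lambda>v. k * differential A f x v)) (at (snd (chart_at A x) x))"
    using D by (auto intro!: derivative_eq_intros)
  moreover have "smooth_fun A U (\<lambda>x. a + k * f x)"
    using assms by (intro smooth_fun_add smooth_fun_mult) auto
  ultimately show ?thesis
    using differential_eqI[OF assms(1,2)] by blast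
qed

end

section \<open>The Riemannian measure\<close>

context riemannian_manifold
begin

sublocale metric: inner_prod "g x" for x
  using metric_inner by (simp add: inner_prod_def)

lemma gram_matrix_eq: "gram_matrix A g c x = metric.gram x (\<lambda>i. tangent_vec A c x (axis i 1))"
  by (simp add: gram_matrix_def metric.gram_def)

lemma det_gram_matrix_pos: "c \<in> A \<Longrightarrow> x \<in> fst c \<Longrightarrow> det (gram_matrix A g c x) > 0"
  unfolding gram_matrix_eq using metric.det_gram_pos[OF tangent_vec_inj tangent_vec_linear] .

lemma continuous_on_gram_matrix:
  assumes "c \<in> A" shows "continuous_on (fst c) (\<lambda>x. gram_matrix A g c x $ i $ j)"
  using smooth_fun_continuous[OF chart_open metric_smooth] assms by (simp add: gram_matrix_def)

lemma gram_matrix_change: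
  assumes "c \<in> A" "d \<in> A" "x \<in> fst c" "x \<in> fst d"
  shows "gram_matrix A g c x = transpose (matrix (jac c d x)) ** gram_matrix A g d x ** matrix (jac c d x)"
proof -
  have tv: "tangent_vec A c x (axis i 1) =
      (\<Sum>k\<in>UNIV. (matrix (jac c d x) $ k $ i) *\<^sub>R tangent_vec A d x (axis k 1))" for i
  proof -
    have "tangent_vec A c x (axis i 1) = tangent_vec A d x (jac c d x (axis i 1))"
      using assms by (rule tangent_vec_change)
    also have "jac c d x (axis i 1) = (\<Sum>k\<in>UNIV. (jac c d x (axis i 1) $ k) *\<^sub>R axis k 1)"
      using basis_expansion[of "jac c d x (axis i 1)"] by (simp add: scalar_mult_eq_scaleR)
    finally show ?thesis
      by (simp add: linear_sum[OF tangent_vec_linear] linear_cmul[OF tangent_vec_linear] assms matrix_def)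
  qed
  show ?thesis
    unfolding gram_matrix_def tv metric.left_simps metric.right_simps
    by (simp add: vec_eq_iff matrix_matrix_mult_def transpose_def sum_distrib_left sum_distrib_right mult.assoc mult.commute mult.left_commute)
qed

section \<open>Volume density and volume inside one chart\<close>

definition vol_density :: "('m, 'n) chart \<Rightarrow> 'm \<Rightarrow> real" where
  "vol_density c x = sqrt (det (gram_matrix A g c x))"

lemma vol_density_pos: "c \<in> A \<Longrightarrow> x \<in> fst c \<Longrightarrow> vol_density c x > 0"
  by (simp add: vol_density_def det_gram_matrix_pos)

lemma continuous_on_vol_density: "c \<in> A \<Longrightarrow> continuous_on (fst c) (vol_density c)"
  unfolding vol_density_def by (intro continuous_on_real_sqrt continuous_on_det continuous_on_gram_matrix)

text \<open>Gram matrices change by congruence with the Jacobian, so the square root of the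
  determinant picks up exactly the factor of the change of variables formula.\<close>

lemma vol_density_change:
  assumes "c \<in> A" "d \<in> A" "x \<in> fst c" "x \<in> fst d"
  shows "vol_density c x = \<bar>det (matrix (jac c d x))\<bar> * vol_density d x"
  unfolding vol_density_def gram_matrix_change[OF assms]
  by (simp add: det_mul det_transpose real_sqrt_mult)

definition chart_volume :: "('m, 'n) chart \<Rightarrow> 'm set \<Rightarrow> ennreal" where
  "chart_volume c S = (\<integral>\<^sup>+ y \<in> snd c ` S. ennreal (vol_density c (chart_inv c y)) \<partial>lborel)"

lemma chart_image_borel:
  assumes "c \<in> A" "S \<in> sets borel" "S \<subseteq> fst c" shows "snd c ` S \<in> sets borel"
proof -
  let ?W = "snd c ` fst c"
  have "chart_inv c \<in> borel_measurable (restrict_space borel ?W)"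
    by (rule borel_measurable_continuous_on_restrict[OF continuous_on_chart_inv[OF assms(1)]])
  then have "chart_inv c -` S \<inter> ?W \<in> sets (restrict_space borel ?W)"
    using assms(2) by (auto dest!: measurable_sets simp: space_restrict_space)
  moreover have "?W \<in> sets borel"
    using chart[OF assms(1)] by auto
  moreover have "chart_inv c -` S \<inter> ?W = snd c ` S"
    using assms by (auto simp: image_iff)
  ultimately show ?thesis by (simp add: sets_restrict_space_iff)
qed

lemma measurable_vol_density:
  assumes "c \<in> A" "S \<in> sets borel" "S \<subseteq> fst c"
  shows "(\<lambda>y. indicator (snd c ` S) y * vol_density c (chart_inv c y)) \<in> borel_measurable borel"
proof -
  have "continuous_on (snd c ` fst c) (\<lambda>y. vol_density c (chart_inv c y))"
    by (rule continuous_on_compose2[OF continuous_on_vol_density continuous_on_chart_inv])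
      (use assms in auto)
  then have "continuous_on (snd c ` S) (\<lambda>y. vol_density c (chart_inv c y))"
    by (rule continuous_on_subset) (use assms in auto)
  from borel_measurable_continuous_on_indicator[OF chart_image_borel[OF assms] this]
  show ?thesis by simp
qed

lemma chart_volume_alt:
  "chart_volume c S = (\<integral>\<^sup>+ y. ennreal (indicator (snd c ` S) y * vol_density c (chart_inv c y)) \<partial>lborel)"
  unfolding chart_volume_def by (intro nn_integral_cong) (auto simp: indicator_def)

lemma chart_volume_UN:
  assumes c: "c \<in> A" and S: "\<And>i. S i \<in> sets borel" "\<And>i. S i \<subseteq> fst c" and disj: "disjoint_family S"
  shows "chart_volume c (\<Union>i::nat. S i) = (\<Sum>i. chart_volume c (S i))"
proof -
  let ?r = "\<lambda>y. vol_density c (chart_inv c y)"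
  have disj': "disjoint_family (\<lambda>i. snd c ` S i)"
    using disj S(2) unfolding disjoint_family_on_def
    by (auto simp: set_eq_iff) (metis c chart_inv_apply subsetD)
  have "chart_volume c (\<Union>i. S i) = (\<integral>\<^sup>+ y. (\<Sum>i. ennreal (indicator (snd c ` S i) y * ?r y)) \<partial>lborel)"
    unfolding chart_volume_def
  proof (rule nn_integral_cong)
    fix y
    have "(\<Sum>i. ennreal (indicator (snd c ` S i) y * ?r y)) = (\<Sum>i. ennreal (?r y) * indicator (snd c ` S i) y)"
      by (intro suminf_cong) (auto simp: indicator_def)
    also have "\<dots> = ennreal (?r y) * indicator (\<Union>i. snd c ` S i) y"
      using suminf_indicator[OF disj', of y] by simp
    finally show "ennreal (?r y) * indicator (snd c ` (\<Union>i. S i)) y = (\<Sum>i. ennreal (indicator (snd c ` S i) y * ?r y))"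
      by (simp add: image_UN)
  qed
  also have "\<dots> = (\<Sum>i. chart_volume c (S i))"
    unfolding chart_volume_alt using measurable_vol_density[OF c S]
    by (intro nn_integral_suminf) auto
  finally show ?thesis .
qed

text \<open>The density law absorbs the Jacobian of the transition map under the integral.
  Finiteness on one side is what \<open>nn_integral_change_of_variables\<close> asks for; it will
  come from a coordinate ball on which the density is bounded.\<close>

lemma chart_volume_change:
  assumes c: "c \<in> A" and d: "d \<in> A" and S: "S \<in> sets borel" "S \<subseteq> fst c" "S \<subseteq> fst d"
    and fin: "chart_volume d S < \<infinity>"
  shows "chart_volume c S = chart_volume d S"
proof -
  let ?r = "\<lambda>c y. vol_density c (chart_inv c y)"
  have eq: "\<bar>det (matrix (jac d c (chart_inv d x)))\<bar> * ?r c (snd c (chart_inv d x)) = ?r d x" if "x \<in> snd d ` S" for x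
    using that vol_density_change[OF d c] S c d by (auto simp: subset_iff)
  have "chart_volume c S =
      (\<integral>\<^sup>+x\<in>snd d ` S. ennreal (\<bar>det (matrix (jac d c (chart_inv d x)))\<bar> * ?r c ((snd c \<circ> chart_inv d) x)) \<partial>lborel)"
    unfolding chart_volume_def
  proof (rule nn_integral_change_of_variables[where \<phi> = "snd d \<circ> chart_inv c" and \<phi>' = "\<lambda>y. jac c d (chart_inv c y)"])
    fix x assume "x \<in> snd d ` S" then show "(snd c \<circ> chart_inv d has_derivative jac d c (chart_inv d x)) (at x)"
      using jac_has_derivative[OF d c] S d by (auto simp: subset_iff)
  next
    fix y assume "y \<in> snd c ` S"
    then obtain x where x: "y = snd c x" "x \<in> S" by auto
    then show "(snd d \<circ> chart_inv c has_derivative jac c d (chart_inv c y)) (at y)"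
      using jac_has_derivative[OF c d] S c by (auto simp: subset_iff)
    show "0 \<le> ?r c y" using x vol_density_pos[OF c] S c by (auto simp: subset_iff intro: less_imp_le)
    show "jac c d (chart_inv c y) \<circ> jac d c (chart_inv d ((snd d \<circ> chart_inv c) y)) = id"
      using x S c d jac_cocycle[OF d c d, of x] jac_same[OF d, of x] by (auto simp: subset_iff fun_eq_iff)
  next
    have "(\<lambda>x. indicator (snd d ` S) x * (\<bar>det (matrix (jac d c (chart_inv d x)))\<bar> * ?r c ((snd c \<circ> chart_inv d) x))) =
        (\<lambda>x. indicator (snd d ` S) x * ?r d x)"
      using eq by (auto simp: indicator_def)
    then show "(\<lambda>x. indicator (snd d ` S) x * (\<bar>det (matrix (jac d c (chart_inv d x)))\<bar> * ?r c ((snd c \<circ> chart_inv d) x))) \<in> borel_measurable borel"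
      using measurable_vol_density[OF d S(1,3)] by simp
    show "(\<lambda>y. indicator (snd c ` S) y * ?r c y) \<in> borel_measurable borel"
      by (rule measurable_vol_density[OF c S(1,2)])
    have "(\<integral>\<^sup>+x\<in>snd d ` S. ennreal (\<bar>det (matrix (jac d c (chart_inv d x)))\<bar> * ?r c ((snd c \<circ> chart_inv d) x)) \<partial>lborel) = chart_volume d S"
      unfolding chart_volume_def using eq by (intro nn_integral_cong) (auto simp: indicator_def)
    then show "(\<integral>\<^sup>+x\<in>snd d ` S. ennreal (\<bar>det (matrix (jac d c (chart_inv d x)))\<bar> * ?r c ((snd c \<circ> chart_inv d) x)) \<partial>lborel) < \<infinity>"
      using fin by simp
  qed (use S c d in \<open>auto simp: subset_iff\<close>)
  also have "\<dots> = chart_volume d S"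
    unfolding chart_volume_def using eq by (intro nn_integral_cong) (auto simp: indicator_def)
  finally show ?thesis .
qed

section \<open>The global Riemannian measure: additivity, finiteness, positivity\<close>

lemma chart_cover: "chart_cover A k \<in> A" "(\<Union>k. fst (chart_cover A k)) = UNIV"
proof -
  \<comment> \<open>Second countability enters through the Lindelof property: it yields the
    countable cover behind the \<open>SOME\<close> in \<open>chart_cover\<close>.\<close>
  obtain F where F: "F \<subseteq> fst ` A" "countable F" "\<Union>F = \<Union>(fst ` A)"
    using Lindelof[of "fst ` A"] chart_open by (metis imageE)
  then have "\<Union>F = UNIV" using charts_cover by auto
  then have ne: "F \<noteq> {}" by auto
  have "\<exists>c. c \<in> A \<and> fst c = from_nat_into F k" for k
    using from_nat_into[OF ne, of k] F(1) by blast
  then obtain c where c: "\<And>k. c k \<in> A \<and> fst (c k) = from_nat_into F k" by metis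
  then have "range c \<subseteq> A \<and> (\<Union>k. fst (c k)) = UNIV"
    using \<open>\<Union>F = UNIV\<close> range_from_nat_into[OF ne F(2)] by auto
  then have "range (chart_cover A) \<subseteq> A \<and> (\<Union>k. fst (chart_cover A k)) = UNIV"
    unfolding chart_cover_def
    by (rule someI[where P = "\<lambda>c. range c \<subseteq> A \<and> (\<Union>k. fst (c k)) = UNIV"])
  then show "chart_cover A k \<in> A" "(\<Union>k. fst (chart_cover A k)) = UNIV" by auto
qed

definition piece :: "nat \<Rightarrow> 'm set" where
  "piece = disjointed (\<lambda>k. fst (chart_cover A k))"

lemma piece: "piece k \<in> sets borel" "piece k \<subseteq> fst (chart_cover A k)" "disjoint_family piece" "(\<Union>k. piece k) = UNIV"
proof -
  have "fst (chart_cover A k) \<in> sets borel" for k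
    using chart_open[OF chart_cover(1)] by auto
  then show "piece k \<in> sets borel"
    unfolding piece_def disjointed_def by auto
  show "piece k \<subseteq> fst (chart_cover A k)"
    unfolding piece_def by (rule disjointed_subset)
  show "disjoint_family piece" unfolding piece_def by (rule disjoint_family_disjointed)
  show "(\<Union>k. piece k) = UNIV" unfolding piece_def UN_disjointed_eq by (rule chart_cover)
qed

text \<open>A set function passed to \<open>measure_of\<close> is recovered as
  \<open>emeasure\<close> once it is known to be positive and countably additive. Additivity holds
  chart by chart, and the double series over pieces and disjoint sets may be interchanged because
  all terms are nonnegative.\<close>

lemma emeasure_riemannian_measure:
  assumes "S \<in> sets borel"
  shows "emeasure (riemannian_measure A g) S = (\<Sum>k. chart_volume (chart_cover A k) (S \<inter> piece k))"
proof -
  let ?\<mu> = "\<lambda>S. \<Sum>k. chart_volume (chart_cover A k) (S \<inter> piece k)"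
  have rm: "riemannian_measure A g = measure_of UNIV (sets borel) ?\<mu>"
    by (simp add: riemannian_measure_def chart_volume_def piece_def vol_density_def Let_def)
  have "countably_additive (sets borel) ?\<mu>"
  proof (rule countably_additiveI)
    fix S :: "nat \<Rightarrow> 'm set" assume S: "range S \<subseteq> sets borel" "disjoint_family S"
    have "?\<mu> (\<Union>i. S i) = (\<Sum>k. \<Sum>i. chart_volume (chart_cover A k) (S i \<inter> piece k))"
    proof (rule suminf_cong)
      fix k
      have "(\<Union>i. S i) \<inter> piece k = (\<Union>i. S i \<inter> piece k)" by auto
      moreover have "disjoint_family (\<lambda>i. S i \<inter> piece k)"
        using S(2) unfolding disjoint_family_on_def by blast
      ultimately show "chart_volume (chart_cover A k) ((\<Union>i. S i) \<inter> piece k) = (\<Sum>i. chart_volume (chart_cover A k) (S i \<inter> piece k))"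
        using chart_volume_UN[OF chart_cover(1), of "\<lambda>i. S i \<inter> piece k" k] S piece(1,2)[of k] by auto
    qed
    \<comment> \<open>Tonelli for series: the outer sum is read as an integral over counting
      measure.\<close>
    also have "\<dots> = (\<integral>\<^sup>+k. (\<Sum>i. chart_volume (chart_cover A k) (S i \<inter> piece k)) \<partial>count_space UNIV)"
      by (simp add: nn_integral_count_space_nat)
    also have "\<dots> = (\<Sum>i. \<integral>\<^sup>+k. chart_volume (chart_cover A k) (S i \<inter> piece k) \<partial>count_space UNIV)"
      by (intro nn_integral_suminf) auto
    also have "\<dots> = (\<Sum>i. ?\<mu> (S i))"
      by (simp add: nn_integral_count_space_nat)
    finally show "(\<Sum>i. ?\<mu> (S i)) = ?\<mu> (\<Union>i. S i)" by simp
  qed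
  moreover have "positive (sets borel) ?\<mu>"
    by (simp add: positive_def chart_volume_def)
  moreover have "sigma_algebra UNIV (sets (borel :: 'm measure))"
    using sets.sigma_algebra_axioms[of "borel :: 'm measure"] by simp
  ultimately show ?thesis
    unfolding rm using assms by (intro emeasure_measure_of_sigma) auto
qed

lemma sets_riemannian_measure [measurable_cong, simp]: "sets (riemannian_measure A g) = sets borel"
  unfolding riemannian_measure_def using sets.sigma_sets_eq[of "borel :: 'm measure"] by (simp add: sets_measure_of_conv)

lemma space_riemannian_measure [simp]: "space (riemannian_measure A g) = UNIV"
  unfolding riemannian_measure_def by (simp add: space_measure_of_conv)

text \<open>A closed coordinate ball inside a chart is compact, so the density is bounded there and
  the open ball has finite volume in that chart. The measure, however, is computed in the charts of
  the chosen cover; each intersection with a \<open>piece\<close> is carried back by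
  \<open>chart_volume_change\<close>.\<close>

lemma riemannian_measure_locally_finite:
  "\<exists>B. open B \<and> x \<in> B \<and> emeasure (riemannian_measure A g) B < \<infinity>"
proof -
  define d where "d = chart_at A x"
  have d: "d \<in> A" "x \<in> fst d" using chart_at by (auto simp: d_def)
  have W: "open (snd d ` fst d)" using chart[OF d(1)] by blast
  then obtain r where r: "r > 0" "cball (snd d x) r \<subseteq> snd d ` fst d"
    using d open_contains_cball by blast
  define B where "B = chart_inv d ` ball (snd d x) r"
  have sub: "ball (snd d x) r \<subseteq> snd d ` fst d" using r by auto
  have B: "open B" unfolding B_def using sub by (intro open_chart_inv_image d) auto
  have xB: "x \<in> B" unfolding B_def using r d by (auto simp: image_iff intro!: bexI[of _ "snd d x"])
  have Bd: "B \<subseteq> fst d"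
    unfolding B_def using sub d by auto
  have im: "snd d ` B = ball (snd d x) r"
    unfolding B_def image_image using sub d(1) by (force simp: image_iff)
  have "chart_volume d B < \<infinity>"
  proof -
    let ?r = "\<lambda>y. vol_density d (chart_inv d y)"
    have "continuous_on (snd d ` fst d) ?r"
      by (rule continuous_on_compose2[OF continuous_on_vol_density continuous_on_chart_inv])
        (use d in auto)
    then have "compact (?r ` cball (snd d x) r)"
      using r by (intro compact_continuous_image) (auto intro: continuous_on_subset)
    then obtain C where C: "\<And>y. y \<in> cball (snd d x) r \<Longrightarrow> \<bar>?r y\<bar> \<le> C"
      using compact_imp_bounded[of "?r ` cball (snd d x) r"] unfolding bounded_iff by (auto simp del: mem_cball)
    have "chart_volume d B \<le> (\<integral>\<^sup>+y. ennreal C * indicator (ball (snd d x) r) y \<partial>lborel)"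
      unfolding chart_volume_def im
    proof (rule nn_integral_mono)
      fix y show "ennreal (?r y) * indicator (ball (snd d x) r) y \<le> ennreal C * indicator (ball (snd d x) r) y"
        using C[of y] by (auto simp: indicator_def intro!: ennreal_leI)
    qed
    also have "\<dots> = ennreal C * emeasure lborel (ball (snd d x) r)"
      by (subst nn_integral_cmult_indicator) auto
    also have "\<dots> < \<infinity>"
      using emeasure_bounded_finite[OF bounded_ball, of "snd d x" r] by (simp add: ennreal_mult_less_top)
    finally show ?thesis .
  qed
  moreover have "emeasure (riemannian_measure A g) B = chart_volume d B"
  proof -
    have sets: "B \<inter> piece k \<in> sets borel" for k using B piece(1)[of k] by auto
    have "chart_volume (chart_cover A k) (B \<inter> piece k) = chart_volume d (B \<inter> piece k)" for k
    proof (rule chart_volume_change)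
      have "chart_volume d (B \<inter> piece k) \<le> chart_volume d B"
        unfolding chart_volume_def by (intro nn_integral_mono) (auto simp: indicator_def)
      with \<open>chart_volume d B < \<infinity>\<close> show "chart_volume d (B \<inter> piece k) < \<infinity>" by (simp add: le_less_trans)
    qed (use sets chart_cover d Bd piece(2)[of k] in auto)
    moreover have "(\<Sum>k. chart_volume d (B \<inter> piece k)) = chart_volume d (\<Union>k. B \<inter> piece k)"
    proof (rule chart_volume_UN[symmetric])
      show "disjoint_family (\<lambda>k. B \<inter> piece k)"
        using piece(3) unfolding disjoint_family_on_def by blast
    qed (use sets Bd d in auto)
    moreover have "(\<Union>k. B \<inter> piece k) = B" using piece(4) by auto
    ultimately show ?thesis
      using B by (simp add: emeasure_riemannian_measure)
  qed
  ultimately show ?thesis using B xB by auto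
qed

lemma finite_riemannian_measure:
  assumes "compact (UNIV :: 'm set)" shows "finite_measure (riemannian_measure A g)"
proof
  define \<B> where "\<B> = {B. open B \<and> emeasure (riemannian_measure A g) B < \<infinity>}"
  have "UNIV \<subseteq> \<Union>\<B>" using riemannian_measure_locally_finite by (auto simp: \<B>_def)
  then obtain F where F: "F \<subseteq> \<B>" "finite F" "UNIV \<subseteq> \<Union>F"
    by (rule compactE[OF assms]) (auto simp: \<B>_def)
  have "emeasure (riemannian_measure A g) (\<Union>B\<in>F. B) \<le> (\<Sum>B\<in>F. emeasure (riemannian_measure A g) B)"
    by (rule emeasure_subadditive_finite) (use F in \<open>auto simp: \<B>_def\<close>)
  also have "\<dots> < \<infinity>" using F by (auto simp: \<B>_def)
  moreover have "(\<Union>B\<in>F. B) = UNIV" using F by auto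
  ultimately show "emeasure (riemannian_measure A g) (space (riemannian_measure A g)) \<noteq> \<infinity>" by auto
qed

text \<open>A null nonempty open set would have a nonempty open coordinate image on which a strictly
  positive density integrates to zero.\<close>

lemma riemannian_measure_pos:
  assumes "open U" "U \<noteq> {}" shows "emeasure (riemannian_measure A g) U \<noteq> 0"
proof
  assume 0: "emeasure (riemannian_measure A g) U = 0"
  let ?C = "\<lambda>k. fst (chart_cover A k)"
  \<comment> \<open>For the least index whose chart meets \<open>U\<close>, making the cover
    disjoint removes nothing: \<open>U \<inter> piece k\<close> is the whole part of
    \<open>U\<close> in that chart.\<close>
  define k where "k = (LEAST k. U \<inter> ?C k \<noteq> {})"
  have "\<exists>k. U \<inter> ?C k \<noteq> {}" using assms chart_cover(2) by auto
  then have k: "U \<inter> ?C k \<noteq> {}" unfolding k_def by (metis (mono_tags, lifting) LeastI_ex)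
  have "U \<inter> ?C j = {}" if "j < k" for j using not_less_Least that unfolding k_def by blast
  then have Uk: "U \<inter> piece k = U \<inter> ?C k"
    unfolding piece_def disjointed_def by fastforce
  let ?c = "chart_cover A k" let ?W = "snd ?c ` (?C k \<inter> U)"
  have W: "open ?W" "?W \<noteq> {}" using chart_open_image[OF chart_cover(1) assms(1)] k by auto
  have "\<forall>k. chart_volume (chart_cover A k) (U \<inter> piece k) = 0"
    using 0 assms(1) suminf_eq_zero_iff[of "\<lambda>k. chart_volume (chart_cover A k) (U \<inter> piece k)"]
    by (simp add: emeasure_riemannian_measure)
  then have "chart_volume ?c (?C k \<inter> U) = 0" using Uk by (metis Int_commute)
  then have "AE y in lborel. indicator ?W y * vol_density ?c (chart_inv ?c y) \<le> 0"
    unfolding chart_volume_alt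
    using measurable_vol_density[OF chart_cover(1), of "?C k \<inter> U" k] assms(1) chart_open[OF chart_cover(1)]
    by (subst (asm) nn_integral_0_iff_AE) (auto simp: ennreal_eq_0_iff)
  then have "AE y in lborel. y \<notin> ?W"
  proof eventually_elim
    case (elim y)
    show ?case
    proof
      assume "y \<in> ?W"
      then obtain z where "y = snd ?c z" "z \<in> ?C k" by auto
      with vol_density_pos[OF chart_cover(1), of z k] elim \<open>y \<in> ?W\<close> show False
        by (simp add: chart_cover(1))
    qed
  qed
  then have "?W \<in> null_sets lborel"
    using W(1) by (subst AE_iff_null_sets) auto
  then have "negligible ?W"
    by (simp add: negligible_iff_null_sets null_sets_completionI)
  then show False using open_not_negligible[OF W] by blast
qed

end

section \<open>Vector bundles\<close>

context riemannian_vector_bundle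
begin

lemma fibre_subspace: "subspace (E x)"
proof -
  have "x \<in> (\<Union>F\<in>Fr. fst F)" using frames_cover by simp
  then obtain U s where "(U, s) \<in> Fr" "x \<in> U" by auto
  then have "E x = span ((\<lambda>i. s i x) ` {..<r})" using frame_basis by blast
  then show ?thesis by (simp add: subspace_span)
qed

lemma frame_in_fibre: "(U, s) \<in> Fr \<Longrightarrow> x \<in> U \<Longrightarrow> i < r \<Longrightarrow> s i x \<in> E x"
  using frame_basis[of U s x] span_base[of "s i x" "(\<lambda>i. s i x) ` {..<r}"] by auto

lemma frame_combination_inj:
  assumes "(U, s) \<in> Fr" "x \<in> U" "(\<Sum>i<r. a i *\<^sub>R s i x) = (\<Sum>i<r. b i *\<^sub>R s i x)" "i < r"
  shows "a i = b i"
proof -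
  have inj: "inj_on (\<lambda>i. s i x) {..<r}" and ind: "independent ((\<lambda>i. s i x) ` {..<r})"
    using frame_basis[OF assms(1,2)] by auto
  \<comment> \<open>\<open>independentD\<close> takes coefficients indexed by vectors, so the index
    is recovered from the frame vector by injectivity.\<close>
  define k where "k v = a (the_inv_into {..<r} (\<lambda>i. s i x) v) - b (the_inv_into {..<r} (\<lambda>i. s i x) v)" for v
  have k: "k (s j x) = a j - b j" if "j < r" for j
    using the_inv_into_f_f[OF inj] that by (simp add: k_def)
  have "(\<Sum>v\<in>(\<lambda>i. s i x) ` {..<r}. k v *\<^sub>R v) = (\<Sum>i<r. k (s i x) *\<^sub>R s i x)"
    by (simp add: sum.reindex[OF inj])
  also have "\<dots> = (\<Sum>i<r. (a i - b i) *\<^sub>R s i x)"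
    by (rule sum.cong) (auto simp: k)
  also have "\<dots> = 0" using assms(3) by (simp add: scaleR_diff_left sum_subtractf)
  finally have *: "(\<Sum>v\<in>(\<lambda>i. s i x) ` {..<r}. k v *\<^sub>R v) = 0" .
  have "k (s i x) = 0"
    by (rule independentD[OF ind _ subset_refl *]) (use assms(4) in auto)
  with k[OF assms(4)] show ?thesis by simp
qed

section \<open>Algebra of the fibre metric\<close>

lemma h_sym:
  assumes "u \<in> E x" "v \<in> E x" shows "h x u v = h x v u"
proof -
  have "\<forall>u\<in>E x. \<forall>v\<in>E x. h x u v = h x v u"
    using fibre_metric_inner[of x] unfolding inner_product_on_def by (elim conjE)
  from bspec[OF bspec[OF this assms(1)] assms(2)] show ?thesis .
qed

lemma h_lin:
  assumes "u \<in> E x" "v \<in> E x" "w \<in> E x" shows "h x (k *\<^sub>R u + v) w = k * h x u w + h x v w"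
proof -
  have "\<forall>u\<in>E x. \<forall>v\<in>E x. \<forall>w\<in>E x. \<forall>k. h x (k *\<^sub>R u + v) w = k * h x u w + h x v w"
    using fibre_metric_inner[of x] unfolding inner_product_on_def by (elim conjE)
  from spec[OF bspec[OF bspec[OF bspec[OF this assms(1)] assms(2)] assms(3)]] show ?thesis .
qed

lemma h_zero: "w \<in> E x \<Longrightarrow> h x 0 w = 0"
  using h_lin[of 0 x 0 w 1] subspace_0[OF fibre_subspace] by simp

lemma h_add: "u \<in> E x \<Longrightarrow> v \<in> E x \<Longrightarrow> w \<in> E x \<Longrightarrow> h x (u + v) w = h x u w + h x v w"
  using h_lin[of u x v w 1] by simp

lemma h_scale: "u \<in> E x \<Longrightarrow> w \<in> E x \<Longrightarrow> h x (k *\<^sub>R u) w = k * h x u w"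
  using h_lin[of u x 0 w k] h_zero subspace_0[OF fibre_subspace] by simp

lemma h_scale_right: "u \<in> E x \<Longrightarrow> w \<in> E x \<Longrightarrow> h x w (k *\<^sub>R u) = k * h x w u"
  using h_scale[of u x w k] h_sym subspace_scale[OF fibre_subspace] by metis

lemma h_add_right: "u \<in> E x \<Longrightarrow> v \<in> E x \<Longrightarrow> w \<in> E x \<Longrightarrow> h x w (u + v) = h x w u + h x w v"
  using h_add[of u x v w] h_sym subspace_add[OF fibre_subspace] by metis

lemma h_sum:
  assumes "finite I" "w \<in> E x" "\<And>i. i \<in> I \<Longrightarrow> u i \<in> E x"
  shows "h x (\<Sum>i\<in>I. a i *\<^sub>R u i) w = (\<Sum>i\<in>I. a i * h x (u i) w)"
  using assms(1,3)
proof (induction I rule: finite_induct)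
  case empty
  then show ?case using h_zero assms(2) by simp
next
  case (insert i I)
  then have "(\<Sum>i\<in>I. a i *\<^sub>R u i) \<in> E x"
    by (intro subspace_sum[OF fibre_subspace] subspace_scale[OF fibre_subspace]) auto
  with insert show ?case using h_lin assms(2) by simp
qed

lemma h_sum2:
  assumes "finite I" "\<And>i. i \<in> I \<Longrightarrow> u i \<in> E x"
  shows "h x (\<Sum>i\<in>I. a i *\<^sub>R u i) (\<Sum>j\<in>I. b j *\<^sub>R u j) = (\<Sum>i\<in>I. \<Sum>j\<in>I. a i * b j * h x (u i) (u j))"
proof -
  have in_E: "(\<Sum>j\<in>I. b j *\<^sub>R u j) \<in> E x"
    using assms by (intro subspace_sum[OF fibre_subspace] subspace_scale[OF fibre_subspace]) auto
  have "h x (u i) (\<Sum>j\<in>I. b j *\<^sub>R u j) = (\<Sum>j\<in>I. b j * h x (u i) (u j))" if "i \<in> I" for i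
  proof -
    have "h x (u i) (\<Sum>j\<in>I. b j *\<^sub>R u j) = h x (\<Sum>j\<in>I. b j *\<^sub>R u j) (u i)"
      using in_E assms(2) that h_sym by blast
    also have "\<dots> = (\<Sum>j\<in>I. b j * h x (u i) (u j))"
      using h_sum[OF assms(1) assms(2)[OF that] assms(2)] that assms(2) h_sym[of "u i" x]
      by (simp cong: sum.cong)
    finally show ?thesis .
  qed
  then show ?thesis
    using h_sum[OF assms(1) in_E assms(2)] by (simp add: sum_distrib_left mult.assoc cong: sum.cong)
qed

lemma h_pos:
  assumes "u \<in> E x" "u \<noteq> 0" shows "h x u u > 0"
proof -
  have "\<forall>u\<in>E x. u \<noteq> 0 \<longrightarrow> h x u u > 0"
    using fibre_metric_inner[of x] unfolding inner_product_on_def by (elim conjE)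
  with assms show ?thesis by blast
qed

lemma h_nonneg: "u \<in> E x \<Longrightarrow> h x u u \<ge> 0"
  using h_pos h_zero by (metis less_eq_real_def)

lemma h_eq_0: "u \<in> E x \<Longrightarrow> h x u u = 0 \<Longrightarrow> u = 0"
  using h_pos by (metis less_irrefl)

lemma h_Cauchy_Schwarz:
  assumes u: "u \<in> E x" and v: "v \<in> E x"
  shows "(h x u v)\<^sup>2 \<le> h x u u * h x v v"
proof (cases "v = 0")
  case True
  then show ?thesis using h_zero[OF u] h_zero[OF v] h_sym[OF u v] by simp
next
  case False
  then have pos: "h x v v > 0" using h_pos v by blast
  \<comment> \<open>The minimiser of the squared norm of \<open>t *\<^sub>R v + u\<close>;
    nonnegativity of the minimum is the inequality.\<close>
  define t where "t = - (h x u v / h x v v)"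
  have tv: "t *\<^sub>R v \<in> E x" using subspace_scale[OF fibre_subspace v] .
  have in_E: "t *\<^sub>R v + u \<in> E x" using subspace_add[OF fibre_subspace tv u] .
  have "h x (t *\<^sub>R v + u) (t *\<^sub>R v + u) = t * (t * h x v v + h x v u) + (t * h x u v + h x u u)"
    by (simp add: h_lin[OF v u in_E] h_add_right[OF tv u v] h_add_right[OF tv u u] h_scale_right[OF v v] h_scale_right[OF v u])
  also have "\<dots> = h x u u - (h x u v)\<^sup>2 / h x v v"
    using pos h_sym[OF u v] by (simp add: t_def field_simps power2_eq_square)
  finally have "(h x u v)\<^sup>2 / h x v v \<le> h x u u" using h_nonneg[OF in_E] by simp
  then show ?thesis using pos by (simp add: pos_divide_le_eq)
qed

section \<open>Smooth sections and locality of the connection\<close>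

abbreviation smooth_sec :: "'m set \<Rightarrow> ('m \<Rightarrow> 'v) \<Rightarrow> bool" where
  "smooth_sec U \<sigma> \<equiv> smooth_section A E r Fr U \<sigma>"

lemma smooth_secD: "smooth_sec U \<sigma> \<Longrightarrow> x \<in> U \<Longrightarrow> \<sigma> x \<in> E x"
  by (simp add: smooth_section_def)

lemma smooth_sec_coeffs:
  assumes "smooth_sec U \<sigma>" "(V, s) \<in> Fr"
  shows "\<exists>a. (\<forall>i<r. smooth_fun A (U \<inter> V) (a i)) \<and> (\<forall>x\<in>U \<inter> V. \<sigma> x = (\<Sum>i<r. a i x *\<^sub>R s i x))"
  using assms unfolding smooth_section_def by force

lemma smooth_secI:
  assumes "\<And>x. x \<in> U \<Longrightarrow> \<sigma> x \<in> E x"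
    and "\<And>V s. (V, s) \<in> Fr \<Longrightarrow> \<exists>a. (\<forall>i<r. smooth_fun A (U \<inter> V) (a i)) \<and> (\<forall>x\<in>U \<inter> V. \<sigma> x = (\<Sum>i<r. a i x *\<^sub>R s i x))"
  shows "smooth_sec U \<sigma>"
  using assms unfolding smooth_section_def by force

lemma smooth_sec_subset:
  assumes "smooth_sec U \<sigma>" "U' \<subseteq> U" shows "smooth_sec U' \<sigma>"
proof (rule smooth_secI)
  fix x assume "x \<in> U'" with assms show "\<sigma> x \<in> E x" by (auto dest: smooth_secD)
next
  fix V s assume Fr: "(V, s) \<in> Fr"
  from smooth_sec_coeffs[OF assms(1) Fr] obtain a where
    "\<forall>i<r. smooth_fun A (U \<inter> V) (a i)" "\<forall>x\<in>U \<inter> V. \<sigma> x = (\<Sum>i<r. a i x *\<^sub>R s i x)"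
    by blast
  note a = this[rule_format]
  show "\<exists>a. (\<forall>i<r. smooth_fun A (U' \<inter> V) (a i)) \<and> (\<forall>x\<in>U' \<inter> V. \<sigma> x = (\<Sum>i<r. a i x *\<^sub>R s i x))"
  proof (rule exI[of _ a], intro conjI allI impI ballI)
    fix i assume "i < r" from smooth_fun_subset[OF a(1)[OF this]] show "smooth_fun A (U' \<inter> V) (a i)"
      using assms(2) by blast
  qed (use a(2) assms(2) in auto)
qed

lemma smooth_sec_scale:
  assumes U: "open U" and f: "smooth_fun A U f" and \<sigma>: "smooth_sec U \<sigma>"
  shows "smooth_sec U (\<lambda>x. f x *\<^sub>R \<sigma> x)"
proof (rule smooth_secI)
  fix x assume "x \<in> U" then show "f x *\<^sub>R \<sigma> x \<in> E x"
    using subspace_scale[OF fibre_subspace smooth_secD[OF \<sigma>]] by blast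
next
  fix V s assume Fr: "(V, s) \<in> Fr"
  from smooth_sec_coeffs[OF \<sigma> Fr] obtain a where
    "\<forall>i<r. smooth_fun A (U \<inter> V) (a i)" "\<forall>x\<in>U \<inter> V. \<sigma> x = (\<Sum>i<r. a i x *\<^sub>R s i x)"
    by blast
  note a = this[rule_format]
  have UV: "open (U \<inter> V)" using U frame_open[OF Fr] by blast
  have f': "smooth_fun A (U \<inter> V) f" by (rule smooth_fun_subset[OF f]) auto
  show "\<exists>a. (\<forall>i<r. smooth_fun A (U \<inter> V) (a i)) \<and> (\<forall>x\<in>U \<inter> V. f x *\<^sub>R \<sigma> x = (\<Sum>i<r. a i x *\<^sub>R s i x))"
  proof (rule exI[of _ "\<lambda>i x. f x * a i x"], intro conjI allI impI ballI)
    fix i assume "i < r" show "smooth_fun A (U \<inter> V) (\<lambda>x. f x * a i x)"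
      by (rule smooth_fun_mult[OF UV f' a(1)[OF \<open>i < r\<close>]])
  qed (use a(2) in \<open>auto simp: scaleR_sum_right\<close>)
qed

lemma smooth_sec_add:
  assumes U: "open U" and \<tau>: "smooth_sec U \<tau>" and \<sigma>: "smooth_sec U \<sigma>"
  shows "smooth_sec U (\<lambda>x. \<tau> x + \<sigma> x)"
proof (rule smooth_secI)
  fix x assume "x \<in> U" then show "\<tau> x + \<sigma> x \<in> E x"
    using subspace_add[OF fibre_subspace smooth_secD[OF \<tau>] smooth_secD[OF \<sigma>]] by blast
next
  fix V s assume Fr: "(V, s) \<in> Fr"
  from smooth_sec_coeffs[OF \<sigma> Fr] obtain a where
    "\<forall>i<r. smooth_fun A (U \<inter> V) (a i)" "\<forall>x\<in>U \<inter> V. \<sigma> x = (\<Sum>i<r. a i x *\<^sub>R s i x)"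
    by blast
  note a = this[rule_format]
  from smooth_sec_coeffs[OF \<tau> Fr] obtain b where
    "\<forall>i<r. smooth_fun A (U \<inter> V) (b i)" "\<forall>x\<in>U \<inter> V. \<tau> x = (\<Sum>i<r. b i x *\<^sub>R s i x)"
    by blast
  note b = this[rule_format]
  have UV: "open (U \<inter> V)" using U frame_open[OF Fr] by blast
  show "\<exists>a. (\<forall>i<r. smooth_fun A (U \<inter> V) (a i)) \<and> (\<forall>x\<in>U \<inter> V. \<tau> x + \<sigma> x = (\<Sum>i<r. a i x *\<^sub>R s i x))"
  proof (rule exI[of _ "\<lambda>i x. b i x + a i x"], intro conjI allI impI ballI)
    fix i assume "i < r" show "smooth_fun A (U \<inter> V) (\<lambda>x. b i x + a i x)"
      by (rule smooth_fun_add[OF UV b(1)[OF \<open>i < r\<close>] a(1)[OF \<open>i < r\<close>]])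
  next
    fix x assume x: "x \<in> U \<inter> V"
    show "\<tau> x + \<sigma> x = (\<Sum>i<r. (b i x + a i x) *\<^sub>R s i x)"
      unfolding a(2)[OF x] b(2)[OF x] by (simp add: scaleR_add_left sum.distrib)
  qed
qed

lemma smooth_sec_frame:
  assumes Us: "(U, s) \<in> Fr" and i: "i < r" shows "smooth_sec U (s i)"
proof (rule smooth_secI)
  fix x assume "x \<in> U" then show "s i x \<in> E x" using frame_in_fibre assms by blast
next
  fix V t assume Vt: "(V, t) \<in> Fr"
  from frame_transition[OF Vt Us] obtain a where
    a: "\<And>i j. i < r \<Longrightarrow> j < r \<Longrightarrow> smooth_fun A (V \<inter> U) (a i j)"
       "\<And>x j. x \<in> V \<inter> U \<Longrightarrow> j < r \<Longrightarrow> s j x = (\<Sum>i<r. a i j x *\<^sub>R t i x)"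
    by blast
  show "\<exists>a. (\<forall>i<r. smooth_fun A (U \<inter> V) (a i)) \<and> (\<forall>x\<in>U \<inter> V. s i x = (\<Sum>k<r. a k x *\<^sub>R t k x))"
  proof (rule exI[of _ "\<lambda>k. a k i"], intro conjI allI impI ballI)
    fix k assume "k < r" from a(1)[OF this i] show "smooth_fun A (U \<inter> V) (a k i)"
      by (simp add: Int_commute)
  qed (use a(2) i in auto)
qed

lemma smooth_fun_h:
  assumes U: "open U" and \<sigma>: "smooth_sec U \<sigma>" and \<tau>: "smooth_sec U \<tau>"
  shows "smooth_fun A U (\<lambda>x. h x (\<sigma> x) (\<tau> x))"
proof (rule smooth_fun_UN[where I = Fr and V = fst])
  fix Vs assume Fr': "Vs \<in> Fr"
  obtain V s where Vs: "Vs = (V, s)" by (cases Vs)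
  have Fr: "(V, s) \<in> Fr" using Fr' Vs by simp
  have V: "open V" using frame_open[OF Fr] .
  then show "open (fst Vs)" using Vs by simp
  from smooth_sec_coeffs[OF \<sigma> Fr] obtain a where
    "\<forall>i<r. smooth_fun A (U \<inter> V) (a i)" "\<forall>x\<in>U \<inter> V. \<sigma> x = (\<Sum>i<r. a i x *\<^sub>R s i x)"
    by blast
  note a = this[rule_format]
  from smooth_sec_coeffs[OF \<tau> Fr] obtain b where
    "\<forall>i<r. smooth_fun A (U \<inter> V) (b i)" "\<forall>x\<in>U \<inter> V. \<tau> x = (\<Sum>i<r. b i x *\<^sub>R s i x)"
    by blast
  note b = this[rule_format]
  have UV: "open (U \<inter> V)" using U V by auto
  have hs: "smooth_fun A (U \<inter> V) (\<lambda>x. h x (s i x) (s j x))" if "i < r" "j < r" for i j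
    by (rule smooth_fun_subset[OF fibre_metric_smooth[OF Fr that]]) auto
  have sm: "smooth_fun A (U \<inter> V) (\<lambda>x. \<Sum>i<r. \<Sum>j<r. a i x * b j x * h x (s i x) (s j x))"
    by (intro smooth_fun_sum smooth_fun_mult UV a(1) b(1) hs) auto
  have eq: "h x (\<sigma> x) (\<tau> x) = (\<Sum>i<r. \<Sum>j<r. a i x * b j x * h x (s i x) (s j x))" if "x \<in> U \<inter> V" for x
  proof -
    have x: "x \<in> U" "x \<in> V" using that by auto
    show ?thesis
      unfolding a(2)[OF that] b(2)[OF that] by (rule h_sum2) (use frame_in_fibre[OF Fr x(2)] in auto)
  qed
  show "smooth_fun A (U \<inter> fst Vs) (\<lambda>x. h x (\<sigma> x) (\<tau> x))"
    unfolding Vs fst_conv by (rule iffD2[OF smooth_fun_cong[OF UV eq] sm])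
qed (use frames_cover in auto)

lemma N_in_fibre: "open U \<Longrightarrow> smooth_sec U \<sigma> \<Longrightarrow> x \<in> U \<Longrightarrow> N \<sigma> x v \<in> E x"
  using connection_linear by blast

lemma N_linear: "open U \<Longrightarrow> smooth_sec U \<sigma> \<Longrightarrow> x \<in> U \<Longrightarrow> linear (N \<sigma> x)"
  using connection_linear by blast

text \<open>\<open>N\<close> takes a function on the whole type, so agreement on \<open>U\<close>
  does not make the arguments equal. Multiplied by the indicator of \<open>U\<close> they do become
  equal; on \<open>U\<close> that indicator is 1 with zero differential, so by the Leibniz rule the
  multiplication leaves the derivative unchanged.\<close>

lemma N_local:
  assumes U: "open U" and \<sigma>: "smooth_sec U \<sigma>" and \<tau>: "smooth_sec U \<tau>" and x: "x \<in> U"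
    and eq: "\<And>y. y \<in> U \<Longrightarrow> \<sigma> y = \<tau> y"
  shows "N \<sigma> x v = N \<tau> x v"
proof -
  let ?f = "\<lambda>y. if y \<in> U then 1 else 0 :: real"
  have f: "smooth_fun A U ?f" using smooth_fun_cong[OF U, of ?f "\<lambda>_. 1"] by simp
  have df: "differential A ?f x v = 0" using differential_cong[OF U x, of ?f "\<lambda>_. 1"] by simp
  have "N \<sigma> x v = N (\<lambda>y. ?f y *\<^sub>R \<sigma> y) x v"
    using connection_Leibniz[OF U f \<sigma> x] df x by simp
  also have "(\<lambda>y. ?f y *\<^sub>R \<sigma> y) = (\<lambda>y. ?f y *\<^sub>R \<tau> y)" using eq by auto
  also have "N (\<lambda>y. ?f y *\<^sub>R \<tau> y) x v = N \<tau> x v"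
    using connection_Leibniz[OF U f \<tau> x] df x by simp
  finally show ?thesis .
qed

section \<open>Norms of the covariant derivative and their continuity\<close>

lemma differential_norm_sq:
  assumes "open U" "smooth_sec U \<sigma>" "x \<in> U"
  shows "differential A (\<lambda>y. h y (\<sigma> y) (\<sigma> y)) x v = 2 * h x (N \<sigma> x v) (\<sigma> x)"
  using connection_metric[OF assms(1,2,2,3)] h_sym[OF N_in_fibre[OF assms] smooth_secD[OF assms(2,3)]] by simp

text \<open>The same choice that \<open>covariant_norm_sq\<close> makes internally; nothing makes it
  vary continuously with \<open>x\<close>.\<close>

definition onb :: "'m \<Rightarrow> 'n \<Rightarrow> real^'n" where
  "onb x = (SOME e. orthonormal_basis (g x) e)"

lemma onb: "orthonormal_basis (g x) (onb x)"
  unfolding onb_def using metric.ex_orthonormal by (rule someI_ex)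

lemma covariant_norm_sq_onb:
  "covariant_norm_sq g h N \<sigma> x = (\<Sum>i\<in>UNIV. h x (N \<sigma> x (onb x i)) (N \<sigma> x (onb x i)))"
  by (simp add: covariant_norm_sq_def onb_def Let_def)

text \<open>For smooth \<sigma> this is |\<nabla>F|^2, because metric compatibility gives dF(v) =
  \<open>h x (N \<sigma> x v) (\<sigma> x)\<close>. As a sum over the basis of
  \<open>covariant_norm_sq\<close> it can be compared with that norm term by term.\<close>

definition grad_norm_sq :: "('m \<Rightarrow> 'v) \<Rightarrow> 'm \<Rightarrow> real" where
  "grad_norm_sq \<sigma> x = (\<Sum>i\<in>UNIV. (h x (N \<sigma> x (onb x i)) (\<sigma> x))\<^sup>2)"

lemma gradient_norm_sq:
  fixes x
  assumes \<sigma>: "smooth_sec UNIV \<sigma>"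
  defines "v \<equiv> gradient A g (\<lambda>x. 1/2 * h x (\<sigma> x) (\<sigma> x)) x"
  shows "g x v v = grad_norm_sq \<sigma> x"
proof -
  let ?u = "\<lambda>x. h x (\<sigma> x) (\<sigma> x)"
  have u: "smooth_fun A UNIV ?u" using smooth_fun_h[OF _ \<sigma> \<sigma>] by simp
  have d: "differential A (\<lambda>x. 1/2 * ?u x) x w = h x (N \<sigma> x w) (\<sigma> x)" for w
    using differential_affine[OF _ _ u, of x 0 "1/2" w] differential_norm_sq[OF _ \<sigma>, of x w] by simp
  have "linear (differential A (\<lambda>x. 1/2 * ?u x) x)"
    by (rule differential_linear[OF open_UNIV UNIV_I smooth_fun_mult[OF open_UNIV smooth_fun_const u]])
  from metric.riesz(2)[OF onb this] show ?thesis
    unfolding v_def gradient_def d grad_norm_sq_def .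
qed

definition energy_density :: "real \<Rightarrow> real \<Rightarrow> ('m \<Rightarrow> 'v) \<Rightarrow> 'm \<Rightarrow> real" where
  "energy_density p q \<sigma> x = 1 / (1 + h x (\<sigma> x) (\<sigma> x)) powr p *
     (covariant_norm_sq g h N \<sigma> x + q * grad_norm_sq \<sigma> x)"

lemma vertical_energy_density:
  "smooth_sec UNIV \<sigma> \<Longrightarrow> vertical_energy A g h N p q \<sigma> = 1/2 * (LINT x|riemannian_measure A g. energy_density p q \<sigma> x)"
  unfolding vertical_energy_def Let_def energy_density_def by (simp only: gradient_norm_sq)

lemma grad_norm_sq_le:
  assumes "smooth_sec UNIV \<sigma>"
  shows "grad_norm_sq \<sigma> x \<le> h x (\<sigma> x) (\<sigma> x) * covariant_norm_sq g h N \<sigma> x"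
  unfolding grad_norm_sq_def covariant_norm_sq_onb sum_distrib_left
  by (rule sum_mono)
    (use assms h_Cauchy_Schwarz[OF N_in_fibre[OF open_UNIV assms] smooth_secD[OF assms]] in \<open>auto simp: mult.commute\<close>)

lemma covariant_norm_sq_nonneg:
  "smooth_sec UNIV \<sigma> \<Longrightarrow> covariant_norm_sq g h N \<sigma> x \<ge> 0"
  unfolding covariant_norm_sq_onb by (intro sum_nonneg h_nonneg N_in_fibre[of UNIV]) auto

lemma grad_norm_sq_nonneg: "grad_norm_sq \<sigma> x \<ge> 0"
  by (simp add: grad_norm_sq_def sum_nonneg)

lemma covariant_norm_sq_eq_0:
  assumes "smooth_sec UNIV \<sigma>" "covariant_norm_sq g h N \<sigma> x = 0" shows "N \<sigma> x v = 0"
proof -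
  have "h x (N \<sigma> x (onb x i)) (N \<sigma> x (onb x i)) = 0" for i
    using assms(2) h_nonneg[OF N_in_fibre[OF open_UNIV assms(1)]] unfolding covariant_norm_sq_onb
    by (subst (asm) sum_nonneg_eq_0_iff) auto
  then have "N \<sigma> x (onb x i) = 0" for i
    using h_eq_0[OF N_in_fibre[OF open_UNIV assms(1)]] by auto
  then have "N \<sigma> x (\<Sum>i\<in>UNIV. g x v (onb x i) *\<^sub>R onb x i) = 0"
    by (simp add: linear_sum[OF N_linear[OF open_UNIV assms(1) UNIV_I]] linear_cmul[OF N_linear[OF open_UNIV assms(1) UNIV_I]])
  then show ?thesis using metric.orthonormal_expansion[OF onb, of v x] by simp
qed

abbreviation coord_vec :: "('m, 'n) chart \<Rightarrow> 'm \<Rightarrow> 'n \<Rightarrow> real^'n" where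
  "coord_vec c x i \<equiv> tangent_vec A c x (axis i 1)"

lemma trace_onb:
  assumes "c \<in> A" "x \<in> fst c" "bilinear B"
  shows "(\<Sum>i\<in>UNIV. B (onb x i) (onb x i)) =
     (\<Sum>j\<in>UNIV. \<Sum>k\<in>UNIV. cramer_inverse (gram_matrix A g c x) $ j $ k * B (coord_vec c x j) (coord_vec c x k))"
  using metric.trace_gram_inverse[OF onb _ assms(3), of x "coord_vec c x"] cramer_inverse[of "gram_matrix A g c x"]
    det_gram_matrix_pos[OF assms(1,2)] by (simp add: gram_matrix_eq)

lemma continuous_on_inverse_gram:
  "c \<in> A \<Longrightarrow> continuous_on (fst c) (\<lambda>x. cramer_inverse (gram_matrix A g c x) $ j $ k)"
  by (rule continuous_on_cramer_inverse[OF continuous_on_gram_matrix]) (auto dest: det_gram_matrix_pos)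

text \<open>Inside a chart, \<open>trace_onb\<close> turns the sum over the possibly discontinuous
  \<open>onb\<close> into one over coordinate vectors with the inverse Gram matrix as coefficients,
  where every ingredient is continuous. Charts are open and cover M.\<close>

lemma continuous_trace:
  fixes B :: "'m \<Rightarrow> real^'n \<Rightarrow> real^'n \<Rightarrow> real"
  assumes "\<And>x. bilinear (B x)"
    and "\<And>c j k. c \<in> A \<Longrightarrow> continuous_on (fst c) (\<lambda>x. B x (coord_vec c x j) (coord_vec c x k))"
  shows "continuous_on UNIV (\<lambda>x. \<Sum>i\<in>UNIV. B x (onb x i) (onb x i))"
proof -
  have "continuous_on (\<Union>c\<in>A. fst c) (\<lambda>x. \<Sum>i\<in>UNIV. B x (onb x i) (onb x i))"
  proof (rule continuous_on_open_UN)
    fix c assume c: "c \<in> A"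
    then show "open (fst c)" by (rule chart_open)
    have "continuous_on (fst c) (\<lambda>x. \<Sum>j\<in>UNIV. \<Sum>k\<in>UNIV. cramer_inverse (gram_matrix A g c x) $ j $ k * B x (coord_vec c x j) (coord_vec c x k))"
      by (intro continuous_intros continuous_on_inverse_gram assms(2) c)
    then show "continuous_on (fst c) (\<lambda>x. \<Sum>i\<in>UNIV. B x (onb x i) (onb x i))"
      by (rule continuous_on_eq) (simp add: trace_onb[OF c _ assms(1)])
  qed
  then show ?thesis using charts_cover by simp
qed

lemma smooth_sec_coord_derivative:
  "smooth_sec UNIV \<sigma> \<Longrightarrow> c \<in> A \<Longrightarrow> smooth_sec (fst c) (\<lambda>x. N \<sigma> x (coord_vec c x j))"
  using connection_smooth[OF open_UNIV, of \<sigma> c "axis j 1"] by simp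

lemma bilinear_h_N: "smooth_sec UNIV \<sigma> \<Longrightarrow> bilinear (\<lambda>v w. h x (N \<sigma> x v) (N \<sigma> x w))"
  using N_in_fibre[OF open_UNIV, of \<sigma> x] N_linear[OF open_UNIV, of \<sigma> x]
  by (auto simp: bilinear_def linear_iff h_add h_add_right h_scale h_scale_right)

lemma linear_h_N: "smooth_sec UNIV \<sigma> \<Longrightarrow> linear (\<lambda>v. h x (N \<sigma> x v) (\<sigma> x))"
  using N_in_fibre[OF open_UNIV, of \<sigma> x] N_linear[OF open_UNIV, of \<sigma> x] smooth_secD[of UNIV \<sigma> x]
  by (auto simp: linear_iff h_add h_scale)

lemma continuous_covariant_norm_sq:
  assumes "smooth_sec UNIV \<sigma>" shows "continuous_on UNIV (covariant_norm_sq g h N \<sigma>)"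
  unfolding covariant_norm_sq_onb[abs_def]
proof (rule continuous_trace[where B = "\<lambda>x v w. h x (N \<sigma> x v) (N \<sigma> x w)"])
  fix c j k assume c: "c \<in> A"
  show "continuous_on (fst c) (\<lambda>x. h x (N \<sigma> x (coord_vec c x j)) (N \<sigma> x (coord_vec c x k)))"
    by (intro smooth_fun_continuous smooth_fun_h chart_open[OF c] smooth_sec_coord_derivative[OF assms c])
qed (rule bilinear_h_N[OF assms])

lemma continuous_grad_norm_sq:
  assumes "smooth_sec UNIV \<sigma>" shows "continuous_on UNIV (grad_norm_sq \<sigma>)"
proof -
  have bil: "bilinear (\<lambda>v w. h x (N \<sigma> x v) (\<sigma> x) * h x (N \<sigma> x w) (\<sigma> x))" for x
    using linear_h_N[OF assms, of x] by (auto simp: bilinear_def linear_iff algebra_simps)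
  have "continuous_on (fst c) (\<lambda>x. h x (N \<sigma> x (coord_vec c x j)) (\<sigma> x))" if "c \<in> A" for c j
    by (intro smooth_fun_continuous smooth_fun_h chart_open[OF that] smooth_sec_coord_derivative[OF assms that]
        smooth_sec_subset[OF assms subset_UNIV])
  then have "continuous_on UNIV (\<lambda>x. \<Sum>i\<in>UNIV. h x (N \<sigma> x (onb x i)) (\<sigma> x) * h x (N \<sigma> x (onb x i)) (\<sigma> x))"
    by (intro continuous_trace bil continuous_on_mult)
  then show ?thesis by (simp add: grad_norm_sq_def[abs_def] power2_eq_square)
qed

end

section \<open>Variations of parallel sections\<close>

context riemannian_vector_bundle
begin

text \<open>Smoothness and the formula are proved together: \<open>connection_add\<close> in the
  induction step requires the partial sum to be a smooth section.\<close>

lemma N_combination: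
  assumes Fr: "(V, s) \<in> Fr" and "finite I" "I \<subseteq> {..<r}"
    and \<alpha>: "\<And>i. i < r \<Longrightarrow> smooth_fun A V (\<alpha> i)"
  shows "smooth_sec V (\<lambda>y. \<Sum>i\<in>I. \<alpha> i y *\<^sub>R s i y) \<and>
    (\<forall>x\<in>V. N (\<lambda>y. \<Sum>i\<in>I. \<alpha> i y *\<^sub>R s i y) x v =
      (\<Sum>i\<in>I. differential A (\<alpha> i) x v *\<^sub>R s i x + \<alpha> i x *\<^sub>R N (s i) x v))"
  using assms(2,3)
proof (induction I rule: finite_induct)
  case empty
  have V: "open V" using frame_open[OF Fr] .
  have 0: "smooth_sec V (\<lambda>y. 0)"
    by (rule smooth_secI) (auto intro!: exI[of _ "\<lambda>i x. 0"] subspace_0[OF fibre_subspace])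
  have "N (\<lambda>y. 0) x v = 0" if "x \<in> V" for x
    using connection_Leibniz[OF V smooth_fun_const[of _ 0] 0 that, of v] by simp
  with 0 show ?case by simp
next
  case (insert i I)
  have V: "open V" using frame_open[OF Fr] .
  have i: "i < r" using insert.prems by simp
  have si: "smooth_sec V (s i)" using smooth_sec_frame[OF Fr i] .
  have asi: "smooth_sec V (\<lambda>y. \<alpha> i y *\<^sub>R s i y)" using smooth_sec_scale[OF V \<alpha>[OF i] si] .
  have IH: "smooth_sec V (\<lambda>y. \<Sum>i\<in>I. \<alpha> i y *\<^sub>R s i y)"
    "\<And>x. x \<in> V \<Longrightarrow> N (\<lambda>y. \<Sum>i\<in>I. \<alpha> i y *\<^sub>R s i y) x v =
      (\<Sum>i\<in>I. differential A (\<alpha> i) x v *\<^sub>R s i x + \<alpha> i x *\<^sub>R N (s i) x v)"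
    using insert by auto
  have sum: "(\<lambda>y. \<Sum>j\<in>insert i I. \<alpha> j y *\<^sub>R s j y) = (\<lambda>y. \<alpha> i y *\<^sub>R s i y + (\<Sum>j\<in>I. \<alpha> j y *\<^sub>R s j y))"
    using insert by simp
  have "smooth_sec V (\<lambda>y. \<Sum>j\<in>insert i I. \<alpha> j y *\<^sub>R s j y)"
    unfolding sum by (rule smooth_sec_add[OF V asi IH(1)])
  moreover have "N (\<lambda>y. \<Sum>j\<in>insert i I. \<alpha> j y *\<^sub>R s j y) x v =
      (\<Sum>j\<in>insert i I. differential A (\<alpha> j) x v *\<^sub>R s j x + \<alpha> j x *\<^sub>R N (s j) x v)" if x: "x \<in> V" for x
    unfolding sum connection_add[OF V asi IH(1) x] connection_Leibniz[OF V \<alpha>[OF i] si x] IH(2)[OF x]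
    using insert by simp
  ultimately show ?case by blast
qed

lemma variation_coeffs:
  assumes "smooth_variation A E r Fr \<sigma> \<epsilon> \<Sigma>" "c \<in> A" "(V, s) \<in> Fr"
  shows "\<exists>a. (\<forall>i<r. smooth_on ({-\<epsilon><..<\<epsilon>} \<times> snd c ` (fst c \<inter> V)) (a i)) \<and>
    (\<forall>t\<in>{-\<epsilon><..<\<epsilon>}. \<forall>x\<in>fst c \<inter> V. \<Sigma> t x = (\<Sum>i<r. a i (t, snd c x) *\<^sub>R s i x))"
  using assms unfolding smooth_variation_def by fastforce

text \<open>A variation comes with separate coefficient functions for each chart, whereas a smooth
  section needs one family on all of \<open>V\<close>. Linear independence of the frame makes the
  families agree on overlaps, so reading the coefficient in the preferred chart of each point gives
  a smooth function.\<close>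

lemma variation_smooth_sec:
  assumes var: "smooth_variation A E r Fr \<sigma> \<epsilon> \<Sigma>" and t: "t \<in> {-\<epsilon><..<\<epsilon>}"
  shows "smooth_sec UNIV (\<Sigma> t)"
proof (rule smooth_secI)
  fix x show "\<Sigma> t x \<in> E x" using assms unfolding smooth_variation_def by blast
next
  fix V s assume Fr: "(V, s) \<in> Fr"
  have "\<forall>c\<in>A. \<exists>a. (\<forall>i<r. smooth_on ({-\<epsilon><..<\<epsilon>} \<times> snd c ` (fst c \<inter> V)) (a i)) \<and>
    (\<forall>t\<in>{-\<epsilon><..<\<epsilon>}. \<forall>x\<in>fst c \<inter> V. \<Sigma> t x = (\<Sum>i<r. a i (t, snd c x) *\<^sub>R s i x))"
    using variation_coeffs[OF var _ Fr] by blast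
  from bchoice[OF this] obtain a where
    "\<forall>c\<in>A. (\<forall>i<r. smooth_on ({-\<epsilon><..<\<epsilon>} \<times> snd c ` (fst c \<inter> V)) (a c i)) \<and>
    (\<forall>t\<in>{-\<epsilon><..<\<epsilon>}. \<forall>x\<in>fst c \<inter> V. \<Sigma> t x = (\<Sum>i<r. a c i (t, snd c x) *\<^sub>R s i x))"
    by blast
  then have a: "\<And>c i. c \<in> A \<Longrightarrow> i < r \<Longrightarrow> smooth_on ({-\<epsilon><..<\<epsilon>} \<times> snd c ` (fst c \<inter> V)) (a c i)"
    "\<And>c x. c \<in> A \<Longrightarrow> x \<in> fst c \<Longrightarrow> x \<in> V \<Longrightarrow> \<Sigma> t x = (\<Sum>i<r. a c i (t, snd c x) *\<^sub>R s i x)"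
    using t by blast+
  have V: "open V" using frame_open[OF Fr] .
  define b where "b i x = a (chart_at A x) i (t, snd (chart_at A x) x)" for i x
  have b: "b i x = a c i (t, snd c x)" if "c \<in> A" "x \<in> fst c" "x \<in> V" "i < r" for c i x
    unfolding b_def
    by (rule frame_combination_inj[OF Fr that(3) _ that(4)])
      (use a(2)[OF that(1-3)] a(2)[OF chart_at that(3)] in simp)
  show "\<exists>a. (\<forall>i<r. smooth_fun A (UNIV \<inter> V) (a i)) \<and> (\<forall>x\<in>UNIV \<inter> V. \<Sigma> t x = (\<Sum>i<r. a i x *\<^sub>R s i x))"
  proof (rule exI[of _ b], intro conjI allI impI ballI)
    fix i assume i: "i < r"
    show "smooth_fun A (UNIV \<inter> V) (b i)"
    proof (rule smooth_funI)
      fix c assume c: "c \<in> A"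
      have W: "open (snd c ` (fst c \<inter> V))" by (rule chart_open_image[OF c V])
      have "smooth_on (snd c ` (fst c \<inter> V)) (\<lambda>y. a c i (t, y))"
        by (rule smooth_on_slice(1)[OF a(1)[OF c i] t W])
      moreover have "b i (chart_inv c y) = a c i (t, y)" if "y \<in> snd c ` (fst c \<inter> V)" for y
        using that b[OF c _ _ i] c by auto
      ultimately show "smooth_on (snd c ` (fst c \<inter> (UNIV \<inter> V))) (\<lambda>y. b i (chart_inv c y))"
        using smooth_on_cong[OF W, of "\<lambda>y. b i (chart_inv c y)" "\<lambda>y. a c i (t, y)"] by simp
    qed
  next
    fix x assume "x \<in> UNIV \<inter> V"
    then show "\<Sigma> t x = (\<Sum>i<r. b i x *\<^sub>R s i x)"
      using a(2)[OF chart_at] by (simp add: b_def)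
  qed
qed

text \<open>In a chart and a frame the covariant derivatives of the \<open>\<Sigma> t\<close> have coefficients smooth in
  \<open>(t, y)\<close>.  If the base section is parallel these coefficients vanish at \<open>t = 0\<close>.\<close>

lemma variation_covariant_coeffs:
  assumes var: "smooth_variation A E r Fr \<sigma> \<epsilon> \<Sigma>" and c: "c \<in> A" and Fr: "(V, s) \<in> Fr"
  obtains b where
    "\<And>j k. k < r \<Longrightarrow> smooth_on ({-\<epsilon><..<\<epsilon>} \<times> snd c ` (fst c \<inter> V)) (b j k)"
    "\<And>j t x. t \<in> {-\<epsilon><..<\<epsilon>} \<Longrightarrow> x \<in> fst c \<inter> V \<Longrightarrow>
       N (\<Sigma> t) x (coord_vec c x j) = (\<Sum>k<r. b j k (t, snd c x) *\<^sub>R s k x)"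
proof -
  let ?W = "snd c ` (fst c \<inter> V)" let ?Z = "{-\<epsilon><..<\<epsilon>} \<times> ?W"
  have V: "open V" using frame_open[OF Fr] .
  have W: "open ?W" by (rule chart_open_image[OF c V])
  have Z: "open ?Z" using W by (intro open_Times) auto
  from variation_coeffs[OF var c Fr] obtain a where
    "\<forall>i<r. smooth_on ?Z (a i)"
    "\<forall>t\<in>{-\<epsilon><..<\<epsilon>}. \<forall>x\<in>fst c \<inter> V. \<Sigma> t x = (\<Sum>i<r. a i (t, snd c x) *\<^sub>R s i x)" by blast
  note a = this[rule_format]
  \<comment> \<open>The \<open>\<Gamma> i j k\<close> will be the connection coefficients of the
    frame in the chart \<open>c\<close>; the predicate \<open>R\<close> prepares their simultaneous
    choice for all \<open>i\<close> and \<open>j\<close>.\<close>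
  define R where "R i j \<Gamma> \<longleftrightarrow> (\<forall>k<r. smooth_fun A (V \<inter> fst c \<inter> V) (\<Gamma> k)) \<and>
      (\<forall>x\<in>V \<inter> fst c \<inter> V. N (s i) x (coord_vec c x j) = (\<Sum>k<r. \<Gamma> k x *\<^sub>R s k x))" for i j \<Gamma>
  have "\<exists>\<Gamma>. R i j \<Gamma>" if "i < r" for i j
    unfolding R_def
    by (rule smooth_sec_coeffs[OF connection_smooth[OF V smooth_sec_frame[OF Fr that] c] Fr])
  then obtain \<Gamma> where "\<And>i j. i < r \<Longrightarrow> R i j (\<Gamma> i j)" by metis
  then have \<Gamma>: "\<And>i j k. i < r \<Longrightarrow> k < r \<Longrightarrow> smooth_fun A (V \<inter> fst c \<inter> V) (\<Gamma> i j k)"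
    and \<Gamma>_eq: "\<And>i j x. i < r \<Longrightarrow> x \<in> fst c \<Longrightarrow> x \<in> V \<Longrightarrow> N (s i) x (coord_vec c x j) = (\<Sum>k<r. \<Gamma> i j k x *\<^sub>R s k x)"
    unfolding R_def by auto
  \<comment> \<open>The classical local formula for \<nabla>: the derivative of the
    \<open>k\<close>-th coefficient plus the contraction with the connection coefficients. The
    direction \<open>(0, axis j 1)\<close> differentiates in space at fixed
    \<open>t\<close>.\<close>
  define b where "b j k z = frechet_derivative (a k) (at z) (0, axis j 1) +
      (\<Sum>i<r. a i z * \<Gamma> i j k (chart_inv c (snd z)))" for j k z
  have \<Gamma>_smooth: "smooth_on ?Z (\<lambda>z. \<Gamma> i j k (chart_inv c (snd z)))" if "i < r" "k < r" for i j k
  proof (rule smooth_on_compose_snd[OF _ W])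
    have "fst c \<inter> (V \<inter> fst c \<inter> V) = fst c \<inter> V" by blast
    moreover have "smooth_fun A (V \<inter> fst c \<inter> V) (\<Gamma> i j k)" by (rule \<Gamma>[OF that])
    ultimately show "smooth_on ?W (\<lambda>y. \<Gamma> i j k (chart_inv c y))" using smooth_funD[OF _ c] by metis
  qed auto
  have "smooth_on ?Z (b j k)" if "k < r" for j k
    unfolding b_def[abs_def]
    by (intro smooth_on_add smooth_on_sum smooth_on_mult Z smooth_on_derivative a(1) \<Gamma>_smooth that) auto
  moreover have "N (\<Sigma> t) x (coord_vec c x j) = (\<Sum>k<r. b j k (t, snd c x) *\<^sub>R s k x)"
    if t: "t \<in> {-\<epsilon><..<\<epsilon>}" and x: "x \<in> fst c \<inter> V" for j t x
  proof -
    have xc: "x \<in> fst c" "x \<in> V" using x by auto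
    have St: "smooth_sec V (\<Sigma> t)"
      by (rule smooth_sec_subset[OF variation_smooth_sec[OF var t] subset_UNIV])
    \<comment> \<open>\<open>a\<close> lives on coordinates, while \<open>N_combination\<close>
      needs coefficient functions on the manifold; \<open>\<alpha>\<close> provides them on
      \<open>V\<close>, and by uniqueness they match \<open>a\<close> inside the chart.\<close>
    from smooth_sec_coeffs[OF St Fr] obtain \<alpha> where
      \<alpha>: "\<forall>i<r. smooth_fun A (V \<inter> V) (\<alpha> i)" "\<forall>x\<in>V \<inter> V. \<Sigma> t x = (\<Sum>i<r. \<alpha> i x *\<^sub>R s i x)" by blast
    have \<alpha>s: "smooth_fun A V (\<alpha> i)" if "i < r" for i using \<alpha>(1) that by simp
    have comb: "smooth_sec V (\<lambda>y. \<Sum>i<r. \<alpha> i y *\<^sub>R s i y)"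
      "N (\<lambda>y. \<Sum>i<r. \<alpha> i y *\<^sub>R s i y) x v = (\<Sum>i<r. differential A (\<alpha> i) x v *\<^sub>R s i x + \<alpha> i x *\<^sub>R N (s i) x v)" for v
      using N_combination[OF Fr finite_lessThan[of r] subset_refl, of \<alpha> v] \<alpha>s xc(2) by auto
    have \<alpha>a: "\<alpha> i y = a i (t, snd c y)" if "y \<in> fst c \<inter> V" "i < r" for i y
      by (rule frame_combination_inj[OF Fr _ _ that(2)]) (use \<alpha>(2) a(2)[OF t that(1)] that in auto)
    have d\<alpha>: "differential A (\<alpha> i) x (coord_vec c x j) = frechet_derivative (a i) (at (t, snd c x)) (0, axis j 1)"
      if i: "i < r" for i
    proof -
      have "((\<lambda>y. \<alpha> i (chart_inv c y)) has_derivative (\<lambda>w. differential A (\<alpha> i) x (tangent_vec A c x w))) (at (snd c x))"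
        by (rule smooth_fun_chart_has_derivative[OF c xc(1) V xc(2) \<alpha>s[OF i]])
      then have "((\<lambda>y. a i (t, y)) has_derivative (\<lambda>w. differential A (\<alpha> i) x (tangent_vec A c x w))) (at (snd c x))"
        by (rule has_derivative_transform_within_open[OF _ W]) (use x \<alpha>a[OF _ i] c in auto)
      from frechet_derivative_at[OF this, symmetric]
      show ?thesis
        using smooth_on_slice(2)[OF a(1)[OF i] t W, of "snd c x" "axis j 1"] x by simp
    qed
    have "N (\<Sigma> t) x (coord_vec c x j) = N (\<lambda>y. \<Sum>i<r. \<alpha> i y *\<^sub>R s i y) x (coord_vec c x j)"
      by (rule N_local[OF V St _ xc(2)])
        (use comb(1) \<alpha>(2) in auto)
    also have "\<dots> = (\<Sum>i<r. differential A (\<alpha> i) x (coord_vec c x j) *\<^sub>R s i x + \<alpha> i x *\<^sub>R N (s i) x (coord_vec c x j))"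
      by (rule comb(2))
    also have "\<dots> = (\<Sum>i<r. frechet_derivative (a i) (at (t, snd c x)) (0, axis j 1) *\<^sub>R s i x) +
        (\<Sum>i<r. a i (t, snd c x) *\<^sub>R (\<Sum>k<r. \<Gamma> i j k x *\<^sub>R s k x))"
      unfolding sum.distrib[symmetric]
      by (rule sum.cong[OF refl]) (use d\<alpha> \<alpha>a[OF x] \<Gamma>_eq[OF _ xc] in auto)
    also have "(\<Sum>i<r. a i (t, snd c x) *\<^sub>R (\<Sum>k<r. \<Gamma> i j k x *\<^sub>R s k x)) =
        (\<Sum>k<r. (\<Sum>i<r. a i (t, snd c x) * \<Gamma> i j k x) *\<^sub>R s k x)"
      unfolding scaleR_sum_right scaleR_sum_left scaleR_scaleR by (rule sum.swap)
    finally show ?thesis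
      unfolding b_def using c xc by (simp add: scaleR_add_left sum.distrib)
  qed
  ultimately show ?thesis using that by blast
qed

text \<open>The frame coefficients of the covariant derivative vanish at t = 0, hence are O(t); its
  squared norm is quadratic in them with locally bounded coefficients, hence O(t^2), and
  Cauchy-Schwarz carries this over to the gradient term. The filter
  \<open>nhds (0, snd c x0)\<close> makes the estimates hold jointly for \<open>t\<close> near 0 and
  \<open>x\<close> near \<open>x0\<close>.\<close>

lemma parallel_variation_energy_density_local:
  assumes \<sigma>: "smooth_sec UNIV \<sigma>" and par: "parallel N \<sigma>" and var: "smooth_variation A E r Fr \<sigma> \<epsilon> \<Sigma>"
  shows "\<exists>U C d. open U \<and> x0 \<in> U \<and> d > 0 \<and> (\<forall>t x. \<bar>t\<bar> < d \<longrightarrow> x \<in> U \<longrightarrow> \<bar>energy_density p q (\<Sigma> t) x\<bar> \<le> C * t\<^sup>2)"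
proof -
  define c where "c = chart_at A x0"
  have c: "c \<in> A" "x0 \<in> fst c" using chart_at by (auto simp: c_def)
  have "x0 \<in> (\<Union>F\<in>Fr. fst F)" using frames_cover by simp
  then obtain V s where Fr: "(V, s) \<in> Fr" and x0V: "x0 \<in> V" by auto
  have V: "open V" using frame_open[OF Fr] .
  let ?W = "snd c ` (fst c \<inter> V)" let ?Z = "{-\<epsilon><..<\<epsilon>} \<times> ?W" let ?F = "nhds (0::real, snd c x0)"
  have W: "open ?W" by (rule chart_open_image[OF c(1) V])
  have Z: "open ?Z" using W by (intro open_Times) auto
  have \<epsilon>: "\<epsilon> > 0" and \<Sigma>0: "\<Sigma> 0 = \<sigma>" using var by (auto simp: smooth_variation_def)
  have z0: "(0, snd c x0) \<in> ?Z" using \<epsilon> c x0V by auto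
  obtain b where b: "\<And>j k. k < r \<Longrightarrow> smooth_on ?Z (b j k)"
    "\<And>j t x. t \<in> {-\<epsilon><..<\<epsilon>} \<Longrightarrow> x \<in> fst c \<inter> V \<Longrightarrow> N (\<Sigma> t) x (coord_vec c x j) = (\<Sum>k<r. b j k (t, snd c x) *\<^sub>R s k x)"
    by (rule variation_covariant_coeffs[OF var c(1) Fr]) blast
  from variation_coeffs[OF var c(1) Fr] obtain a where
    "\<forall>i<r. smooth_on ?Z (a i)"
    "\<forall>t\<in>{-\<epsilon><..<\<epsilon>}. \<forall>x\<in>fst c \<inter> V. \<Sigma> t x = (\<Sum>i<r. a i (t, snd c x) *\<^sub>R s i x)" by blast
  note a = this[rule_format]
  have b_bigo: "b j k \<in> O[?F](fst)" if k: "k < r" for j k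
  proof (rule smooth_on_vanishing_bigo[OF b(1)[OF k] \<epsilon> W])
    fix y assume "y \<in> ?W"
    then obtain x where x: "y = snd c x" "x \<in> fst c \<inter> V" by auto
    have "(\<Sum>k<r. b j k (0, snd c x) *\<^sub>R s k x) = (\<Sum>k<r. 0 *\<^sub>R s k x)"
      using b(2)[of 0 x j] par \<epsilon> x \<Sigma>0 by (simp add: parallel_def)
    from frame_combination_inj[OF Fr _ this k] x show "b j k (0, y) = 0" by auto
  qed (use c x0V in auto)
  have cont_snd: "(\<lambda>z. f (chart_inv c (snd z))) \<in> O[?F](\<lambda>_. 1)" if "continuous_on (fst c \<inter> V) f" for f :: "'m \<Rightarrow> real"
  proof (rule continuous_on_bigo_1[OF _ Z z0])
    have "continuous_on ?W (chart_inv c)"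
      by (rule continuous_on_subset[OF continuous_on_chart_inv[OF c(1)]]) auto
    then have "continuous_on ?Z (\<lambda>z. chart_inv c (snd z))"
      by (rule continuous_on_compose2) (auto intro: continuous_intros)
    then show "continuous_on ?Z (\<lambda>z. f (chart_inv c (snd z)))"
      by (rule continuous_on_compose2[OF that]) (use c in auto)
  qed
  define H where "H k m z = h (chart_inv c (snd z)) (s k (chart_inv c (snd z))) (s m (chart_inv c (snd z)))" for k m and z :: "real \<times> (real^'n)"
  have H: "H k m \<in> O[?F](\<lambda>_. 1)" if "k < r" "m < r" for k m
    unfolding H_def[abs_def]
    by (rule cont_snd, rule continuous_on_subset[OF smooth_fun_continuous[OF V fibre_metric_smooth[OF Fr that]]]) auto
  define Q where "Q j l z = cramer_inverse (gram_matrix A g c (chart_inv c (snd z))) $ j $ l" for j l and z :: "real \<times> (real^'n)"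
  have Q: "Q j l \<in> O[?F](\<lambda>_. 1)" for j l
    unfolding Q_def[abs_def]
    by (rule cont_snd, rule continuous_on_subset[OF continuous_on_inverse_gram[OF c(1)]]) auto
  define S where "S z = (\<Sum>j\<in>UNIV. \<Sum>l\<in>UNIV. Q j l z * (\<Sum>k<r. \<Sum>m<r. b j k z * b l m z * H k m z))" for z
  have S: "S \<in> O[?F](\<lambda>z. (fst z)\<^sup>2)"
  proof -
    have "(\<lambda>z. Q j l z * (\<Sum>k<r. \<Sum>m<r. b j k z * b l m z * H k m z)) \<in> O[?F](\<lambda>z. 1 * (fst z * fst z * 1))" for j l
      by (intro landau_o.big.mult Q big_sum_in_bigo b_bigo H) auto
    then show ?thesis
      unfolding S_def[abs_def] by (intro big_sum_in_bigo) (simp add: power2_eq_square)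
  qed
  define u where "u z = (\<Sum>k<r. \<Sum>m<r. a k z * a m z * H k m z)" for z
  have u: "u \<in> O[?F](\<lambda>_. 1)"
  proof -
    have "a k \<in> O[?F](\<lambda>_. 1)" if "k < r" for k
      by (rule continuous_on_bigo_1[OF smooth_on_continuous[OF a(1)[OF that]] Z z0])
    then have "(\<lambda>z. a k z * a m z * H k m z) \<in> O[?F](\<lambda>z. 1 * 1 * 1)" if "k < r" "m < r" for k m
      using that by (intro landau_o.big.mult H) auto
    then show ?thesis unfolding u_def[abs_def] by (intro big_sum_in_bigo) simp
  qed
  obtain CS where CS: "CS > 0" "eventually (\<lambda>z. \<bar>S z\<bar> \<le> CS * (fst z)\<^sup>2) ?F"
    using landau_o.bigE[OF S] by auto
  obtain Cu where Cu: "Cu > 0" "eventually (\<lambda>z. \<bar>u z\<bar> \<le> Cu) ?F"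
    using landau_o.bigE[OF u] by auto
  have "eventually (\<lambda>z. z \<in> ?Z) ?F" using Z z0 by (rule eventually_nhds_in_open)
  with CS(2) Cu(2) have "eventually (\<lambda>z. z \<in> ?Z \<and> \<bar>S z\<bar> \<le> CS * (fst z)\<^sup>2 \<and> \<bar>u z\<bar> \<le> Cu) ?F"
    by eventually_elim auto
  then obtain P where P: "open P" "(0, snd c x0) \<in> P"
    "\<And>z. z \<in> P \<Longrightarrow> z \<in> ?Z \<and> \<bar>S z\<bar> \<le> CS * (fst z)\<^sup>2 \<and> \<bar>u z\<bar> \<le> Cu"
    unfolding eventually_nhds by blast
  from open_prod_elim[OF P(1,2)] obtain T B where TB: "open T" "open B" "0 \<in> T" "snd c x0 \<in> B" "T \<times> B \<subseteq> P"
    by (metis mem_Sigma_iff)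
  from TB(1,3) obtain d where d: "d > 0" "ball 0 d \<subseteq> T" using open_contains_ball by blast
  define U where "U = chart_inv c ` (B \<inter> ?W)"
  have U: "open U"
    unfolding U_def by (rule open_chart_inv_image[OF c(1)]) (use TB W in auto)
  have x0U: "x0 \<in> U"
    unfolding U_def using TB c x0V by (auto simp: image_iff intro!: bexI[of _ "snd c x0"])
  \<comment> \<open>The first factor bounds the weight, the second the bracket;
    \<open>Cu * CS\<close> comes from \<open>grad_norm_sq_le\<close>.\<close>
  define C where "C = (1 + Cu) powr \<bar>p\<bar> * (CS + \<bar>q\<bar> * (Cu * CS))"
  have "\<bar>energy_density p q (\<Sigma> t) x\<bar> \<le> C * t\<^sup>2" if t: "\<bar>t\<bar> < d" and "x \<in> U" for t x
  proof -
    have x: "x \<in> fst c \<inter> V" "snd c x \<in> B"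
      using \<open>x \<in> U\<close> c by (auto simp: U_def)
    have tT: "t \<in> T" using d t by (auto simp: subset_iff)
    have z: "(t, snd c x) \<in> ?Z" "\<bar>S (t, snd c x)\<bar> \<le> CS * t\<^sup>2" "\<bar>u (t, snd c x)\<bar> \<le> Cu"
      using P(3)[of "(t, snd c x)"] TB(5) tT x(2) by auto
    have t\<epsilon>: "t \<in> {-\<epsilon><..<\<epsilon>}" using z(1) by auto
    have sec: "smooth_sec UNIV (\<Sigma> t)" by (rule variation_smooth_sec[OF var t\<epsilon>])
    have sE: "s k x \<in> E x" if "k < r" for k using frame_in_fibre[OF Fr _ that] x by auto
    have ci: "chart_inv c (snd c x) = x" using c x by auto
    have u_eq: "h x (\<Sigma> t x) (\<Sigma> t x) = u (t, snd c x)"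
      unfolding a(2)[OF t\<epsilon> x(1)] u_def H_def snd_conv ci by (rule h_sum2) (use sE in auto)
    have S_eq: "covariant_norm_sq g h N (\<Sigma> t) x = S (t, snd c x)"
    proof -
      have "covariant_norm_sq g h N (\<Sigma> t) x = (\<Sum>j\<in>UNIV. \<Sum>l\<in>UNIV. cramer_inverse (gram_matrix A g c x) $ j $ l *
          h x (N (\<Sigma> t) x (coord_vec c x j)) (N (\<Sigma> t) x (coord_vec c x l)))"
        unfolding covariant_norm_sq_onb
        using trace_onb[OF c(1) _ bilinear_h_N[OF sec, of x]] x by auto
      moreover have "h x (N (\<Sigma> t) x (coord_vec c x j)) (N (\<Sigma> t) x (coord_vec c x l)) =
          (\<Sum>k<r. \<Sum>m<r. b j k (t, snd c x) * b l m (t, snd c x) * h x (s k x) (s m x))" for j l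
        unfolding b(2)[OF t\<epsilon> x(1)] by (rule h_sum2) (use sE in auto)
      ultimately show ?thesis by (simp add: S_def Q_def H_def ci)
    qed
    have u0: "0 \<le> u (t, snd c x)" unfolding u_eq[symmetric] by (rule h_nonneg[OF smooth_secD[OF sec UNIV_I]])
    have S0: "0 \<le> covariant_norm_sq g h N (\<Sigma> t) x" by (rule covariant_norm_sq_nonneg[OF sec])
    have G: "grad_norm_sq (\<Sigma> t) x \<le> Cu * (CS * t\<^sup>2)"
      using grad_norm_sq_le[OF sec, of x] mult_mono[of "u (t, snd c x)" Cu "S (t, snd c x)" "CS * t\<^sup>2"] z u0 S0 Cu(1)
      unfolding u_eq S_eq by auto
    have G': "\<bar>covariant_norm_sq g h N (\<Sigma> t) x + q * grad_norm_sq (\<Sigma> t) x\<bar> \<le> (CS + \<bar>q\<bar> * (Cu * CS)) * t\<^sup>2"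
    proof -
      have "\<bar>covariant_norm_sq g h N (\<Sigma> t) x + q * grad_norm_sq (\<Sigma> t) x\<bar> \<le> S (t, snd c x) + \<bar>q\<bar> * grad_norm_sq (\<Sigma> t) x"
        using S0 grad_norm_sq_nonneg[of "\<Sigma> t" x] unfolding S_eq by (intro abs_triangle_ineq[THEN order_trans]) (auto simp: abs_mult)
      also have "\<dots> \<le> CS * t\<^sup>2 + \<bar>q\<bar> * (Cu * (CS * t\<^sup>2))"
        by (rule add_mono) (use z G in \<open>auto intro: mult_left_mono\<close>)
      finally show ?thesis by (simp add: algebra_simps)
    qed
    \<comment> \<open>The sign of \<open>p\<close> is arbitrary; since the base is at least 1,
      enlarging the exponent from \<open>-p\<close> to \<open>\<bar>p\<bar>\<close> treats both
      cases.\<close>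
    have pw: "\<bar>1 / (1 + u (t, snd c x)) powr p\<bar> \<le> (1 + Cu) powr \<bar>p\<bar>"
    proof -
      have "1 / (1 + u (t, snd c x)) powr p = (1 + u (t, snd c x)) powr (-p)"
        by (simp add: powr_minus_divide)
      also have "\<dots> \<le> (1 + u (t, snd c x)) powr \<bar>p\<bar>"
        by (rule powr_mono) (use u0 in auto)
      also have "\<dots> \<le> (1 + Cu) powr \<bar>p\<bar>"
        by (rule powr_mono2) (use u0 z in auto)
      finally show ?thesis by simp
    qed
    show ?thesis
      unfolding energy_density_def u_eq abs_mult C_def
      using mult_mono[OF pw G'] by (simp add: mult.assoc)
  qed
  with U x0U d(1) show ?thesis by blast
qed

lemma parallel_variation_energy_density:
  assumes comp: "compact (UNIV :: 'm set)" and \<sigma>: "smooth_sec UNIV \<sigma>" and par: "parallel N \<sigma>"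
    and var: "smooth_variation A E r Fr \<sigma> \<epsilon> \<Sigma>"
  shows "\<exists>C d. d > 0 \<and> (\<forall>t x. \<bar>t\<bar> < d \<longrightarrow> \<bar>energy_density p q (\<Sigma> t) x\<bar> \<le> C * t\<^sup>2)"
proof -
  define R where "R x0 U C d \<longleftrightarrow> open U \<and> x0 \<in> U \<and> d > 0 \<and>
      (\<forall>t x. \<bar>t\<bar> < d \<longrightarrow> x \<in> U \<longrightarrow> \<bar>energy_density p q (\<Sigma> t) x\<bar> \<le> C * t\<^sup>2)" for x0 U and C d :: real
  have "\<exists>U C d. R x0 U C d" for x0
    unfolding R_def by (rule parallel_variation_energy_density_local[OF \<sigma> par var])
  then obtain U C d where "\<And>x0. R x0 (U x0) (C x0) (d x0)" by metis
  then have U: "\<And>x0. open (U x0)" "\<And>x0. x0 \<in> U x0" "\<And>x0. d x0 > 0"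
    and bound: "\<And>x0 t x. \<bar>t\<bar> < d x0 \<Longrightarrow> x \<in> U x0 \<Longrightarrow> \<bar>energy_density p q (\<Sigma> t) x\<bar> \<le> C x0 * t\<^sup>2"
    unfolding R_def by auto
  obtain X where X: "finite X" "UNIV \<subseteq> (\<Union>x\<in>X. U x)"
    by (rule compactE_image[OF comp, of UNIV U]) (use U(1,2) in auto)
  then have "X \<noteq> {}" by auto
  \<comment> \<open>The sum of the local constants serves as a common upper bound; absolute values
    make each summand nonnegative.\<close>
  have "\<bar>energy_density p q (\<Sigma> t) x\<bar> \<le> (\<Sum>x0\<in>X. \<bar>C x0\<bar>) * t\<^sup>2" if "\<bar>t\<bar> < Min (d ` X)" for t x
  proof -
    obtain x0 where x0: "x0 \<in> X" "x \<in> U x0" using X(2) by auto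
    have "Min (d ` X) \<le> d x0" by (rule Min_le) (use X(1) x0(1) in auto)
    then have "\<bar>t\<bar> < d x0" using that by linarith
    then have "\<bar>energy_density p q (\<Sigma> t) x\<bar> \<le> C x0 * t\<^sup>2"
      using x0(2) by (rule bound)
    also have "\<dots> \<le> (\<Sum>x0\<in>X. \<bar>C x0\<bar>) * t\<^sup>2"
      using member_le_sum[OF x0(1), of "\<lambda>x. \<bar>C x\<bar>"] X(1) by (intro mult_right_mono) auto
    finally show ?thesis .
  qed
  moreover have "Min (d ` X) > 0" using X(1) \<open>X \<noteq> {}\<close> U(3) by auto
  ultimately show ?thesis by blast
qed

lemma parallel_imp_harmonic:
  assumes comp: "compact (UNIV :: 'm set)" and \<sigma>: "smooth_sec UNIV \<sigma>" and par: "parallel N \<sigma>"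
  shows "harmonic_section A g E r Fr h N p q \<sigma>"
  unfolding harmonic_section_def
proof (intro conjI allI impI \<sigma>)
  fix \<epsilon> \<Sigma> assume var: "smooth_variation A E r Fr \<sigma> \<epsilon> \<Sigma>"
  let ?M = "riemannian_measure A g"
  interpret finite_measure ?M by (rule finite_riemannian_measure[OF comp])
  obtain C d where d: "d > 0" "\<And>t x. \<bar>t\<bar> < d \<Longrightarrow> \<bar>energy_density p q (\<Sigma> t) x\<bar> \<le> C * t\<^sup>2"
    using parallel_variation_energy_density[OF assms var] by blast
  define K where "K = 1/2 * \<bar>C * measure ?M UNIV\<bar>"
  have \<epsilon>: "\<epsilon> > 0" using var by (simp add: smooth_variation_def)
  have bound: "\<bar>vertical_energy A g h N p q (\<Sigma> t)\<bar> \<le> K * t\<^sup>2" if t: "\<bar>t\<bar> < min d \<epsilon>" for t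
  proof -
    let ?e = "energy_density p q (\<Sigma> t)"
    have "\<bar>LINT x|?M. ?e x\<bar> \<le> C * t\<^sup>2 * measure ?M UNIV"
    \<comment> \<open>A non-integrable density has integral 0 by convention and satisfies the bound
      too, so continuity of the density along a general variation need not be established.\<close>
    proof (cases "integrable ?M ?e")
      case True
      have "\<bar>LINT x|?M. ?e x\<bar> \<le> (LINT x|?M. \<bar>?e x\<bar>)" by (rule integral_abs_bound)
      also have "\<dots> \<le> (LINT x|?M. C * t\<^sup>2)"
        by (rule integral_mono) (use True d(2) t in auto)
      finally show ?thesis by (simp add: ac_simps)
    next
      case False
      \<comment> \<open>Any point serves here: the bound on the density itself shows that its
        right-hand side is nonnegative.\<close>
      have "0 \<le> C * t\<^sup>2" using d(2)[of t undefined] t by linarith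
      with False show ?thesis by (simp add: not_integrable_integral_eq)
    qed
    also have "\<dots> \<le> \<bar>C * measure ?M UNIV\<bar> * t\<^sup>2"
      using mult_right_mono[OF abs_ge_self[of "C * measure ?M UNIV"], of "t\<^sup>2"]
      by (simp add: mult.assoc mult.commute[of "t\<^sup>2"])
    finally have "\<bar>LINT x|?M. ?e x\<bar> \<le> \<bar>C * measure ?M UNIV\<bar> * t\<^sup>2" .
    moreover have "t \<in> {-\<epsilon><..<\<epsilon>}" using t by auto
    ultimately show ?thesis
      using vertical_energy_density[OF variation_smooth_sec[OF var], of t p q]
      by (simp add: K_def abs_mult)
  qed
  \<comment> \<open>At t = 0 the quadratic bound forces zero energy, so the difference quotient is
    the energy divided by \<open>t\<close>.\<close>
  have E0: "vertical_energy A g h N p q (\<Sigma> 0) = 0" using bound[of 0] d(1) \<epsilon> by simp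
  have "((\<lambda>t. vertical_energy A g h N p q (\<Sigma> t) / t) \<longlongrightarrow> 0) (at 0)"
  proof (rule Lim_null_comparison)
    show "((\<lambda>t. K * \<bar>t\<bar>) \<longlongrightarrow> 0) (at 0)"
      by (auto intro!: tendsto_eq_intros)
    have "eventually (\<lambda>t. \<bar>t\<bar> < min d \<epsilon>) (at (0::real))"
      using d(1) \<epsilon> unfolding eventually_at by (intro exI[of _ "min d \<epsilon>"]) (auto simp: dist_real_def)
    then show "\<forall>\<^sub>F t in at 0. norm (vertical_energy A g h N p q (\<Sigma> t) / t) \<le> K * \<bar>t\<bar>"
    proof eventually_elim
      case (elim t)
      show ?case
      proof (cases "t = 0")
        case False
        have "\<bar>vertical_energy A g h N p q (\<Sigma> t)\<bar> / \<bar>t\<bar> \<le> K * t\<^sup>2 / \<bar>t\<bar>"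
          using bound[OF elim] by (intro divide_right_mono) auto
        also have "\<dots> = K * \<bar>t\<bar>" using False by (simp add: power2_eq_square abs_if)
        finally show ?thesis by simp
      qed simp
    qed
  qed
  then show "((\<lambda>t. vertical_energy A g h N p q (\<Sigma> t)) has_real_derivative 0) (at 0)"
    by (simp add: DERIV_def E0)
qed

end

section \<open>The first variation along scalings\<close>

text \<open>Dominated convergence for difference quotients. The dominating constant is a bound of
  \<open>\<phi>'\<close> on the compact product \<open>{-1..1} \<times> UNIV\<close>, transferred to
  the quotients by the mean value theorem.\<close>

lemma Leibniz_rule_compact:
  fixes \<phi> \<phi>' :: "real \<Rightarrow> 'a::topological_space \<Rightarrow> real"
  assumes "finite_measure M" and M: "sets M = sets borel" and comp: "compact (UNIV :: 'a set)"
    and der: "\<And>t x. \<bar>t\<bar> \<le> 1 \<Longrightarrow> ((\<lambda>t. \<phi> t x) has_real_derivative \<phi>' t x) (at t)"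
    and cont: "\<And>t. continuous_on UNIV (\<phi> t)"
    and cont': "continuous_on ({-1..1} \<times> UNIV) (\<lambda>(t, x). \<phi>' t x)"
  shows "((\<lambda>t. LINT x|M. \<phi> t x) has_real_derivative (LINT x|M. \<phi>' 0 x)) (at 0)"
proof -
  interpret finite_measure M by fact
  have meas [measurable]: "f \<in> borel_measurable M" if "continuous_on UNIV f" for f :: "'a \<Rightarrow> real"
    using borel_measurable_continuous_onI[OF that] M by (simp cong: measurable_cong_sets)
  have int: "integrable M f" if f: "continuous_on UNIV f" for f :: "'a \<Rightarrow> real"
  proof -
    obtain B where "\<And>x. \<bar>f x\<bar> \<le> B"
      using compact_imp_bounded[OF compact_continuous_image[OF f comp]] by (auto simp: bounded_iff)
    with meas[OF f] show ?thesis by (intro integrable_const_bound[of _ B]) auto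
  qed
  have cont0: "continuous_on UNIV (\<phi>' 0)"
  proof -
    have "continuous_on UNIV (\<lambda>x. (\<lambda>(t, x). \<phi>' t x) (0, x))"
      by (rule continuous_on_compose2[OF cont']) (auto intro!: continuous_intros)
    then show ?thesis by simp
  qed
  have "compact ((\<lambda>(t, x). \<phi>' t x) ` ({-1..1} \<times> UNIV))"
    by (rule compact_continuous_image[OF cont' compact_Times[OF compact_Icc comp]])
  from compact_imp_bounded[OF this]
  obtain B where B': "\<forall>y\<in>(\<lambda>(t, x). \<phi>' t x) ` ({-1..1} \<times> UNIV). norm y \<le> B"
    unfolding bounded_iff by blast
  have B: "\<bar>\<phi>' t x\<bar> \<le> B" if "\<bar>t\<bar> \<le> 1" for t x
  proof -
    have "\<phi>' t x \<in> (\<lambda>(t, x). \<phi>' t x) ` ({-1..1} \<times> UNIV)"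
      using that by (intro image_eqI[of _ _ "(t, x)"]) auto
    with B' show ?thesis by force
  qed
  have quot: "\<bar>(\<phi> t x - \<phi> 0 x) / t\<bar> \<le> B" if "\<bar>t\<bar> \<le> 1" "t \<noteq> 0" for t x
  proof -
    have "norm (\<phi> t x - \<phi> 0 x) \<le> B * norm (t - 0)"
    proof (rule field_differentiable_bound[of "{-1..1}" "\<lambda>t. \<phi> t x" "\<lambda>t. \<phi>' t x"])
      fix s :: real assume "s \<in> {-1..1}"
      then have "\<bar>s\<bar> \<le> 1" by auto
      from der[OF this] B[OF this]
      show "((\<lambda>t. \<phi> t x) has_real_derivative \<phi>' s x) (at s within {-1..1})" "norm (\<phi>' s x) \<le> B"
        by (auto intro: has_field_derivative_at_within)
    qed (use that in auto)
    then show ?thesis using that by (simp add: divide_le_eq)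
  qed
  have "((\<lambda>t. ((LINT x|M. \<phi> t x) - (LINT x|M. \<phi> 0 x)) / t) \<longlongrightarrow> (LINT x|M. \<phi>' 0 x)) (at 0)"
    unfolding tendsto_at_iff_sequentially comp_def
  proof (intro allI impI)
    fix X :: "nat \<Rightarrow> real" assume X: "\<forall>i. X i \<in> UNIV - {0}" "X \<longlonglongrightarrow> 0"
    have "eventually (\<lambda>i. \<bar>X i\<bar> < 1) sequentially"
      using tendstoD[OF X(2), of 1] by (simp add: dist_real_def)
    \<comment> \<open>The quotients are bounded for \<open>\<bar>t\<bar> \<le> 1\<close> only;
      dropping the first \<open>n\<close> terms puts the whole sequence into that range.\<close>
    then obtain n where n: "\<And>i. \<bar>X (i + n)\<bar> \<le> 1"
      unfolding eventually_sequentially by (metis le_add2 less_imp_le)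
    let ?Y = "\<lambda>i. X (i + n)"
    have Y: "?Y \<longlonglongrightarrow> 0" "\<And>i. ?Y i \<noteq> 0" using X by (auto intro: LIMSEQ_ignore_initial_segment)
    have "(\<lambda>i. LINT x|M. (\<phi> (?Y i) x - \<phi> 0 x) / ?Y i) \<longlonglongrightarrow> (LINT x|M. \<phi>' 0 x)"
    proof (rule integral_dominated_convergence[where w = "\<lambda>_. B"])
      show "AE x in M. (\<lambda>i. (\<phi> (?Y i) x - \<phi> 0 x) / ?Y i) \<longlonglongrightarrow> \<phi>' 0 x"
      proof (rule AE_I2)
        fix x
        have "((\<lambda>t. (\<phi> t x - \<phi> 0 x) / t) \<longlongrightarrow> \<phi>' 0 x) (at 0)"
          using der[of 0 x] by (simp add: DERIV_def)
        then show "(\<lambda>i. (\<phi> (?Y i) x - \<phi> 0 x) / ?Y i) \<longlonglongrightarrow> \<phi>' 0 x"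
          using Y unfolding tendsto_at_iff_sequentially comp_def by auto
      qed
    next
      fix i show "AE x in M. norm ((\<phi> (?Y i) x - \<phi> 0 x) / ?Y i) \<le> B"
        using quot[OF n Y(2)] by auto
    next
      fix i show "(\<lambda>x. (\<phi> (?Y i) x - \<phi> 0 x) / ?Y i) \<in> borel_measurable M"
        by (intro borel_measurable_divide borel_measurable_diff meas cont borel_measurable_const)
    qed (auto intro: meas cont0)
    moreover have "(LINT x|M. (\<phi> t x - \<phi> 0 x) / t) = ((LINT x|M. \<phi> t x) - (LINT x|M. \<phi> 0 x)) / t" for t
      using Bochner_Integration.integral_diff[OF int[OF cont, of t] int[OF cont, of 0]] by simp
    ultimately have "(\<lambda>i. ((LINT x|M. \<phi> (?Y i) x) - (LINT x|M. \<phi> 0 x)) / ?Y i) \<longlonglongrightarrow> (LINT x|M. \<phi>' 0 x)"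
      by (simp only:)
    then show "(\<lambda>i. ((LINT x|M. \<phi> (X i) x) - (LINT x|M. \<phi> 0 x)) / X i) \<longlonglongrightarrow> (LINT x|M. \<phi>' 0 x)"
      by (rule LIMSEQ_offset[where k = n])
  qed
  then show ?thesis by (simp add: DERIV_def)
qed

text \<open>\<open>density_poly\<close> is the factor \<open>|\<nabla>\<sigma>\<^sub>t|\<^sup>2 + q|\<nabla>F\<^sub>t|\<^sup>2\<close> for \<open>\<sigma>\<^sub>t = (1 + t f) \<sigma>\<close>, \<open>f = exp (c |\<sigma>|\<^sup>2)\<close>,
  in terms of \<open>u = |\<sigma>|\<^sup>2\<close>, \<open>S = |\<nabla>\<sigma>|\<^sup>2\<close> and \<open>D = |\<nabla>F|\<^sup>2\<close>; here \<open>k = 2 c f\<close> is the derivative of \<open>f\<close>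
  with respect to \<open>F\<close>.\<close>

definition density_poly :: "real \<Rightarrow> real \<Rightarrow> real \<Rightarrow> real \<Rightarrow> real \<Rightarrow> real \<Rightarrow> real \<Rightarrow> real" where
  "density_poly q f k u S D t = (1 + t * f)\<^sup>2 * S + (2 * (1 + t * f) * t * k + t\<^sup>2 * k\<^sup>2 * u) * D +
     q * ((1 + t * f)\<^sup>2 * (1 + t * f + t * k * u)\<^sup>2 * D)"

definition density_poly' :: "real \<Rightarrow> real \<Rightarrow> real \<Rightarrow> real \<Rightarrow> real \<Rightarrow> real \<Rightarrow> real \<Rightarrow> real" where
  "density_poly' q f k u S D t = 2 * (1 + t * f) * f * S + (2 * f * t * k + 2 * (1 + t * f) * k + 2 * t * k\<^sup>2 * u) * D +
     q * ((2 * (1 + t * f) * f * (1 + t * f + t * k * u)\<^sup>2 + (1 + t * f)\<^sup>2 * (2 * (1 + t * f + t * k * u) * (f + k * u))) * D)"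

lemma density_poly_has_derivative:
  "(density_poly q f k u S D has_real_derivative density_poly' q f k u S D t) (at t)"
  unfolding density_poly_def[abs_def] density_poly'_def
  by (auto intro!: derivative_eq_intros simp: power2_eq_square algebra_simps)

definition scaled_density :: "real \<Rightarrow> real \<Rightarrow> real \<Rightarrow> real \<Rightarrow> real \<Rightarrow> real \<Rightarrow> real \<Rightarrow> real \<Rightarrow> real" where
  "scaled_density p q f k u S D t = (1 + (1 + t * f)\<^sup>2 * u) powr (-p) * density_poly q f k u S D t"

definition scaled_density' :: "real \<Rightarrow> real \<Rightarrow> real \<Rightarrow> real \<Rightarrow> real \<Rightarrow> real \<Rightarrow> real \<Rightarrow> real \<Rightarrow> real" where
  "scaled_density' p q f k u S D t =
     -p * (1 + (1 + t * f)\<^sup>2 * u) powr (-p - 1) * (2 * (1 + t * f) * f * u) * density_poly q f k u S D t +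
     (1 + (1 + t * f)\<^sup>2 * u) powr (-p) * density_poly' q f k u S D t"

lemma scaled_density_has_derivative:
  assumes "u \<ge> 0"
  shows "(scaled_density p q f k u S D has_real_derivative scaled_density' p q f k u S D t) (at t)"
proof -
  have pos: "1 + (1 + t * f)\<^sup>2 * u > 0" using assms by (simp add: add_pos_nonneg)
  have "((\<lambda>t. 1 + (1 + t * f)\<^sup>2 * u) has_real_derivative 2 * (1 + t * f) * f * u) (at t)"
    by (auto intro!: derivative_eq_intros)
  then have "((\<lambda>t. (1 + (1 + t * f)\<^sup>2 * u) powr (-p)) has_real_derivative
      -p * (1 + (1 + t * f)\<^sup>2 * u) powr (-p - 1) * (2 * (1 + t * f) * f * u)) (at t)"
    by (rule DERIV_chain2[where f = "\<lambda>z. z powr (-p)" and g = "\<lambda>t. 1 + (1 + t * f)\<^sup>2 * u" and x = t, OF has_real_derivative_powr[OF pos]])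
  from DERIV_mult[OF this density_poly_has_derivative]
  show ?thesis
    unfolding scaled_density_def[abs_def] scaled_density'_def by (simp add: algebra_simps)
qed

text \<open>Pulling out \<open>(1 + u) powr (-p - 1)\<close> turns the weight into a factor
  \<open>1 + u\<close>, while, up to the common \<open>2 * f\<close>, its derivative contributes
  \<open>- p * u * (S + q * D)\<close>. Thus \<open>1 - p\<close> arises from
  \<open>(1 + u) - p * u\<close> and \<open>2 - p\<close> from \<open>2 * (1 + u) - p * u\<close>;
  the term with \<open>c\<close> comes from the derivative of \<open>f\<close>.\<close>

lemma scaled_density'_0:
  assumes "u \<ge> 0"
  shows "scaled_density' p q f (2 * c * f) u S D 0 = 2 * f * (1 + u) powr (-p - 1) *
     ((1 + (1 - p) * u) * S + (2 * c * (1 + u) * (1 + q * u) + q * (2 + (2 - p) * u)) * D)"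
proof -
  have "(1 + u) powr (-p) = (1 + u) * (1 + u) powr (-p - 1)"
    using powr_mult_base[of "1 + u" "-p - 1"] assms by simp
  then show ?thesis
    by (simp add: scaled_density'_def density_poly_def density_poly'_def algebra_simps power2_eq_square)
qed

text \<open>This fixes the exponent \<open>c = \<bar>q\<bar> * (2 + \<bar>2 - p\<bar>)\<close> of
  the multiplier: the possibly negative term is at most \<open>c * (1 + u)\<close> in absolute
  value, and \<open>1 + q * u \<ge> 1/2\<close> makes the other term at least that large.\<close>

lemma bracket_nonneg:
  fixes u q p :: real
  assumes "u \<ge> 0" "1 + q * u \<ge> 1/2"
  shows "2 * (\<bar>q\<bar> * (2 + \<bar>2 - p\<bar>)) * (1 + u) * (1 + q * u) + q * (2 + (2 - p) * u) \<ge> 0"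
proof -
  have "- (q * (2 + (2 - p) * u)) \<le> \<bar>q\<bar> * \<bar>2 + (2 - p) * u\<bar>"
    by (metis abs_ge_minus_self abs_mult)
  also have "\<bar>2 + (2 - p) * u\<bar> \<le> 2 + \<bar>2 - p\<bar> * u"
    using assms(1) abs_triangle_ineq[of 2 "(2 - p) * u"] by (simp add: abs_mult)
  also have "2 + \<bar>2 - p\<bar> * u \<le> (2 + \<bar>2 - p\<bar>) * (1 + u)"
    using assms(1) by (simp add: algebra_simps)
  finally have "- (q * (2 + (2 - p) * u)) \<le> \<bar>q\<bar> * ((2 + \<bar>2 - p\<bar>) * (1 + u))"
    by (simp add: mult_left_mono)
  also have "\<dots> = 2 * (\<bar>q\<bar> * (2 + \<bar>2 - p\<bar>)) * (1 + u) * (1/2)" by simp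
  also have "\<dots> \<le> 2 * (\<bar>q\<bar> * (2 + \<bar>2 - p\<bar>)) * (1 + u) * (1 + q * u)"
    using assms by (intro mult_left_mono) auto
  finally show ?thesis by simp
qed

context riemannian_vector_bundle
begin

section \<open>Scalings of a harmonic section and the passage to parallelism\<close>

lemma scaling_variation:
  assumes \<sigma>: "smooth_sec UNIV \<sigma>" and f: "smooth_fun A UNIV f"
  shows "smooth_variation A E r Fr \<sigma> 1 (\<lambda>t x. (1 + t * f x) *\<^sub>R \<sigma> x)"
  unfolding smooth_variation_def
proof (intro conjI ballI allI)
  fix t x show "(1 + t * f x) *\<^sub>R \<sigma> x \<in> E x"
    by (rule subspace_scale[OF fibre_subspace smooth_secD[OF \<sigma> UNIV_I]])
next
  fix c Vs assume c: "c \<in> A" and Fr': "Vs \<in> Fr"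
  obtain V s where Vs: "Vs = (V, s)" by (cases Vs)
  have Fr: "(V, s) \<in> Fr" using Fr' Vs by simp
  let ?W = "snd c ` (fst c \<inter> V)" let ?Z = "{-1<..<1::real} \<times> ?W"
  have W: "open ?W" by (rule chart_open_image[OF c frame_open[OF Fr]])
  have Z: "open ?Z" using W by (intro open_Times) auto
  from smooth_sec_coeffs[OF \<sigma> Fr] obtain a where
    "\<forall>i<r. smooth_fun A (UNIV \<inter> V) (a i)" "\<forall>x\<in>UNIV \<inter> V. \<sigma> x = (\<Sum>i<r. a i x *\<^sub>R s i x)" by blast
  note a = this[rule_format]
  let ?a = "\<lambda>i z. (1 + fst z * f (chart_inv c (snd z))) * a i (chart_inv c (snd z))"
  have "smooth_on ?Z (?a i)" if "i < r" for i
  proof -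
    have "smooth_on ?W (\<lambda>y. a i (chart_inv c y))"
      using smooth_funD[OF a(1)[OF that] c] by simp
    moreover have "smooth_on ?W (\<lambda>y. f (chart_inv c y))"
      using smooth_funD[OF smooth_fun_subset[OF f subset_UNIV] c] .
    ultimately show ?thesis
      by (intro smooth_on_mult smooth_on_add smooth_on_const smooth_on_fst smooth_on_compose_snd Z W) auto
  qed
  moreover have "(1 + t * f x) *\<^sub>R \<sigma> x = (\<Sum>i<r. ?a i (t, snd c x) *\<^sub>R s i x)" if "x \<in> fst c \<inter> V" for t x
    using that a(2)[of x] c by (simp add: scaleR_sum_right)
  ultimately show "case Vs of (V, s) \<Rightarrow> \<exists>a. (\<forall>i<r. smooth_on ({-1<..<1} \<times> snd c ` (fst c \<inter> V)) (a i)) \<and>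
      (\<forall>t\<in>{-1<..<1}. \<forall>x\<in>fst c \<inter> V. (1 + t * f x) *\<^sub>R \<sigma> x = (\<Sum>i<r. a i (t, snd c x) *\<^sub>R s i x))"
    unfolding Vs prod.case by (intro exI[of _ ?a]) blast
qed auto

text \<open>Since \<open>f\<close> is a function of \<open>u\<close>, its differential is
  \<open>2 * c * f x * w v\<close> with \<open>w v = h x (N \<sigma> x v) (\<sigma> x)\<close>, and
  the Leibniz rule writes the derivative of the scaled section as a combination of
  \<open>\<sigma> x\<close> and \<open>N \<sigma> x v\<close>. Their inner products are
  \<open>u x\<close>, \<open>w v\<close> and the summands of |\<nabla>\<sigma>|^2, so the density
  closes up after summation over the basis.\<close>

lemma scaled_energy_density:
  fixes \<sigma> c
  assumes \<sigma>: "smooth_sec UNIV \<sigma>"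
  defines "u \<equiv> \<lambda>x. h x (\<sigma> x) (\<sigma> x)"
  defines "f \<equiv> \<lambda>x. exp (c * u x)"
  shows "smooth_fun A UNIV f" "smooth_sec UNIV (\<lambda>x. (1 + t * f x) *\<^sub>R \<sigma> x)"
    "energy_density p q (\<lambda>x. (1 + t * f x) *\<^sub>R \<sigma> x) x =
       scaled_density p q (f x) (2 * c * f x) (u x) (covariant_norm_sq g h N \<sigma> x) (grad_norm_sq \<sigma> x) t"
proof -
  have u: "smooth_fun A UNIV u" unfolding u_def by (rule smooth_fun_h[OF open_UNIV \<sigma> \<sigma>])
  have cu: "smooth_fun A UNIV (\<lambda>x. c * u x)" by (rule smooth_fun_mult[OF open_UNIV smooth_fun_const u])
  show f: "smooth_fun A UNIV f" unfolding f_def by (rule smooth_fun_exp[OF open_UNIV cu])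
  have tf: "smooth_fun A UNIV (\<lambda>x. 1 + t * f x)" for t
    by (rule smooth_fun_add[OF open_UNIV smooth_fun_const smooth_fun_mult[OF open_UNIV smooth_fun_const f]])
  let ?\<sigma> = "\<lambda>t x. (1 + t * f x) *\<^sub>R \<sigma> x"
  show sec: "smooth_sec UNIV (?\<sigma> t)" by (rule smooth_sec_scale[OF open_UNIV tf \<sigma>])
  have \<sigma>E: "\<sigma> x \<in> E x" by (rule smooth_secD[OF \<sigma> UNIV_I])
  have NE: "N \<sigma> x v \<in> E x" for v by (rule N_in_fibre[OF open_UNIV \<sigma> UNIV_I])
  define a where "a = 1 + t * f x"
  define k where "k = 2 * c * f x"
  define w where "w v = h x (N \<sigma> x v) (\<sigma> x)" for v
  have "differential A (\<lambda>x. c * u x) x v = 2 * c * w v" for v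
    using differential_affine[OF open_UNIV UNIV_I u, of 0 c x v] differential_norm_sq[OF open_UNIV \<sigma> UNIV_I, of x v]
    by (simp add: u_def w_def)
  then have "differential A f x v = k * w v" for v
    using differential_exp[OF open_UNIV UNIV_I cu, of x v] by (simp add: f_def k_def)
  then have "differential A (\<lambda>x. 1 + t * f x) x v = t * (k * w v)" for v
    using differential_affine[OF open_UNIV UNIV_I f, of 1 t x v] by simp
  then have Nt: "N (?\<sigma> t) x v = (t * k * w v) *\<^sub>R \<sigma> x + a *\<^sub>R N \<sigma> x v" for v
    using connection_Leibniz[OF open_UNIV tf \<sigma> UNIV_I, of t x v] by (simp add: a_def)
  have E1: "b *\<^sub>R \<sigma> x \<in> E x" "b *\<^sub>R N \<sigma> x v \<in> E x" for b v
    using subspace_scale[OF fibre_subspace] \<sigma>E NE by blast+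
  then have E2: "b *\<^sub>R \<sigma> x + b' *\<^sub>R N \<sigma> x v \<in> E x" for b b' v
    by (intro subspace_add[OF fibre_subspace]) auto
  note hs = h_add h_add_right h_scale h_scale_right E1 E2 \<sigma>E NE
  have sw: "h x (\<sigma> x) (N \<sigma> x v) = w v" for v unfolding w_def by (rule h_sym[OF \<sigma>E NE])
  have ux: "h x (\<sigma> x) (\<sigma> x) = u x" by (simp add: u_def)
  have u': "h x (?\<sigma> t x) (?\<sigma> t x) = a\<^sup>2 * u x"
    by (simp add: hs a_def[symmetric] ux power2_eq_square)
  have NN: "h x (N (?\<sigma> t) x v) (N (?\<sigma> t) x v) =
      a\<^sup>2 * h x (N \<sigma> x v) (N \<sigma> x v) + (2 * a * t * k + t\<^sup>2 * k\<^sup>2 * u x) * (w v)\<^sup>2" for v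
    unfolding Nt by (simp only: hs sw w_def[symmetric] ux) (simp add: power2_eq_square algebra_simps)
  have NS: "h x (N (?\<sigma> t) x v) (?\<sigma> t x) = a * (a + t * k * u x) * w v" for v
    unfolding Nt a_def[symmetric] by (simp only: hs sw w_def[symmetric] ux) (simp add: power2_eq_square algebra_simps)
  have S: "covariant_norm_sq g h N (?\<sigma> t) x = a\<^sup>2 * covariant_norm_sq g h N \<sigma> x + (2 * a * t * k + t\<^sup>2 * k\<^sup>2 * u x) * grad_norm_sq \<sigma> x"
    unfolding covariant_norm_sq_onb grad_norm_sq_def NN w_def[symmetric] sum_distrib_left sum.distrib ..
  have D: "grad_norm_sq (?\<sigma> t) x = a\<^sup>2 * (a + t * k * u x)\<^sup>2 * grad_norm_sq \<sigma> x"
    unfolding grad_norm_sq_def NS w_def[symmetric] sum_distrib_left by (simp add: power_mult_distrib)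
  show "energy_density p q (?\<sigma> t) x =
       scaled_density p q (f x) (2 * c * f x) (u x) (covariant_norm_sq g h N \<sigma> x) (grad_norm_sq \<sigma> x) t"
    unfolding energy_density_def u' S D
    unfolding scaled_density_def density_poly_def a_def[symmetric] k_def[symmetric]
    by (simp add: powr_minus_divide mult.assoc)
qed

text \<open>The set where \<open>f\<close> does not vanish is open and null, while a nonempty open
  set has positive Riemannian measure.\<close>

lemma nonneg_integral_eq_0:
  fixes f :: "'m \<Rightarrow> real"
  assumes comp: "compact (UNIV :: 'm set)" and cont: "continuous_on UNIV f" and nonneg: "\<And>x. f x \<ge> 0"
    and int: "(LINT x|riemannian_measure A g. f x) = 0"
  shows "f x = 0"
proof (rule ccontr)
  assume "f x \<noteq> 0"
  let ?M = "riemannian_measure A g"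
  interpret finite_measure ?M by (rule finite_riemannian_measure[OF comp])
  have meas: "f \<in> borel_measurable ?M"
    using borel_measurable_continuous_onI[OF cont] by (simp cong: measurable_cong_sets)
  obtain B where "\<And>x. \<bar>f x\<bar> \<le> B"
    using compact_imp_bounded[OF compact_continuous_image[OF cont comp]] by (auto simp: bounded_iff)
  then have "integrable ?M f" using meas by (intro integrable_const_bound[of _ B]) auto
  then have "AE x in ?M. f x = 0"
    using integral_nonneg_eq_0_iff_AE[of ?M f] nonneg int by simp
  let ?U = "{x. f x \<noteq> 0}"
  have "?U = f -` (- {0})" by auto
  then have U: "open ?U" using open_vimage[OF open_Compl[OF closed_singleton[of 0]] cont] by simp
  then have "?U \<in> null_sets ?M"
    using \<open>AE x in ?M. f x = 0\<close> by (subst AE_iff_null_sets) auto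
  then show False using riemannian_measure_pos[OF U] \<open>f x \<noteq> 0\<close> by (auto simp: null_sets_def)
qed

lemma harmonic_weight_covariant_norm_sq:
  assumes comp: "compact (UNIV :: 'm set)" and harm: "harmonic_section A g E r Fr h N p q \<sigma>"
    and k: "\<And>x. 1 + (1 - p) * h x (\<sigma> x) (\<sigma> x) \<ge> 0" and qu: "\<And>x. 1 + q * h x (\<sigma> x) (\<sigma> x) \<ge> 1/2"
  shows "(1 + (1 - p) * h x (\<sigma> x) (\<sigma> x)) * covariant_norm_sq g h N \<sigma> x = 0"
proof -
  let ?M = "riemannian_measure A g"
  interpret finite_measure ?M by (rule finite_riemannian_measure[OF comp])
  have \<sigma>: "smooth_sec UNIV \<sigma>" using harm by (simp add: harmonic_section_def)
  define c where "c = \<bar>q\<bar> * (2 + \<bar>2 - p\<bar>)"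
  define u where "u x = h x (\<sigma> x) (\<sigma> x)" for x
  define f where "f x = exp (c * u x)" for x
  define S where "S = covariant_norm_sq g h N \<sigma>"
  define D where "D = grad_norm_sq \<sigma>"
  define \<phi> where "\<phi> t x = scaled_density p q (f x) (2 * c * f x) (u x) (S x) (D x) t" for t x
  define \<phi>' where "\<phi>' t x = scaled_density' p q (f x) (2 * c * f x) (u x) (S x) (D x) t" for t x
  let ?\<sigma> = "\<lambda>t x. (1 + t * f x) *\<^sub>R \<sigma> x"
  have sd: "smooth_fun A UNIV f" "\<And>t. smooth_sec UNIV (?\<sigma> t)" "\<And>t x. energy_density p q (?\<sigma> t) x = \<phi> t x"
    using scaled_energy_density[OF \<sigma>, where c = c] unfolding \<phi>_def S_def D_def f_def u_def by auto
  have u0: "u x \<ge> 0" for x unfolding u_def by (rule h_nonneg[OF smooth_secD[OF \<sigma> UNIV_I]])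
  have u: "continuous_on UNIV u"
    unfolding u_def[abs_def] by (rule smooth_fun_continuous[OF open_UNIV smooth_fun_h[OF open_UNIV \<sigma> \<sigma>]])
  then have f: "continuous_on UNIV f" unfolding f_def[abs_def] by (intro continuous_intros)
  have S: "continuous_on UNIV S" unfolding S_def by (rule continuous_covariant_norm_sq[OF \<sigma>])
  have D: "continuous_on UNIV D" unfolding D_def by (rule continuous_grad_norm_sq[OF \<sigma>])
  \<comment> \<open>Continuity of \<open>powr\<close> in its base requires a nonzero base.\<close>
  have W: "1 + (1 + t * f x)\<^sup>2 * u x \<noteq> 0" for t x
    using u0[of x] by (smt (verit) mult_nonneg_nonneg zero_le_power2)
  have cont: "continuous_on UNIV (\<phi> t)" for t
    unfolding \<phi>_def[abs_def] scaled_density_def density_poly_def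
    by (intro continuous_intros u f S D ballI W)
  have cs: "continuous_on ({-1..1} \<times> UNIV) (\<lambda>z. F (snd z))" if "continuous_on UNIV F" for F :: "'m \<Rightarrow> real"
    by (rule continuous_on_compose2[OF that]) (auto intro: continuous_intros)
  have cont': "continuous_on ({-1..1} \<times> UNIV) (\<lambda>(t, x). \<phi>' t x)"
    unfolding \<phi>'_def scaled_density'_def density_poly_def density_poly'_def case_prod_beta
    by (intro continuous_intros cs u f S D ballI W)
  have "((\<lambda>t. LINT x|?M. \<phi> t x) has_real_derivative (LINT x|?M. \<phi>' 0 x)) (at 0)"
    by (rule Leibniz_rule_compact[OF finite_riemannian_measure[OF comp] sets_riemannian_measure comp _ cont cont'])
      (auto simp: \<phi>_def[abs_def] \<phi>'_def intro: scaled_density_has_derivative u0)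
  from DERIV_cmult[OF this, of "1/2"]
  have "((\<lambda>t. vertical_energy A g h N p q (?\<sigma> t)) has_real_derivative 1/2 * (LINT x|?M. \<phi>' 0 x)) (at 0)"
    unfolding vertical_energy_density[OF sd(2)] sd(3) .
  moreover have "((\<lambda>t. vertical_energy A g h N p q (?\<sigma> t)) has_real_derivative 0) (at 0)"
    using harm scaling_variation[OF \<sigma> sd(1)] unfolding harmonic_section_def by blast
  \<comment> \<open>Harmonicity and differentiation under the integral give two values for one
    derivative.\<close>
  ultimately have "1/2 * (LINT x|?M. \<phi>' 0 x) = 0" by (rule DERIV_unique)
  then have int0: "(LINT x|?M. \<phi>' 0 x) = 0" by simp
  define B where "B x = 2 * c * (1 + u x) * (1 + q * u x) + q * (2 + (2 - p) * u x)" for x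
  have \<phi>'0: "\<phi>' 0 x = 2 * f x * (1 + u x) powr (-p - 1) * ((1 + (1 - p) * u x) * S x + B x * D x)" for x
    unfolding \<phi>'_def B_def by (rule scaled_density'_0[OF u0])
  have B: "B x \<ge> 0" for x
    unfolding B_def c_def by (rule bracket_nonneg[OF u0]) (use qu in \<open>simp add: u_def\<close>)
  have S0: "S x \<ge> 0" "D x \<ge> 0" for x
    using covariant_norm_sq_nonneg[OF \<sigma>] grad_norm_sq_nonneg by (auto simp: S_def D_def)
  have k': "1 + (1 - p) * u x \<ge> 0" for x using k by (simp add: u_def)
  have nonneg: "\<phi>' 0 x \<ge> 0" for x
    unfolding \<phi>'0 using B S0 k' by (simp add: f_def)
  have "continuous_on UNIV (\<lambda>x. (\<lambda>(t, x). \<phi>' t x) (0, x))"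
    by (rule continuous_on_compose2[OF cont']) (auto intro!: continuous_intros)
  then have "continuous_on UNIV (\<phi>' 0)" by simp
  from nonneg_integral_eq_0[OF comp this nonneg int0, of x]
  have "2 * f x * (1 + u x) powr (-p - 1) * ((1 + (1 - p) * u x) * S x + B x * D x) = 0"
    unfolding \<phi>'0 .
  moreover have "f x > 0" "(1 + u x) powr (-p - 1) > 0" using u0[of x] by (auto simp: f_def)
  ultimately have "(1 + (1 - p) * u x) * S x + B x * D x = 0" by simp
  moreover have "(1 + (1 - p) * u x) * S x \<ge> 0" "B x * D x \<ge> 0" using k' S0 B by auto
  ultimately show ?thesis unfolding u_def S_def by linarith
qed

text \<open>Only strictness at a single point is assumed: where the weight \<open>1 + (1 - p)|\<sigma>|\<^sup>2\<close> is positive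
  \<open>\<sigma>\<close> is parallel, so \<open>|\<sigma>|\<close> is locally constant there, and the positivity spreads over the connected manifold.\<close>

lemma positivity_spreads:
  assumes \<sigma>: "smooth_sec UNIV \<sigma>"
    and eq: "\<And>x. (1 + k * h x (\<sigma> x) (\<sigma> x)) * covariant_norm_sq g h N \<sigma> x = 0"
    and x0: "1 + k * h x0 (\<sigma> x0) (\<sigma> x0) > 0"
  shows "h x (\<sigma> x) (\<sigma> x) = h x0 (\<sigma> x0) (\<sigma> x0)"
proof -
  define u where "u x = h x (\<sigma> x) (\<sigma> x)" for x
  have u: "smooth_fun A UNIV u" unfolding u_def[abs_def] by (rule smooth_fun_h[OF open_UNIV \<sigma> \<sigma>])
  then have cont: "continuous_on UNIV u" using smooth_fun_continuous by blast
  let ?Z = "{x. u x = u x0}"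
  have "closed ?Z" using continuous_closed_vimage[of "{u x0}" u] cont
    by (simp add: vimage_def continuous_on_eq_continuous_within)
  moreover have "open ?Z"
  proof (subst open_subopen, intro ballI)
    fix x assume "x \<in> ?Z"
    \<comment> \<open>Positivity of the weight depends on \<open>u\<close> alone, so it passes from
      \<open>x0\<close> to every point of \<open>?Z\<close>; on the open set \<open>P\<close> the
      equation forces \<nabla>\<sigma> = 0 and hence du = 0.\<close>
    define P where "P = {x. 1 + k * u x > 0}"
    have "P = (\<lambda>x. 1 + k * u x) -` {0<..}" by (auto simp: P_def)
    moreover have "continuous_on UNIV (\<lambda>x. 1 + k * u x)" by (intro continuous_intros cont)
    ultimately have P: "open P" using open_vimage[of "{0<..}" "\<lambda>x. 1 + k * u x"] by simp
    have xP: "x \<in> P" using \<open>x \<in> ?Z\<close> x0 by (simp add: P_def u_def)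
    have du: "differential A u y v = 0" if "y \<in> P" for y v
    proof -
      have "covariant_norm_sq g h N \<sigma> y = 0" using eq[of y] that by (simp add: P_def u_def)
      then have "N \<sigma> y v = 0" by (rule covariant_norm_sq_eq_0[OF \<sigma>])
      then show ?thesis
        using differential_norm_sq[OF open_UNIV \<sigma> UNIV_I, of y v] h_zero[OF smooth_secD[OF \<sigma> UNIV_I], of y]
        by (simp add: u_def[abs_def])
    qed
    define c where "c = chart_at A x"
    have c: "c \<in> A" "x \<in> fst c" using chart_at by (auto simp: c_def)
    let ?W = "snd c ` (fst c \<inter> P)"
    have W: "open ?W" by (rule chart_open_image[OF c(1) P])
    moreover have "snd c x \<in> ?W" using c xP by auto
    ultimately obtain e where e: "e > 0" "ball (snd c x) e \<subseteq> ?W" using open_contains_ball by blast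
    have der: "((\<lambda>y. u (chart_inv c y)) has_derivative (\<lambda>w. 0)) (at y)" if yW: "y \<in> ?W" for y
    proof -
      obtain z where z: "y = snd c z" "z \<in> fst c" "z \<in> P" using yW by blast
      show ?thesis
        using smooth_fun_chart_has_derivative[OF c(1) z(2) open_UNIV UNIV_I u] du[OF z(3)] z(1) by simp
    qed
    have const: "u (chart_inv c y) = u x" if y: "y \<in> ball (snd c x) e" for y
    proof -
      \<comment> \<open>A coordinate ball is convex, so the vanishing derivative makes
        \<open>u\<close> constant on it.\<close>
      have "\<exists>d. \<forall>y\<in>ball (snd c x) e. u (chart_inv c y) = d"
        by (rule has_derivative_zero_constant[OF convex_ball])
          (use der e(2) in \<open>blast intro: has_derivative_at_withinI\<close>)
      then obtain d where d: "\<And>y. y \<in> ball (snd c x) e \<Longrightarrow> u (chart_inv c y) = d" by blast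
      have "u (chart_inv c (snd c x)) = d" by (rule d) (use e in simp)
      with d[OF y] c show ?thesis by simp
    qed
    have "open (chart_inv c ` ball (snd c x) e)"
      by (rule open_chart_inv_image[OF c(1)]) (use e in auto)
    moreover have "x \<in> chart_inv c ` ball (snd c x) e"
      using c e by (auto simp: image_iff intro!: bexI[of _ "snd c x"])
    moreover have "chart_inv c ` ball (snd c x) e \<subseteq> ?Z" using const \<open>x \<in> ?Z\<close> by auto
    ultimately show "\<exists>T. open T \<and> x \<in> T \<and> T \<subseteq> ?Z" by blast
  qed
  ultimately have "openin (top_of_set UNIV) ?Z" "closedin (top_of_set UNIV) ?Z"
    by (simp_all add: open_openin[symmetric] closed_closedin[symmetric])
  with connected_manifold have "?Z = {} \<or> ?Z = UNIV"
    unfolding connected_clopen by blast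
  then show ?thesis by (auto simp: u_def)
qed

text \<open>Divided by \<nu>, the Riemannian condition bounds the weight below by 1 - 1/\<nu>:
  positive outright for \<nu> > 1, merely nonnegative for \<nu> = 1, where
  \<open>positivity_spreads\<close> starts from the one point of strictness.\<close>

lemma harmonic_imp_parallel:
  assumes comp: "compact (UNIV :: 'm set)" and harm: "harmonic_section A g E r Fr h N p q \<sigma>"
    and q: "q \<ge> varrho \<nu> p"
    and riem: "(\<nu> > 1 \<and> riemannian_section h (\<nu> * (1 - p)) \<sigma>) \<or>
         (\<nu> = 1 \<and> strictly_riemannian_section h (1 - p) \<sigma>)"
  shows "parallel N \<sigma>"
proof -
  have \<sigma>: "smooth_sec UNIV \<sigma>" using harm by (simp add: harmonic_section_def)
  define u where "u x = h x (\<sigma> x) (\<sigma> x)" for x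
  have u0: "u x \<ge> 0" for x unfolding u_def by (rule h_nonneg[OF smooth_secD[OF \<sigma> UNIV_I]])
  have \<nu>: "\<nu> \<ge> 1" and \<nu>u: "\<nu> * ((1 - p) * u x) \<ge> -1" for x
    using riem by (auto simp: riemannian_section_def strictly_riemannian_section_def u_def mult.assoc)
  have k: "1 + (1 - p) * u x \<ge> 1 - 1 / \<nu>" for x
    using \<nu>u[of x] \<nu> by (simp add: field_simps)
  have k0: "1 + (1 - p) * u x \<ge> 0" for x
  proof -
    have "1 / \<nu> \<le> 1" using \<nu> by simp
    with k[of x] show ?thesis by linarith
  qed
  have qu: "1 + q * u x \<ge> 1/2" for x
  proof (cases "q \<ge> 0")
    case True
    then have "q * u x \<ge> 0" using u0 by simp
    then show ?thesis by simp
  next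
    case False
    \<comment> \<open>\<open>varrho \<nu> p\<close> is negative only for p > 2, so a negative
      \<open>q\<close> selects the last branch.\<close>
    then have p: "p > 2" and q': "q \<ge> \<nu> * (2 - p) / 2"
      using q by (auto simp: varrho_def split: if_splits)
    have "\<nu> * (2 - p) / 2 * u x \<le> q * u x" by (rule mult_right_mono[OF q' u0])
    \<comment> \<open>Lowering 2 - p to 1 - p reaches the Riemannian condition, and the factor 1/2
      in \<open>varrho\<close> leaves q u \<ge> -1/2.\<close>
    moreover have "\<nu> * ((2 - p) * u x) \<ge> \<nu> * ((1 - p) * u x)"
      using \<nu> u0[of x] by (intro mult_left_mono mult_right_mono) auto
    ultimately show ?thesis using \<nu>u[of x] by (simp add: mult.assoc)
  qed
  have eq: "(1 + (1 - p) * h x (\<sigma> x) (\<sigma> x)) * covariant_norm_sq g h N \<sigma> x = 0" for x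
    by (rule harmonic_weight_covariant_norm_sq[OF comp harm]) (use k0 qu in \<open>auto simp: u_def\<close>)
  have pos: "1 + (1 - p) * u x > 0" for x
  proof (cases "\<nu> > 1")
    case True
    then have "1 / \<nu> < 1" by simp
    with k[of x] show ?thesis by linarith
  next
    case False
    then obtain x0 where "(1 - p) * u x0 > -1"
      using riem by (auto simp: strictly_riemannian_section_def u_def)
    then have x0: "1 + (1 - p) * u x0 > 0" by simp
    then have "u x = u x0"
      unfolding u_def by (rule positivity_spreads[OF \<sigma> eq])
    with x0 show ?thesis by simp
  qed
  have "covariant_norm_sq g h N \<sigma> x = 0" for x
    using eq[of x] pos[of x] by (simp add: u_def)
  then show ?thesis
    using covariant_norm_sq_eq_0[OF \<sigma>] by (simp add: parallel_def)
qed

end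

theorem theorem4p6:
  fixes A :: "('m::{t2_space, second_countable_topology}, 'n::finite) chart set"
    and g :: "'m \<Rightarrow> real^'n \<Rightarrow> real^'n \<Rightarrow> real"
    and E :: "'m \<Rightarrow> 'v::real_vector set"
    and r :: nat
    and Fr :: "('m, 'v) frame set"
    and h :: "'m \<Rightarrow> 'v \<Rightarrow> 'v \<Rightarrow> real"
    and N :: "('m \<Rightarrow> 'v) \<Rightarrow> 'm \<Rightarrow> real^'n \<Rightarrow> 'v"
    and \<sigma> :: "'m \<Rightarrow> 'v"
    and \<nu> p q :: real
  assumes riem_bundle: "riemannian_vector_bundle A g E r Fr h N"
    and compact_M: "compact (UNIV :: 'm set)"
    and section_\<sigma>: "smooth_section A E r Fr UNIV \<sigma>"
    and "\<nu> > 0" and "p \<ge> -4" and "q \<ge> varrho \<nu> p"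
    and "(\<nu> > 1 \<and> riemannian_section h (\<nu> * (1 - p)) \<sigma>) \<or>
         (\<nu> = 1 \<and> strictly_riemannian_section h (1 - p) \<sigma>)"
  shows "harmonic_section A g E r Fr h N p q \<sigma> \<longleftrightarrow> parallel N \<sigma>"
proof -
  interpret riemannian_vector_bundle A g E r Fr h N by (rule riem_bundle)
  show ?thesis
    using harmonic_imp_parallel[OF compact_M _ \<open>q \<ge> varrho \<nu> p\<close> assms(7)]
      parallel_imp_harmonic[OF compact_M section_\<sigma>] by blast
qed

end
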